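(* Let $(W,S)$ be a Coxeter system, let $(Q,\phi)$ be a partial distinguished matching of $W$, and let $x,y\in Q$ be such that $x\lhd\phi(x)$ and $y\lhd\phi(y)$. Then $$R_{\phi(x),\phi(y)}=R_{x,y},\qquad R_{x,\phi(y)}=(q-1)R_{x,y}+qR_{\phi(x),y}.$$
   Context: $W$ carries the Bruhat order $\le$ and the length function $\ell$; $x\lhd y$ means that $y$ covers $x$ ($x<y$ with nothing strictly between); $\mathrm{coat}(y)=\{x : x\lhd y\}$. A subset $Q\subseteq W$ is decreasing if $q\in Q$ and $x\le q$ imply $x\in Q$. A partial distinguished matching of $W$ is a pair $(Q,\phi)$ with $Q\subseteq W$ decreasing and $\phi:Q\to Q$ such that: (i) $\phi(\phi(u))=u$ for all $u\in Q$; (ii) for all $u\in Q$, $u\lhd\phi(u)$ or $\phi(u)\lhd u$; (iii) for all $u\in Q$ with $u\lhd\phi(u)$, $\mathrm{coat}(\phi(u))=\{u\}\cup\{\phi(v): v\lhd u,\ v\lhd\phi(v)\}$. $R_{x,y}$ are the $R$-polynomials of $(W,S)$ in the variable $q$: $R_{x,y}=0$ unless $x\le y$, $R_{x,x}=1$, and if $s\in S$, $\ell(sx)>\ell(x)$, $\ell(sy)>\ell(y)$, then $R_{sx,sy}=R_{x,y}$ and $R_{x,sy}=(q-1)R_{x,y}+qR_{sx,y}$. *)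

theory Defs
  imports "HOL-Algebra.Algebra" "HOL-Computational_Algebra.Polynomial"
begin

definition word_val :: "('a, 'b) monoid_scheme \<Rightarrow> 'a list \<Rightarrow> 'a" where
  "word_val W w = foldr (\<otimes>\<^bsub>W\<^esub>) w \<one>\<^bsub>W\<^esub>"

text \<open>Deletion of one occurrence of a defining relator \<open>(st)\<^sup>m\<close>, where \<open>m\<close> is the order of \<open>st\<close>
  in \<open>W\<close>; \<open>group.ord\<close> is 0 on elements of infinite order, for which there is no relation.
  The case \<open>s = t\<close> gives the relator \<open>ss\<close> (as \<open>ss = 1\<close> has order 1), so that each letter is its
  own inverse modulo the relations and words without formal inverses suffice.\<close>

inductive coxeter_step :: "('a, 'b) monoid_scheme \<Rightarrow> 'a set \<Rightarrow> 'a list \<Rightarrow> 'a list \<Rightarrow> bool"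
  for W S where
  "\<lbrakk>u \<in> lists S; v \<in> lists S; s \<in> S; t \<in> S; m = group.ord W (s \<otimes>\<^bsub>W\<^esub> t); m \<noteq> 0\<rbrakk>
    \<Longrightarrow> coxeter_step W S (u @ concat (replicate m [s, t]) @ v) (u @ v)"

text \<open>The definition of Bourbaki, Lie IV.1.3: \<open>W\<close> is generated by the set \<open>S\<close> of involutions and is
  presented by the relators above. The set \<open>S\<close> may be infinite.\<close>

locale coxeter_system = group W for W (structure) +
  fixes S :: "'a set"
  assumes S_carrier: "S \<subseteq> carrier W"
    and S_involution: "s \<in> S \<Longrightarrow> ord s = 2"
    and S_generates: "generate W S = carrier W"
    and presentation: "\<lbrakk>u \<in> lists S; v \<in> lists S\<rbrakk>
          \<Longrightarrow> word_val W u = word_val W v \<longleftrightarrow> equivclp (coxeter_step W S) u v"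

definition cox_length :: "('a, 'b) monoid_scheme \<Rightarrow> 'a set \<Rightarrow> 'a \<Rightarrow> nat" where
  "cox_length W S x = (LEAST n. \<exists>w \<in> lists S. length w = n \<and> word_val W w = x)"

definition reflections :: "('a, 'b) monoid_scheme \<Rightarrow> 'a set \<Rightarrow> 'a set" where
  "reflections W S = {w \<otimes>\<^bsub>W\<^esub> s \<otimes>\<^bsub>W\<^esub> inv\<^bsub>W\<^esub> w | w s. w \<in> carrier W \<and> s \<in> S}"

definition bruhat_step :: "('a, 'b) monoid_scheme \<Rightarrow> 'a set \<Rightarrow> 'a \<Rightarrow> 'a \<Rightarrow> bool" where
  "bruhat_step W S x y \<longleftrightarrow> x \<in> carrier W \<and> y \<in> carrier W \<and>
     (\<exists>t \<in> reflections W S. y = t \<otimes>\<^bsub>W\<^esub> x) \<and> cox_length W S x < cox_length W S y"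

definition bruhat_le :: "('a, 'b) monoid_scheme \<Rightarrow> 'a set \<Rightarrow> 'a \<Rightarrow> 'a \<Rightarrow> bool" where
  "bruhat_le W S x y \<longleftrightarrow> x \<in> carrier W \<and> (bruhat_step W S)\<^sup>*\<^sup>* x y"

definition bruhat_less :: "('a, 'b) monoid_scheme \<Rightarrow> 'a set \<Rightarrow> 'a \<Rightarrow> 'a \<Rightarrow> bool" where
  "bruhat_less W S x y \<longleftrightarrow> bruhat_le W S x y \<and> x \<noteq> y"

definition bruhat_covered :: "('a, 'b) monoid_scheme \<Rightarrow> 'a set \<Rightarrow> 'a \<Rightarrow> 'a \<Rightarrow> bool" where
  "bruhat_covered W S x y \<longleftrightarrow>
     bruhat_less W S x y \<and> \<not> (\<exists>z. bruhat_less W S x z \<and> bruhat_less W S z y)"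

definition coat :: "('a, 'b) monoid_scheme \<Rightarrow> 'a set \<Rightarrow> 'a \<Rightarrow> 'a set" where
  "coat W S y = {x. bruhat_covered W S x y}"

definition decreasing :: "('a, 'b) monoid_scheme \<Rightarrow> 'a set \<Rightarrow> 'a set \<Rightarrow> bool" where
  "decreasing W S Q \<longleftrightarrow> Q \<subseteq> carrier W \<and> (\<forall>q \<in> Q. \<forall>x. bruhat_le W S x q \<longrightarrow> x \<in> Q)"

definition partial_distinguished_matching ::
  "('a, 'b) monoid_scheme \<Rightarrow> 'a set \<Rightarrow> 'a set \<Rightarrow> ('a \<Rightarrow> 'a) \<Rightarrow> bool" where
  "partial_distinguished_matching W S Q \<phi> \<longleftrightarrow>
     decreasing W S Q \<and> \<phi> \<in> Q \<rightarrow> Q \<and>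
     (\<forall>u \<in> Q. \<phi> (\<phi> u) = u) \<and>
     (\<forall>u \<in> Q. bruhat_covered W S u (\<phi> u) \<or> bruhat_covered W S (\<phi> u) u) \<and>
     (\<forall>u \<in> Q. bruhat_covered W S u (\<phi> u) \<longrightarrow>
        coat W S (\<phi> u) =
          {u} \<union> {\<phi> v | v. bruhat_covered W S v u \<and> bruhat_covered W S v (\<phi> v)})"

text \<open>The family of \<open>R\<close>-polynomials is the unique family with the following properties (values
  outside the carrier are irrelevant). The polynomial \<open>[:0, 1:]\<close> is the variable \<open>q\<close>.\<close>

definition R_polynomials ::
  "('a, 'b) monoid_scheme \<Rightarrow> 'a set \<Rightarrow> ('a \<Rightarrow> 'a \<Rightarrow> int poly) \<Rightarrow> bool" where
  "R_polynomials W S R \<longleftrightarrow>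
     (\<forall>x \<in> carrier W. \<forall>y \<in> carrier W. \<not> bruhat_le W S x y \<longrightarrow> R x y = 0) \<and>
     (\<forall>x \<in> carrier W. R x x = 1) \<and>
     (\<forall>x \<in> carrier W. \<forall>y \<in> carrier W. \<forall>s \<in> S.
        cox_length W S (s \<otimes>\<^bsub>W\<^esub> x) > cox_length W S x \<and>
        cox_length W S (s \<otimes>\<^bsub>W\<^esub> y) > cox_length W S y \<longrightarrow>
          R (s \<otimes>\<^bsub>W\<^esub> x) (s \<otimes>\<^bsub>W\<^esub> y) = R x y \<and>
          R x (s \<otimes>\<^bsub>W\<^esub> y) = ([:0, 1:] - 1) * R x y + [:0, 1:] * R (s \<otimes>\<^bsub>W\<^esub> x) y)"

end

(*
  Both formulas say that, for w = \<phi> y, the family h = R(-, w) is obtained from R(-, \<phi> w) by the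
  Hecke operator of \<phi>. For multiplication by a simple reflection, on the left, this is the defining
  recursion. It is carried from one matching f to another matching g, both defined on the lower
  interval of w and with f w and g w distinct and below w, by induction on the length of w: the orbit of
  w under f and g is a polygon whose bottom is some z, and on the orbits of the same size both
  alternating words of that length in the two operators agree (braid relation). On the orbits of
  another size f and g may be exchanged, because the matching that follows f on the orbits of the size
  of the orbit of w, and g elsewhere, is again special, so that the induction hypothesis applies to it;
  evaluated at f z it forces the operators of f and g to agree on R(-, z) there.
  That the patched matching is special rests on three facts on covers in the Bruhat order: intervals of
  length two have four elements, and no two elements have three common lower covers or three common
  upper covers. The last two come from the root system: the reflections involved have their
  roots in one plane, and the root of a cover is extremal among the inversions in that plane.
  Every matching is reached from a left multiplication, through a right multiplication if needed.
*)
theory Submission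
  imports Defs Complex_Main
begin

section \<open>Orbits of two special matchings\<close>

text \<open>The orbits of \<open>f\<close> and \<open>g\<close> in one lower interval may have
  different sizes, and the braid relation of length m is available only on the orbits of size m. The
  proof therefore never asks for an identity of operators: it compares the two words on the single
  function R(-, z). On the remaining orbits this needs an independent reason, namely that one more
  special matching, the patched one, computes R(-, f z); hence the induction is over all special
  matchings of the interval, not over a chosen family. The condition on coatoms is replaced by
  \<open>f u \<le> f v\<close> for covers u, v with v distinct from \<open>f u\<close>. This form
  passes to lower intervals, where the induction takes place, and it can be checked cover by cover
  for a patched map. The comparison needs f w and g w distinct, since otherwise the orbit of w is
  collapsed and carries no relation. So a left multiplication that sends w to f w cannot be compared
  with f at once; this is the origin of the detour through right multiplications, and of the final
  case in which w is a simple reflection.\<close>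

fun alt :: "('a \<Rightarrow> 'a) \<Rightarrow> ('a \<Rightarrow> 'a) \<Rightarrow> nat \<Rightarrow> 'a \<Rightarrow> 'a" where
  "alt f g 0 x = x"
| "alt f g (Suc n) x = f (alt g f n x)"

text \<open>The recursion peels off the outermost letter. Which letter is innermost depends on the
  parity of the length, and cancelling it against the argument needs this second form.\<close>

lemma alt_Suc_inner: "alt f g (Suc n) x = alt f g n ((if even n then f else g) x)"
proof (induction n arbitrary: f g)
  case (Suc n)
  have "alt f g (Suc (Suc n)) x = f (alt g f (Suc n) x)"
    by simp
  also have "\<dots> = f (alt g f n ((if even n then g else f) x))"
    by (simp only: Suc.IH)
  finally show ?case
    by simp
qed simp

text \<open>Half the number of steps after which the orbit of \<open>u\<close> under \<open>f\<close> and \<open>g\<close> closes up.\<close>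

definition kap :: "('a \<Rightarrow> 'a) \<Rightarrow> ('a \<Rightarrow> 'a) \<Rightarrow> 'a \<Rightarrow> nat" where
  "kap f g u = (LEAST n. 1 \<le> n \<and> alt f g n u = alt g f n u)"

lemma kap_commute: "kap f g u = kap g f u"
  unfolding kap_def by (rule arg_cong[where f = Least]) (auto simp: fun_eq_iff)

text \<open>By parity exactly one of the two words has innermost letter \<open>f\<close>, which
  cancels against \<open>f u\<close>. The other word applied to \<open>f u\<close> is a word of
  length n + 1 at \<open>u\<close>, and \<open>eq\<close> rewrites all but its outer letter.\<close>

lemma alt_eq_step:
  assumes ff: "\<And>u. u \<in> Q \<Longrightarrow> f (f u) = u" and gg: "\<And>u. u \<in> Q \<Longrightarrow> g (g u) = u"
    and Q: "\<And>u. u \<in> Q \<Longrightarrow> f u \<in> Q" "\<And>u. u \<in> Q \<Longrightarrow> g u \<in> Q" and u: "u \<in> Q"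
    and eq: "alt f g n u = alt g f n u"
  shows "alt f g n (f u) = alt g f n (f u)"
proof (cases n)
  case (Suc k)
  have clos: "alt f g i u \<in> Q \<and> alt g f i u \<in> Q" for i
    by (induction i) (auto simp: Q u)
  show ?thesis
  proof (cases "even k")
    case True
    have "alt f g n (f u) = alt f g k (f (f u))"
      using True alt_Suc_inner[of f g k "f u"] by (simp add: Suc)
    also have "\<dots> = g (g (alt f g k u))"
      using ff[OF u] gg clos by simp
    also have "\<dots> = g (alt g f n u)" by (simp add: Suc)
    also have "\<dots> = alt g f (Suc n) u" using eq by simp
    also have "\<dots> = alt g f n (f u)" using True by (simp only: alt_Suc_inner Suc) simp
    finally show ?thesis .
  next
    case False
    have "alt g f n (f u) = alt g f k (f (f u))"
      using False alt_Suc_inner[of g f k "f u"] by (simp add: Suc)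
    also have "\<dots> = f (f (alt g f k u))"
      using ff[OF u] ff clos by simp
    also have "\<dots> = f (alt f g n u)" by (simp add: Suc)
    also have "\<dots> = alt f g (Suc n) u" using eq by simp
    also have "\<dots> = alt f g n (f u)" using False by (simp only: alt_Suc_inner Suc) simp
    finally show ?thesis by simp
  qed
qed simp

section \<open>Graded posets and special matchings\<close>

locale graded_poset =
  fixes le :: "'a \<Rightarrow> 'a \<Rightarrow> bool" and len :: "'a \<Rightarrow> nat"
  assumes le_trans: "le x y \<Longrightarrow> le y z \<Longrightarrow> le x z"
    and le_len: "le x y \<Longrightarrow> x = y \<or> len x < len y"
    and atom_below: "le x y \<Longrightarrow> x \<noteq> y \<Longrightarrow> \<exists>z. le x z \<and> len z = Suc (len x) \<and> le z y"
begin

text \<open>Length difference one stands for the cover relation: \<open>le_len\<close> leaves no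
  room in between, and \<open>atom_below\<close> finds such a step inside every strict
  relation.\<close>

definition cov :: "'a \<Rightarrow> 'a \<Rightarrow> bool" where
  "cov x y \<longleftrightarrow> le x y \<and> len y = Suc (len x)"

text \<open>Brenti's special matchings, on a lower set \<open>Q\<close>. The last condition asks for
  \<open>le\<close> and not for a cover because the lengths of \<open>f u\<close> and
  \<open>f v\<close> differ by three when \<open>f\<close> lowers \<open>u\<close> and raises
  \<open>v\<close>.\<close>

definition special :: "'a set \<Rightarrow> ('a \<Rightarrow> 'a) \<Rightarrow> bool" where
  "special Q f \<longleftrightarrow> (\<forall>x y. y \<in> Q \<longrightarrow> le x y \<longrightarrow> x \<in> Q) \<and>
     (\<forall>u \<in> Q. f u \<in> Q \<and> f (f u) = u \<and> (cov u (f u) \<or> cov (f u) u)) \<and>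
     (\<forall>u v. v \<in> Q \<longrightarrow> cov u v \<longrightarrow> v \<noteq> f u \<longrightarrow> le (f u) (f v))"

abbreviation up :: "('a \<Rightarrow> 'a) \<Rightarrow> 'a \<Rightarrow> bool" where
  "up f u \<equiv> cov u (f u)"

lemma cov_le: "cov x y \<Longrightarrow> le x y" and cov_len: "cov x y \<Longrightarrow> len y = Suc (len x)"
  by (auto simp: cov_def)

lemma cov_asym: "cov x y \<Longrightarrow> \<not> cov y x"
  by (auto simp: cov_def)

lemma sp_Q: "special Q f \<Longrightarrow> u \<in> Q \<Longrightarrow> f u \<in> Q"
  and sp_inv: "special Q f \<Longrightarrow> u \<in> Q \<Longrightarrow> f (f u) = u"
  and sp_down: "special Q f \<Longrightarrow> u \<in> Q \<Longrightarrow> \<not> up f u \<Longrightarrow> cov (f u) u"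
  and sp_dec: "special Q f \<Longrightarrow> v \<in> Q \<Longrightarrow> le u v \<Longrightarrow> u \<in> Q"
  and sp_le: "special Q f \<Longrightarrow> v \<in> Q \<Longrightarrow> cov u v \<Longrightarrow> v \<noteq> f u \<Longrightarrow> le (f u) (f v)"
  unfolding special_def by blast+

lemma sp_up_iff: "special Q f \<Longrightarrow> u \<in> Q \<Longrightarrow> up f (f u) \<longleftrightarrow> \<not> up f u"
  using sp_inv sp_down cov_asym by metis

text \<open>If \<open>f\<close> lowered \<open>v\<close>, then \<open>f v\<close> would be shorter
  than \<open>f u\<close>, against \<open>f u \<le> f v\<close>.\<close>

lemma sp_up:
  assumes "special Q f" "v \<in> Q" "cov u v" "v \<noteq> f u" "up f u"
  shows "up f v \<and> cov (f u) (f v)"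
proof -
  have l: "le (f u) (f v)" using assms sp_le by blast
  have "up f v"
  proof (rule ccontr)
    assume "\<not> up f v"
    then have "cov (f v) v" using assms sp_down by blast
    then have "len (f v) < len (f u)"
      using cov_len[OF assms(3)] cov_len[OF assms(5)] cov_len[of "f v" v] by linarith
    then show False using le_len[OF l] by auto
  qed
  then show ?thesis using l assms(3,5) by (auto simp: cov_def)
qed

lemma sp_dn:
  assumes "special Q f" "v \<in> Q" "cov u v" "v \<noteq> f u" "\<not> up f v"
  shows "\<not> up f u \<and> cov (f u) (f v)"
proof -
  have u: "u \<in> Q" using assms cov_le sp_dec by blast
  have l: "le (f u) (f v)" using assms sp_le by blast
  have n: "\<not> up f u" using sp_up assms by blast
  then have "cov (f u) u" "cov (f v) v" using sp_down assms u by blast+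
  then show ?thesis using n l assms(3) by (auto simp: cov_def)
qed

text \<open>The lifting property. Climb from \<open>x\<close> towards \<open>y\<close> by one cover
  \<open>z\<close>: either \<open>z = f x\<close>, or \<open>f x \<le> f z\<close>, and
  \<open>f z \<le> y\<close> by induction.\<close>

lemma sp_lift:
  assumes f: "special Q f" and "y \<in> Q" "\<not> up f y" "le x y"
  shows "le (f x) y"
  using assms(4)
proof (induction "len y - len x" arbitrary: x rule: less_induct)
  case less
  have yy: "cov (f y) y" using sp_down f assms by blast
  show ?case
  proof (cases "x = y")
    case False
    then obtain z where z: "le x z" "len z = Suc (len x)" "le z y"
      using atom_below less.prems by blast
    have zQ: "z \<in> Q" using z f assms sp_dec by blast
    have c: "cov x z" using z by (simp add: cov_def)
    have "len x < len y" using le_len[OF less.prems] False by simp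
    then have "le (f z) y" using less.hyps[of z] z by simp
    then show ?thesis
      using z sp_le[OF f zQ c] le_trans by blast
  qed (use yy cov_le in blast)
qed

end

locale thin_poset = graded_poset +
  assumes diamond: "cov x u \<Longrightarrow> cov u y \<Longrightarrow> \<exists>v. v \<noteq> u \<and> (\<forall>z. cov x z \<and> cov z y \<longleftrightarrow> z = u \<or> z = v)"
    and K32: "\<lbrakk>b1 \<noteq> b2; a1 \<noteq> a2; a1 \<noteq> a3; a2 \<noteq> a3; cov a1 b1; cov a2 b1; cov a3 b1;
               cov a1 b2; cov a2 b2; cov a3 b2\<rbrakk> \<Longrightarrow> False"
    and K23: "\<lbrakk>b1 \<noteq> b2; a1 \<noteq> a2; a1 \<noteq> a3; a2 \<noteq> a3; cov b1 a1; cov b1 a2; cov b1 a3;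
               cov b2 a1; cov b2 a2; cov b2 a3\<rbrakk> \<Longrightarrow> False"
begin

lemma three_between:
  assumes "cov x u" "cov x v" "cov x w" "cov u y" "cov v y" "cov w y" "u \<noteq> v" "u \<noteq> w" "v \<noteq> w"
  shows False
  using diamond[OF assms(1,4)] assms by metis

end

text \<open>The bound \<open>N\<close> stops ascending alternating chains, so that every orbit
  closes up to a finite polygon.\<close>

locale bounded_ideal = thin_poset +
  fixes Q :: "'a set" and N :: nat
  assumes bound: "u \<in> Q \<Longrightarrow> len u \<le> N"
begin

abbreviation sp where "sp \<equiv> special Q"

definition bot :: "('a \<Rightarrow> 'a) \<Rightarrow> ('a \<Rightarrow> 'a) \<Rightarrow> 'a \<Rightarrow> bool" where
  "bot f g x \<longleftrightarrow> x \<in> Q \<and> up f x \<and> up g x"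

lemma bot_commute: "bot f g x \<longleftrightarrow> bot g f x"
  by (auto simp: bot_def)

lemma alt_Q: "sp f \<Longrightarrow> sp g \<Longrightarrow> x \<in> Q \<Longrightarrow> alt f g n x \<in> Q"
  by (induction n arbitrary: f g) (auto intro: sp_Q)

lemma kap_f:
  assumes "sp f" "sp g" "u \<in> Q"
  shows "kap f g (f u) = kap f g u"
proof -
  have "alt f g n (f u) = alt g f n (f u) \<longleftrightarrow> alt f g n u = alt g f n u" for n
  proof -
    note step = alt_eq_step[of Q f g _ n, OF sp_inv[OF assms(1)] sp_inv[OF assms(2)]
        sp_Q[OF assms(1)] sp_Q[OF assms(2)]]
    show ?thesis
      using step[of u] step[of "f u"] assms(3) sp_Q[OF assms(1,3)] sp_inv[OF assms(1,3)] by auto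
  qed
  then show ?thesis by (simp add: kap_def)
qed

lemma kap_g: "sp f \<Longrightarrow> sp g \<Longrightarrow> u \<in> Q \<Longrightarrow> kap f g (g u) = kap f g u"
  using kap_f[of g f u] by (simp add: kap_commute)

lemma kap_alt: "sp f \<Longrightarrow> sp g \<Longrightarrow> x \<in> Q \<Longrightarrow> kap f g (alt f g n x) = kap f g x"
proof (induction n arbitrary: f g)
  case (Suc n)
  have "kap f g (alt f g (Suc n) x) = kap f g (alt g f n x)"
    using kap_f Suc.prems alt_Q by simp
  also have "\<dots> = kap g f (alt g f n x)" by (rule kap_commute)
  also have "\<dots> = kap g f x" using Suc by blast
  finally show ?case by (simp only: kap_commute[of g f])
qed simp

lemma kap_alt': "sp f \<Longrightarrow> sp g \<Longrightarrow> x \<in> Q \<Longrightarrow> kap f g (alt g f n x) = kap f g x"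
  using kap_alt[of g f x n] by (simp only: kap_commute[of f g])


section \<open>Orbits as polygons\<close>

text \<open>As long as the two chains above a bottom stay apart, the orbit looks like the Bruhat
  order of a dihedral group: each element covers both elements of the level below. One of these
  covers is the matching itself; the other is the previous edge of the opposite chain, moved by
  \<open>f\<close> or \<open>g\<close>.\<close>

lemma orbit_structure:
  assumes f: "sp f" and g: "sp g" and x: "bot f g x"
    and "\<And>j. 1 \<le> j \<Longrightarrow> j < i \<Longrightarrow> alt f g j x \<noteq> alt g f j x"
  shows "len (alt f g i x) = len x + i \<and> len (alt g f i x) = len x + i \<and>
    (1 \<le> i \<longrightarrow> cov (alt f g (i - 1) x) (alt f g i x) \<and> cov (alt g f (i - 1) x) (alt g f i x)) \<and>
    (i = 0 \<or> alt f g i x \<noteq> alt g f i x \<longrightarrow> up g (alt f g i x) \<and> up f (alt g f i x))"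
  using assms(4)
proof (induction i)
  case 0
  then show ?case using x by (simp add: bot_def)
next
  case (Suc i)
  let ?S = "\<lambda>i. alt f g i x" and ?M = "\<lambda>i. alt g f i x"
  have IH: "len (?S i) = len x + i" "len (?M i) = len x + i"
    "1 \<le> i \<Longrightarrow> cov (?S (i - 1)) (?S i)" "1 \<le> i \<Longrightarrow> cov (?M (i - 1)) (?M i)"
    using Suc.IH Suc.prems by auto
  have ne: "1 \<le> i \<Longrightarrow> ?S i \<noteq> ?M i" using Suc.prems[of i] by simp
  have ups: "up g (?S i)" "up f (?M i)" using Suc.IH Suc.prems ne by (cases i; auto)+
  have xQ: "x \<in> Q" using x by (simp add: bot_def)
  have Q: "?S n \<in> Q" "?M n \<in> Q" for n using alt_Q f g xQ by auto
  have SM: "cov (?M i) (?S (Suc i))" "cov (?S i) (?M (Suc i))" using ups by auto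
  have cross: "cov (?S i) (?S (Suc i)) \<and> cov (?M i) (?M (Suc i))"
  proof (cases i)
    case 0
    then show ?thesis using x by (simp add: bot_def)
  next
    case k: (Suc k)
    have ne: "?S i \<noteq> ?M i" using ne k by simp
    have c: "cov (?S k) (?S i)" "cov (?M k) (?M i)" using IH k by auto
    have eq: "f (?M k) = ?S i" "g (?S k) = ?M i" using k by auto
    have l: "len (?S i) = len (?M i)" using IH by simp
    have u: "up f (?M k)" "up g (?S k)"
      using sp_down[OF f Q(2)[of k]] sp_down[OF g Q(1)[of k]]
        cov_len[OF c(1)] cov_len[OF c(2)] l cov_len[of "f (?M k)" "?M k"] cov_len[of "g (?S k)" "?S k"]
      unfolding eq by linarith+
    have "cov (f (?M k)) (f (?M i))" "cov (g (?S k)) (g (?S i))"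
      using sp_up[OF f Q(2) c(2) _ u(1)] sp_up[OF g Q(1) c(1) _ u(2)] ne
      unfolding eq by auto
    then show ?thesis using k by simp
  qed
  have top: "up g (?S (Suc i)) \<and> up f (?M (Suc i))" if n: "?S (Suc i) \<noteq> ?M (Suc i)"
  proof -
    have "?S (Suc i) \<noteq> g (?S i)" "?M (Suc i) \<noteq> f (?M i)" using n by auto
    then show ?thesis
      using sp_up[OF g Q(1) conjunct1[OF cross] _ ups(1)] sp_up[OF f Q(2) conjunct2[OF cross] _ ups(2)]
      by blast
  qed
  have "len (?S (Suc i)) = len x + Suc i" "len (?M (Suc i)) = len x + Suc i"
    using cov_len[OF SM(1)] cov_len[OF SM(2)] IH(1,2) by linarith+
  then show ?case using cross top by (metis diff_Suc_1 nat.distinct(1))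
qed

lemma kap_bot:
  assumes "sp f" "sp g" "bot f g x"
  shows "\<exists>n\<ge>1. alt f g n x = alt g f n x"
proof (rule ccontr)
  assume n: "\<not> ?thesis"
  have "len (alt f g (Suc N) x) = len x + Suc N"
    using orbit_structure[OF assms, of "Suc N"] n by blast
  moreover have "alt f g (Suc N) x \<in> Q" using alt_Q[OF assms(1,2)] assms(3) unfolding bot_def by blast
  ultimately show False using bound by fastforce
qed

text \<open>A bottom is settled by the length bound. From any other element one matching goes down,
  and \<open>alt_eq_step\<close> carries the closing relation back up.\<close>

lemma kap_exists:
  assumes "sp f" "sp g" "u \<in> Q"
  shows "\<exists>n\<ge>1. alt f g n u = alt g f n u"
  using assms
proof (induction "len u" arbitrary: f g u rule: less_induct)
  case less
  have down: "\<exists>n\<ge>1. alt f' g' n u = alt g' f' n u" if s: "sp f'" "sp g'" "\<not> up f' u" for f' g'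
  proof -
    have c: "cov (f' u) u" using sp_down s less by blast
    have Q: "f' u \<in> Q" using sp_Q s less by blast
    obtain n where n: "n \<ge> 1" "alt f' g' n (f' u) = alt g' f' n (f' u)"
      using less.hyps[of "f' u"] cov_len[OF c] s Q by auto
    have "alt f' g' n (f' (f' u)) = alt g' f' n (f' (f' u))"
      by (rule alt_eq_step[of Q, OF _ _ _ _ Q n(2)]) (use s sp_inv sp_Q in blast)+
    then show ?thesis using n sp_inv s less.prems by metis
  qed
  show ?case
  proof (cases "bot f g u")
    case False
    then have "\<not> up f u \<or> \<not> up g u" using less by (simp add: bot_def)
    then show ?thesis using down[of f g] down[of g f] less.prems by metis
  qed (use kap_bot less in blast)
qed

lemma kap_eq:
  assumes "sp f" "sp g" "u \<in> Q"
  shows "1 \<le> kap f g u" "alt f g (kap f g u) u = alt g f (kap f g u) u"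
  using LeastI_ex[OF kap_exists[OF assms, unfolded Bex_def]] unfolding kap_def by auto

lemma kap_min: "1 \<le> j \<Longrightarrow> j < kap f g u \<Longrightarrow> alt f g j u \<noteq> alt g f j u"
  unfolding kap_def using not_less_Least by blast

lemma kap_1: "sp f \<Longrightarrow> sp g \<Longrightarrow> u \<in> Q \<Longrightarrow> kap f g u < 2 \<Longrightarrow> f u = g u"
  using kap_eq[of f g u] by (metis One_nat_def alt.simps less_2_cases_iff not_one_le_zero)

context
  fixes f g x
  assumes f: "sp f" and g: "sp g" and x: "bot f g x"
begin

lemma orbit_facts: "i \<le> kap f g x \<Longrightarrow> len (alt f g i x) = len x + i \<and> len (alt g f i x) = len x + i \<and>
    (1 \<le> i \<longrightarrow> cov (alt f g (i - 1) x) (alt f g i x) \<and> cov (alt g f (i - 1) x) (alt g f i x)) \<and>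
    (i = 0 \<or> alt f g i x \<noteq> alt g f i x \<longrightarrow> up g (alt f g i x) \<and> up f (alt g f i x))"
proof -
  assume "i \<le> kap f g x"
  then have "\<And>j. 1 \<le> j \<Longrightarrow> j < i \<Longrightarrow> alt f g j x \<noteq> alt g f j x"
    using kap_min[of _ f g x] by (meson less_le_trans)
  from orbit_structure[OF f g x this] show ?thesis by blast
qed

lemma bot_Q: "x \<in> Q"
  using x by (simp add: bot_def)

lemma orb_len: "i \<le> kap f g x \<Longrightarrow> len (alt f g i x) = len x + i"
  and orb_len': "i \<le> kap f g x \<Longrightarrow> len (alt g f i x) = len x + i"
  using orbit_facts by blast+

lemma orb_cross: "i < kap f g x \<Longrightarrow> cov (alt f g i x) (alt f g (Suc i) x)"
  and orb_cross': "i < kap f g x \<Longrightarrow> cov (alt g f i x) (alt g f (Suc i) x)"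
  using orbit_facts[of "Suc i"] by auto

lemma orb_up: "i < kap f g x \<Longrightarrow> up g (alt f g i x)"
  and orb_up': "i < kap f g x \<Longrightarrow> up f (alt g f i x)"
  using orbit_facts[of i] kap_min[of i f g x] by (cases i; auto)+

lemma orb_dn: "1 \<le> i \<Longrightarrow> i \<le> kap f g x \<Longrightarrow> \<not> up f (alt f g i x)"
  and orb_dn': "1 \<le> i \<Longrightarrow> i \<le> kap f g x \<Longrightarrow> \<not> up g (alt g f i x)"
proof -
  assume i: "1 \<le> i" "i \<le> kap f g x"
  then obtain j where j: "i = Suc j" "j < kap f g x" by (cases i) auto
  have "alt g f j x \<in> Q" "alt f g j x \<in> Q" using alt_Q f g bot_Q by auto
  then show "\<not> up f (alt f g i x)" "\<not> up g (alt g f i x)"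
    using orb_up[OF j(2)] orb_up'[OF j(2)] sp_up_iff f g by (simp_all add: j)
qed

lemma orb_top_dn: "\<not> up f (alt f g (kap f g x) x)" "\<not> up g (alt f g (kap f g x) x)"
  using orb_dn[of "kap f g x"] orb_dn'[of "kap f g x"] kap_eq[OF f g bot_Q] by auto

end

text \<open>Descend by some matching \<open>r\<close> that lowers \<open>u\<close> until both
  matchings go up. On the way back \<open>r\<close> raises \<open>r u\<close>, so \<open>r u\<close>
  is not the top of its polygon and one more letter stays on one of its two chains.\<close>

lemma orbit_rep:
  assumes "sp f" "sp g" "u \<in> Q"
  shows "\<exists>a b i x. (a = f \<and> b = g \<or> a = g \<and> b = f) \<and> bot a b x \<and> i \<le> kap a b x \<and> u = alt a b i x"
  using assms(3)
proof (induction "len u" arbitrary: u rule: less_induct)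
  case less
  show ?case
  proof (cases "bot f g u")
    case True
    then show ?thesis by (intro exI[of _ f] exI[of _ g] exI[of _ 0] exI[of _ u]) simp
  next
    case False
    then obtain r r' where r: "r = f \<and> r' = g \<or> r = g \<and> r' = f" "\<not> up r u"
      using less by (auto simp: bot_def)
    then have spr: "sp r" "sp r'" using assms by auto
    have c: "cov (r u) u" using sp_down spr r less by blast
    have Q: "r u \<in> Q" using sp_Q spr less by blast
    have ru: "up r (r u)" using sp_up_iff spr r less by blast
    obtain a b i x where ab: "a = f \<and> b = g \<or> a = g \<and> b = f" "bot a b x" "i \<le> kap a b x"
      "r u = alt a b i x"
      using less.hyps[of "r u"] cov_len[OF c] Q by auto
    have spab: "sp a" "sp b" using ab assms by auto
    have k: "i < kap a b x"
    proof (rule ccontr)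
      assume "\<not> ?thesis"
      then have "i = kap a b x" using ab by simp
      then have "\<not> up a (r u)" "\<not> up b (r u)" using orb_top_dn[OF spab ab(2)] ab(4) by auto
      then show False using ru r ab by metis
    qed
    have u: "u = r (alt a b i x)" using ab(4) sp_inv spr less.prems by metis
    have xQ: "x \<in> Q" using ab by (simp add: bot_def)
    consider "r = b" | "r = a" "i = 0" | j where "r = a" "i = Suc j"
      using r ab by (cases i) auto
    then show ?thesis
    proof cases
      case 1
      then have "u = alt b a (Suc i) x" using u by simp
      then show ?thesis using ab k
        by (intro exI[of _ b] exI[of _ a] exI[of _ "Suc i"] exI[of _ x])
          (auto simp: bot_commute kap_commute[of b a])
    next
      case 2
      then have "u = alt a b (Suc 0) x" using u by simp
      then show ?thesis using ab k 2
        by (intro exI[of _ a] exI[of _ b] exI[of _ "Suc 0"] exI[of _ x]) auto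
    next
      case 3
      then have "u = alt b a j x" using u sp_inv spab alt_Q xQ by simp
      then show ?thesis using ab k 3
        by (intro exI[of _ b] exI[of _ a] exI[of _ j] exI[of _ x])
          (auto simp: bot_commute kap_commute[of b a])
    qed
  qed
qed

section \<open>Covers between orbits of different sizes\<close>

text \<open>Orbits of different sizes are disjoint, so the cover of the bottoms is carried up along
  both chains. If the upper orbit closes first, an interval of length two gets three middle
  elements. If the lower one closes first, two elements get three common lower covers;
  \<open>k2\<close> keeps two of these apart.\<close>

lemma parallel_orbits:
  assumes f: "sp f" and g: "sp g" and x: "bot f g x" and x': "bot f g x'" and c: "cov x x'"
    and k2: "2 \<le> kap f g x" and ne: "kap f g x \<noteq> kap f g x'"
  shows False
proof -
  let ?S = "\<lambda>i. alt f g i x" and ?M = "\<lambda>i. alt g f i x"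
  let ?S' = "\<lambda>i. alt f g i x'" and ?M' = "\<lambda>i. alt g f i x'"
  let ?k = "kap f g x" and ?k' = "kap f g x'"
  have xQ: "x \<in> Q" "x' \<in> Q" using x x' by (auto simp: bot_def)
  have Q: "?S n \<in> Q" "?M n \<in> Q" "?S' n \<in> Q" "?M' n \<in> Q" for n using alt_Q f g xQ by auto
  have kp: "kap f g (?S n) = ?k" "kap f g (?M n) = ?k" "kap f g (?S' n) = ?k'" "kap f g (?M' n) = ?k'" for n
    using kap_alt[OF f g] kap_alt'[OF f g] xQ by auto
  have diff: "?S i \<noteq> ?S' j" "?S i \<noteq> ?M' j" "?M i \<noteq> ?S' j" "?M i \<noteq> ?M' j" for i j
    using kp ne by metis+
  have cv: "i \<le> ?k \<Longrightarrow> cov (?S i) (?S' i) \<and> cov (?M i) (?M' i)" for i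
  proof (induction i)
    case (Suc i)
    then have I: "cov (?S i) (?S' i)" "cov (?M i) (?M' i)" and i: "i < ?k" by auto
    have n: "?S' i \<noteq> g (?S i)" "?M' i \<noteq> f (?M i)"
      using diff(3)[of "Suc i" i] diff(2)[of "Suc i" i] by auto
    show ?case
      using sp_up[OF f Q(4) I(2) n(2) orb_up'[OF f g x i]] sp_up[OF g Q(3) I(1) n(1) orb_up[OF f g x i]]
      by simp
  qed (use c in simp)
  show False
  proof (cases "?k' < ?k")
    case True
    obtain j where j: "?k' = Suc j" using kap_eq(1)[OF f g xQ(2)] by (cases ?k') auto
    have e: "?S' (Suc j) = ?M' (Suc j)" using kap_eq(2)[OF f g xQ(2)] j by simp
    have "?S (Suc j) \<noteq> ?M (Suc j)" using kap_min[of "Suc j" f g x] True j by simp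
    moreover have "cov (?S j) (?S (Suc j))" using orb_cross[OF f g x] True j by simp
    moreover have "cov (?S j) (?M (Suc j))" using orb_up[OF f g x, of j] True j by simp
    moreover have "cov (?S' j) (?S' (Suc j))" using orb_cross[OF f g x'] j by simp
    moreover have "cov (?S j) (?S' j)" "cov (?S (Suc j)) (?S' (Suc j))" "cov (?M (Suc j)) (?S' (Suc j))"
      using cv[of j] cv[of "Suc j"] True j e by (simp_all del: alt.simps)
    ultimately show False
      using three_between[of "?S j" "?S (Suc j)" "?M (Suc j)" "?S' j" "?S' (Suc j)"] diff by blast
  next
    case False
    then have lt: "?k < ?k'" using ne by simp
    obtain j where j: "?k = Suc j" "1 \<le> j" using k2 by (cases ?k) auto
    have e: "?S (Suc j) = ?M (Suc j)" using kap_eq(2)[OF f g xQ(1)] j by simp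
    have "?S' (Suc j) \<noteq> ?M' (Suc j)" "?S' j \<noteq> ?M' j"
      using kap_min[of "Suc j" f g x'] kap_min[of j f g x'] lt j by auto
    moreover have "cov (?S' j) (?S' (Suc j))" "cov (?M' j) (?M' (Suc j))"
      using orb_cross[OF f g x'] orb_cross'[OF f g x'] lt j by simp_all
    moreover have "cov (?S' j) (?M' (Suc j))" "cov (?M' j) (?S' (Suc j))"
      using orb_up[OF f g x', of j] orb_up'[OF f g x', of j] lt j by simp_all
    moreover have "cov (?S (Suc j)) (?S' (Suc j))" "cov (?S (Suc j)) (?M' (Suc j))"
      using cv[of "Suc j"] j e by auto
    ultimately show False
      using K32[of "?S' (Suc j)" "?M' (Suc j)" "?S (Suc j)" "?S' j" "?M' j"] diff by blast
  qed
qed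

text \<open>The two ends of the cover share their outer letter, which lowers both and can be
  stripped. If the word over \<open>y\<close> runs out, a cover of \<open>y\<close> itself remains;
  if the word over the bottom \<open>x\<close> runs out, the cover is a matching edge and both ends
  were in one orbit.\<close>

lemma descend_cover:
  assumes "sp a" "sp b" "bot a b x" "bot a b y" "p < kap a b x" "i \<le> kap a b y"
    and "cov (alt a b p x) (alt a b i y)"
  shows "alt a b i y = alt a b (Suc p) x \<or>
    i \<le> p \<and> (cov (alt a b (p - i) x) y \<or> cov (alt b a (p - i) x) y)"
  using assms
proof (induction i arbitrary: a b p)
  case (Suc i)
  note pr = Suc.prems
  have Q: "x \<in> Q" "y \<in> Q" using pr by (auto simp: bot_def)
  have vQ: "alt a b (Suc i) y \<in> Q" using alt_Q pr Q by blast
  have dn: "\<not> up a (alt a b (Suc i) y)" using orb_dn[OF pr(1,2,4) _ pr(6)] by (simp del: alt.simps)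
  show ?case
  proof (cases p)
    case 0
    have "alt a b (Suc i) y = a x"
      using sp_dn[OF pr(1) vQ, of x] pr(3,7) 0 dn by (auto simp: bot_def)
    then show ?thesis using 0 by simp
  next
    case (Suc q)
    have dnu: "\<not> up a (alt a b p x)" using orb_dn[OF pr(1,2,3), of p] pr(5) Suc by simp
    then have "alt a b (Suc i) y \<noteq> a (alt a b p x)" using pr(7) by auto
    then have "cov (a (alt a b p x)) (a (alt a b (Suc i) y))"
      using sp_dn[OF pr(1) vQ pr(7)] dn by blast
    then have c: "cov (alt b a q x) (alt b a i y)"
      using sp_inv[OF pr(1) alt_Q[OF pr(2,1) Q(1)]] sp_inv[OF pr(1) alt_Q[OF pr(2,1) Q(2)]] Suc by simp
    have "alt b a i y = alt b a (Suc q) x \<or>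
      i \<le> q \<and> (cov (alt b a (q - i) x) y \<or> cov (alt a b (q - i) x) y)"
      using Suc.IH[OF pr(2,1) _ _ _ _ c] pr Suc
      by (simp add: bot_commute[of b a] kap_commute[of b a] del: alt.simps)
    then show ?thesis using Suc by (auto simp del: alt.simps(2)) (simp_all)
  qed
qed simp

text \<open>An inner element of the lower orbit can be covered by the bottom of another orbit only
  right below the top, and then the opposite element of that level is covered too. The induction on
  the height \<open>j\<close> exchanges the roles of \<open>f\<close> and \<open>g\<close> when it
  goes down one step.\<close>

lemma cover_to_bot:
  assumes "sp f" "sp g" "bot f g x" "bot f g x'" "2 \<le> kap f g x" "2 \<le> kap f g x'"
    "kap f g x \<noteq> kap f g x'" "1 \<le> j" "j < kap f g x" "cov (alt f g j x) x'"
  shows "Suc j = kap f g x \<and> cov (alt g f j x) x'"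
  using assms
proof (induction j arbitrary: f g x x' rule: less_induct)
  case (less j)
  note pr = less.prems
  let ?k = "kap f g x"
  obtain i0 where i0: "j = Suc i0" using pr by (cases j) auto
  define u where "u = alt f g j x"
  define v where "v = alt g f i0 x"
  have Q: "x \<in> Q" "x' \<in> Q" using pr by (auto simp: bot_def)
  have uQ: "u \<in> Q" "v \<in> Q" using alt_Q pr Q by (auto simp: u_def v_def)
  have u: "u = f v" by (simp add: u_def v_def i0)
  have vu: "cov v u" using orb_up'[OF pr(1-3), of i0] pr(9) i0 u by (simp add: v_def)
  have ux: "cov u x'" using pr by (simp add: u_def)
  have kp: "kap f g u = ?k" "kap f g v = ?k"
    using kap_alt kap_alt' pr Q by (auto simp: u_def v_def)
  \<comment> \<open>The second middle element between \<open>v\<close>, one step below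
    \<open>u\<close>, and \<open>x'\<close>. Everything depends on where \<open>c\<close>
    lies.\<close>
  obtain c where c: "c \<noteq> u" "cov v c" "cov c x'"
    using diamond[OF vu ux] by blast
  have cQ: "c \<in> Q" using c(3) cov_le sp_dec[OF pr(1) Q(2)] by blast
  have cf: "up f c" "cov u (f c)"
    using sp_up[OF pr(1) cQ c(2)] c(1) u vu by auto
  have dj: "\<not> up f u" using orb_dn[OF pr(1-3) pr(8)] pr(9) by (simp add: u_def)
  have ug: "up g u" using orb_up[OF pr(1-3) pr(9)] by (simp add: u_def)
  have kg: "kap g f y = kap f g y" "bot g f y = bot f g y" for y
    by (rule kap_commute, rule bot_commute)
  show ?case
  proof (cases "c = alt g f j x")
    case True
    \<comment> \<open>Otherwise \<open>u\<close> and \<open>c\<close> have three common upper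
      covers: \<open>x'\<close> and both elements of the next level of the orbit of
      \<open>x\<close>.\<close>
    have "Suc j = ?k"
    proof (rule ccontr)
      assume "Suc j \<noteq> ?k"
      then have lt: "Suc j < ?k" using pr(9) by simp
      have "alt f g (Suc j) x \<noteq> alt g f (Suc j) x" using kap_min[OF _ lt] by simp
      moreover have "alt f g (Suc j) x \<noteq> x'" "alt g f (Suc j) x \<noteq> x'"
        using kap_alt kap_alt' pr Q by metis+
      moreover have "cov u (alt f g (Suc j) x)" "cov c (alt g f (Suc j) x)"
        "cov u (alt g f (Suc j) x)" "cov c (alt f g (Suc j) x)"
        using orb_cross[OF pr(1-3)] orb_cross'[OF pr(1-3)] orb_up[OF pr(1-3)] orb_up'[OF pr(1-3)] pr(9) True
        by (auto simp: u_def)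
      ultimately show False
        using K23[of u c "alt f g (Suc j) x" "alt g f (Suc j) x" x'] c ux by metis
    qed
    then show ?thesis using c True by simp
  next
    case False
    \<comment> \<open>As a bottom of an orbit of size \<open>?k\<close>, the element
      \<open>c\<close> would contradict \<open>parallel_orbits\<close> with \<open>x'\<close>. So
      for a bottom \<open>c\<close> only the equality of sizes is left to show.\<close>
    have cbot: False if "up g c" and kc: "kap f g c \<noteq> ?k \<Longrightarrow> False"
    proof -
      have "bot f g c" using that cf cQ by (simp add: bot_def)
      then show False using parallel_orbits[OF pr(1,2) _ pr(4) c(3)] kc pr(5,7) by metis
    qed
    consider "j = 1" | "2 \<le> j" "up g c" | "2 \<le> j" "\<not> up g c" using pr(8) by linarith
    then have False
    proof cases
      case 1
      then have v: "v = x" using i0 by (simp add: v_def)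
      have gc: "up g c"
        using sp_up[OF pr(2) cQ c(2)] False pr(3) 1 v by (simp add: bot_def)
      then have bc: "bot f g c" using cf cQ by (simp add: bot_def)
      show False
        using cbot[OF gc] parallel_orbits[OF pr(1,2,3) bc] c(2) v pr(5) by metis
    next
      case 2
      then have bc: "bot f g c" using cf cQ by (simp add: bot_def)
      show False
      proof (rule cbot[OF 2(2)])
        assume kc: "kap f g c \<noteq> ?k"
        have "\<not> kap f g c < 2"
        proof
          assume "kap f g c < 2"
          then have e: "f c = g c" using kap_1 pr cQ by blast
          have dn: "\<not> up g (f c)" using sp_up_iff pr(2) cQ 2 e by simp
          have "f c = g u" using sp_dn[OF pr(2) _ cf(2) _ dn] ug sp_Q pr(1) cQ by blast
          then have "g (g c) = g (g u)" using e by simp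
          then show False using c(1) sp_inv pr(2) uQ cQ by metis
        qed
        moreover have "1 \<le> i0" "i0 < ?k" using 2 i0 pr(9) by auto
        ultimately have "Suc i0 = ?k"
          using less.IH[of i0 g f x c] pr bc c(2) kc i0 by (simp add: kg v_def)
        then show False using pr(9) i0 by simp
      qed
    next
      case 3
      obtain A B i y where y: "A = f \<and> B = g \<or> A = g \<and> B = f" "bot A B y" "i \<le> kap A B y" "c = alt A B i y"
        using orbit_rep[OF pr(1,2) cQ] by blast
      have spA: "sp A" "sp B" using y pr by auto
      have i1: "1 \<le> i" using y 3 cf by (cases i) (auto simp: bot_def)
      have ik: "i < kap A B y" using y(1,3,4) orb_top_dn[OF spA y(2)] cf by (metis order_le_less)
      have "A = g" using orb_dn[OF spA y(2) i1 y(3)] y cf by auto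
      then have A: "A = g" "B = f" using y(1) orb_up[OF spA y(2) ik] y(4) 3(2) by auto
      have yy: "bot f g y" "i < kap f g y" "c = alt g f i y" "y \<in> Q"
        using y ik A by (auto simp: kg bot_def)
      \<comment> \<open>Stripping the common letters gives a cover from the orbit of
        \<open>x\<close> to the bottom \<open>y\<close> of the orbit of \<open>c\<close>, at a
        height below \<open>j\<close>; hence both orbits have size \<open>?k\<close>. Then the
        induction hypothesis for \<open>c\<close> and \<open>x'\<close> puts \<open>c\<close> right
        below the top, at height \<open>?k - 1\<close>, although \<open>i < j < ?k\<close>.\<close>
      have "cov (alt g f i0 x) (alt g f i y)" using c(2) yy by (simp add: v_def)
      then have "alt g f i y = alt g f (Suc i0) x \<or>
          i \<le> i0 \<and> (cov (alt g f (i0 - i) x) y \<or> cov (alt f g (i0 - i) x) y)"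
        using descend_cover[OF pr(2,1), of x y i0 i] pr yy i0 by (simp add: kg del: alt.simps)
      then have d: "i \<le> i0" "cov (alt g f (i0 - i) x) y \<or> cov (alt f g (i0 - i) x) y"
        using False yy i0 by auto
      have ky: "2 \<le> kap f g y" using yy i1 by simp
      have ke: "kap f g y = ?k"
      proof (rule ccontr)
        assume kne: "kap f g y \<noteq> ?k"
        show False
        proof (cases "i0 - i = 0")
          case True
          then show False using parallel_orbits[OF pr(1-3) yy(1)] d pr(5) kne by simp
        next
          case l: False
          then have "1 \<le> i0 - i" "i0 - i < ?k" "i0 - i < j" using i0 pr(9) by auto
          moreover have "Suc l = ?k" if "1 \<le> l" "l < ?k" "l < j" "cov (alt g f l x) y" for l
            using less.IH[of l g f x y] that pr(1-3,5) yy(1) ky kne by (simp add: kg)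
          moreover have "Suc l = ?k" if "1 \<le> l" "l < ?k" "l < j" "cov (alt f g l x) y" for l
            using less.IH[of l f g x y] that pr(1-3,5) yy(1) ky kne by simp
          ultimately have "Suc (i0 - i) = ?k" using d(2) by blast
          then show False using pr(9) i0 by simp
        qed
      qed
      have "Suc i = kap g f y"
        using less.IH[of i g f y x'] d i0 pr yy ky ke c(3) i1 by (simp add: kg)
      then show False using d i0 pr ke by (simp add: kg)
    qed
    then show ?thesis ..
  qed
qed

text \<open>A cover between orbits of different sizes, neither of them collapsed, occurs only at the
  bottom of the upper orbit, at the top of the lower one, or next to these. In each case \<open>f u\<close> and
  \<open>g u\<close> lie below both \<open>f u'\<close> and \<open>g u'\<close>, see \<open>cover_adjacent\<close>; so the matchings may be mixed.\<close>

lemma cover_types: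
  assumes "sp f" "sp g" "u' \<in> Q" "cov u u'" "kap f g u \<noteq> kap f g u'" "2 \<le> kap f g u" "2 \<le> kap f g u'"
  shows "(bot f g u' \<and> \<not> up f u \<and> \<not> up g u) \<or>
    (\<exists>a b. (a = f \<and> b = g \<or> a = g \<and> b = f) \<and>
      (bot f g u' \<and> up a u \<and> \<not> up b u \<and> \<not> up b (a u) \<and> cov (b (a u)) u' \<or>
       \<not> up a u' \<and> up b u' \<and> \<not> up f u \<and> \<not> up g u \<and> le (b u) (a u')))"
  using assms(3-)
proof (induction "len u'" arbitrary: u u' rule: less_induct)
  case less
  note pr = less.prems
  have uQ: "u \<in> Q" using pr sp_dec[OF assms(1)] cov_le by blast
  show ?case
  proof (cases "bot f g u'")
    case True
    obtain a b i x where x: "a = f \<and> b = g \<or> a = g \<and> b = f" "bot a b x" "i \<le> kap a b x" "u = alt a b i x"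
      using orbit_rep[OF assms(1,2) uQ] by blast
    have spab: "sp a" "sp b" using x assms by auto
    have xQ: "x \<in> Q" using x by (simp add: bot_def)
    have kk: "kap a b y = kap f g y" for y using x kap_commute by metis
    have bb: "bot a b y = bot f g y" for y using x bot_commute by metis
    have ku: "kap a b u = kap a b x" using kap_alt[OF spab xQ] x by simp
    consider "i = 0" | "i = kap a b x" | "1 \<le> i" "i < kap a b x" using x(3) by linarith
    then show ?thesis
    proof cases
      case 1
      then show ?thesis
        using parallel_orbits[OF assms(1,2) _ True pr(2)] pr x(2,4) by (simp add: bb)
    next
      case 2
      then have "\<not> up a u" "\<not> up b u" using orb_top_dn[OF spab x(2)] x by auto
      then show ?thesis using x(1) True by blast
    next
      case 3
      have cl: "Suc i = kap a b x" "cov (alt b a i x) u'"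
        using cover_to_bot[OF spab x(2), of u' i] True pr ku kk 3 x(4) bb by auto
      \<comment> \<open>The two chains meet one step above \<open>u\<close>, so the opposite element
        of the level of \<open>u\<close> is reached over the top as \<open>a (b u)\<close>.\<close>
      have e: "alt b a (Suc i) x = alt a b (Suc i) x" using kap_eq(2)[OF spab xQ] cl by simp
      then have e2: "a (b u) = alt b a i x"
        using x(4) sp_inv[OF spab(1)] alt_Q[OF spab(2,1) xQ] by simp
      have "up b u" using orb_up[OF spab x(2) 3(2)] x by simp
      moreover have "\<not> up a u" using orb_dn[OF spab x(2) 3(1)] 3 x by simp
      moreover have "\<not> up a (b u)"
        using orb_dn[OF spab x(2), of "Suc i"] cl(1) e x(4) alt.simps(2)[of b a i x] by (simp del: alt.simps)
      ultimately show ?thesis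
        using x(1) True cl(2) e2
        by (intro disjI2 exI[of _ b] exI[of _ a]) auto
    qed
  next
    case False
    then obtain r r' where r: "r = f \<and> r' = g \<or> r = g \<and> r' = f" "\<not> up r u'"
      using pr by (auto simp: bot_def)
    have spr: "sp r" "sp r'" using r assms by auto
    have kr: "kap f g (r y) = kap f g y" if "y \<in> Q" for y
      using that r kap_f[OF assms(1,2)] kap_g[OF assms(1,2)] by auto
    \<comment> \<open>Moving the cover down by \<open>r\<close> preserves both orbit sizes. Since
      \<open>r\<close> raises \<open>r u\<close>, only the alternative next to the top survives at
      \<open>r u\<close>; hence \<open>u\<close> is the top of its orbit and \<open>u'\<close> lies
      one step above the bottom of its own.\<close>
    have "u' \<noteq> r u" using kr[OF uQ] pr by metis
    then have d: "\<not> up r u" "cov (r u) (r u')" using sp_dn[OF spr(1) pr(1,2) _ r(2)] by auto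
    have upr: "up r (r u)" using sp_up_iff spr uQ d by blast
    have c: "cov (r u') u'" using sp_down spr pr r by blast
    have rQ: "r u' \<in> Q" using sp_Q spr pr by blast
    note IH = less.hyps[OF _ rQ d(2), unfolded kr[OF uQ] kr[OF pr(1)]]
    have "len (r u') < len u'" using cov_len[OF c] by simp
    note types = IH[OF this pr(3-5)]
    have "\<not> (\<not> up f (r u) \<and> \<not> up g (r u))" using upr r by auto
    then obtain a b where ab: "a = f \<and> b = g \<or> a = g \<and> b = f" "bot f g (r u')"
      "up a (r u)" "\<not> up b (r u)" "\<not> up b (a (r u))" "cov (b (a (r u))) (r u')"
      using types by blast
    have e: "a = r \<and> b = r'" using ab(1,4) upr r(1) by auto
    have i: "r (r u) = u" "r (r u') = u'" using sp_inv spr uQ pr by auto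
    have bb: "bot r r' (r u')" using ab(2) r bot_commute by metis
    have "kap r r' (r u') = kap f g u'" using kr[OF pr(1)] r kap_commute by metis
    then have "up r' (alt r r' 1 (r u'))"
      using orb_up[OF spr bb, of 1] pr by simp
    then have "up r' u'" using i by simp
    then show ?thesis using r d ab cov_le unfolding conjunct1[OF e] conjunct2[OF e] i
      by (intro disjI2 exI[of _ r] exI[of _ r']) auto
  qed
qed

lemma cover_adjacent:
  assumes f: "sp f" and g: "sp g" and u': "u' \<in> Q" and c: "cov u u'" and ne: "kap f g u \<noteq> kap f g u'"
    and k: "2 \<le> kap f g u" "2 \<le> kap f g u'" and AB: "A \<in> {f, g}" "B \<in> {f, g}"
  shows "le (A u) (B u')"
proof -
  have uQ: "u \<in> Q" using u' c sp_dec[OF f] cov_le by blast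
  have kr: "kap f g (h y) = kap f g y" if "h \<in> {f, g}" "y \<in> Q" for y h
    using that kap_f[OF f g] kap_g[OF f g] by auto
  have spAB: "sp A" "sp B" using AB f g by auto
  have luu: "le u u'" using c cov_le by blast
  have same: "le (h u) (h u')" if "h \<in> {f, g}" for h
    using sp_le[OF _ u' c, of h] kr[OF that uQ] ne that f g by (metis insertE singletonD)
  show ?thesis
  proof (cases "A = B")
    case False
    have Au: "le (A u) u" if "\<not> up A u" using that sp_down[OF spAB(1) uQ] cov_le by blast
    have Bu: "le u' (B u')" if "up B u'" using that cov_le by blast
    have le2: "le (A u) (B u')" if "\<not> up A u" "up B u'" using Au Bu luu le_trans that by blast
    show ?thesis
      using cover_types[OF f g u' c ne k]
    proof (elim disjE exE conjE)
      assume "bot f g u'" "\<not> up f u" "\<not> up g u"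
      then show ?thesis using le2 AB by (auto simp: bot_def)
    next
      fix a b assume h: "a = f" "b = g" "bot f g u'" "up a u" "\<not> up b u" "\<not> up b (a u)" "cov (b (a u)) u'"
      \<comment> \<open>The cover of \<open>b (a u)\<close> by \<open>u'\<close>, moved by
        \<open>b\<close>, turns into \<open>a u \<le> b u'\<close>, the mixed relation that is
        wanted.\<close>
      have i: "b (b (a u)) = a u" using sp_inv g sp_Q f uQ h by simp
      have n: "u' \<noteq> b (b (a u))" using i kr[of a u] uQ h ne by auto
      have "le (b (b (a u))) (b u')" using sp_le[OF g u' _, of "b (a u)"] h n by simp
      then show ?thesis using le2 AB False h i by (auto simp: bot_def)
    next
      fix a b assume h: "a = g" "b = f" "bot f g u'" "up a u" "\<not> up b u" "\<not> up b (a u)" "cov (b (a u)) u'"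
      have i: "b (b (a u)) = a u" using sp_inv f sp_Q g uQ h by simp
      have n: "u' \<noteq> b (b (a u))" using i kr[of a u] uQ h ne by auto
      have "le (b (b (a u))) (b u')" using sp_le[OF f u' _, of "b (a u)"] h n by simp
      then show ?thesis using le2 AB False h i by (auto simp: bot_def)
    next
      fix a b assume "a = f" "b = g" "\<not> up a u'" "up b u'" "\<not> up f u" "\<not> up g u" "le (b u) (a u')"
      then show ?thesis using le2 AB False by auto
    next
      fix a b assume "a = g" "b = f" "\<not> up a u'" "up b u'" "\<not> up f u" "\<not> up g u" "le (b u) (a u')"
      then show ?thesis using le2 AB False by auto
    qed
  qed (use same AB in simp)
qed

text \<open>The size is constant on orbits, so the patched map is an involution. Covers between
  orbits of equal size see only one of the matchings; if one of the sizes is 1, the matchings agree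
  there; the rest is \<open>cover_adjacent\<close>.\<close>

lemma patched_special:
  assumes f: "sp f" and g: "sp g"
  shows "sp (\<lambda>u. if kap f g u = m then f u else g u)" (is "sp ?P")
proof -
  have kf: "kap f g (f u) = kap f g u" "kap f g (g u) = kap f g u" if "u \<in> Q" for u
    using kap_f kap_g f g that by auto
  have "le (?P u) (?P v)" if v: "v \<in> Q" and c: "cov u v" and n: "v \<noteq> ?P u" for u v
  proof -
    have u: "u \<in> Q" using v c sp_dec[OF f] cov_le by blast
    have L: "le (A u) (A v)" if "A \<in> {f, g}" "v \<noteq> A u" for A
      using that sp_le[OF _ v c] f g by auto
    show ?thesis
    proof (cases "kap f g u = kap f g v")
      case True
      then show ?thesis using L n by auto
    next
      case False
      consider "kap f g u < 2" | "kap f g v < 2" | "2 \<le> kap f g u" "2 \<le> kap f g v" by linarith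
      then show ?thesis
      proof cases
        case 1
        then show ?thesis using L[of f] L[of g] n kap_1[OF f g u] by (auto split: if_splits)
      next
        case 2
        then show ?thesis using L[of f] L[of g] n kap_1[OF f g v] by (auto split: if_splits)
      next
        case 3
        then show ?thesis using cover_adjacent[OF f g v c False 3] by auto
      qed
    qed
  qed
  moreover have "x \<in> Q" if "y \<in> Q" "le x y" for x y using sp_dec f that by blast
  moreover have "?P u \<in> Q \<and> ?P (?P u) = u \<and> (cov u (?P u) \<or> cov (?P u) u)" if "u \<in> Q" for u
    using that kf sp_Q sp_inv sp_down[OF f that] sp_down[OF g that] f g by auto
  ultimately show ?thesis unfolding special_def by blast
qed

end

section \<open>Hecke operators of special matchings\<close>

context graded_poset
begin

text \<open>With \<open>h = R(-, y)\<close> and \<open>M\<close> raising \<open>y\<close>, the first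
  branch is the right-hand side for R(x, M y), and the second one expresses R(M x, M y) = R(x, y).
  The operator satisfies the quadratic relation of a Hecke algebra generator.\<close>

definition hecke :: "'c::comm_ring_1 \<Rightarrow> ('a \<Rightarrow> 'a) \<Rightarrow> ('a \<Rightarrow> 'c) \<Rightarrow> 'a \<Rightarrow> 'c" where
  "hecke q M h u = (if up M u then (q - 1) * h u + q * h (M u) else h (M u))"

fun hword :: "'c::comm_ring_1 \<Rightarrow> ('a \<Rightarrow> 'a) \<Rightarrow> ('a \<Rightarrow> 'a) \<Rightarrow> nat \<Rightarrow> ('a \<Rightarrow> 'c) \<Rightarrow> 'a \<Rightarrow> 'c" where
  "hword q f g 0 h = h"
| "hword q f g (Suc n) h = hecke q f (hword q g f n h)"

lemma hword_inner: "hword q f g (Suc n) h = hword q f g n (hecke q (if even n then f else g) h)"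
proof (induction n arbitrary: f g)
  case (Suc n)
  have "hword q f g (Suc (Suc n)) h = hecke q f (hword q g f (Suc n) h)"
    by (rule hword.simps)
  also have "\<dots> = hecke q f (hword q g f n (hecke q (if even n then g else f) h))"
    by (simp only: Suc.IH)
  finally show ?case
    by (simp del: hword.simps(2)) simp
qed simp

lemma hword_linear:
  "hword q f g n (\<lambda>v. c * h v + d * h' v) u = c * hword q f g n h u + d * hword q f g n h' u"
proof (induction n arbitrary: f g u)
  case (Suc n)
  then show ?case by (simp add: hecke_def algebra_simps)
qed simp

lemma hecke_cong:
  assumes "special Q f" "u \<in> Q" "\<And>v. v \<in> Q \<Longrightarrow> h v = h' v"
  shows "hecke q f h u = hecke q f h' u"
  using assms sp_Q by (simp add: hecke_def)

lemma hword_cong: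
  assumes "special Q f" "special Q g" "u \<in> Q" "\<And>v. v \<in> Q \<Longrightarrow> h v = h' v"
  shows "hword q f g n h u = hword q f g n h' u"
  using assms
proof (induction n arbitrary: f g u)
  case (Suc n)
  then show ?case unfolding hword.simps by (intro hecke_cong[of Q]) auto
qed simp

lemma hecke_quadratic:
  assumes "special Q f" "u \<in> Q"
  shows "hecke q f (hecke q f h) u = (q - 1) * hecke q f h u + q * h u"
  using sp_up_iff[OF assms] sp_inv[OF assms] by (simp add: hecke_def)

end

context bounded_ideal
begin

text \<open>Along the chain from \<open>alt f g n x\<close> down to \<open>x\<close> every letter of
  the word meets an element that it lowers, so only the second branch of \<open>hecke\<close> is
  used.\<close>

lemma hword_top:
  assumes "sp f" "sp g" "bot f g x" "n \<le> kap f g x"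
  shows "hword q f g n h (alt f g n x) = h x"
  using assms
proof (induction n arbitrary: f g)
  case (Suc n)
  have "x \<in> Q" using Suc.prems by (simp add: bot_def)
  then have "f (alt f g (Suc n) x) = alt g f n x"
    using sp_inv[OF Suc.prems(1) alt_Q[OF Suc.prems(2,1)]] by simp
  moreover have "\<not> up f (alt f g (Suc n) x)"
    using orb_dn[OF Suc.prems(1-3) _ Suc.prems(4)] by (simp del: alt.simps)
  ultimately have "hword q f g (Suc n) h (alt f g (Suc n) x) = hword q g f n h (alt g f n x)"
    by (simp add: hecke_def del: alt.simps)
  then show ?case using Suc.IH[OF Suc.prems(2,1)] Suc.prems(3,4)
    by (simp add: bot_commute[of g f] kap_commute[of g f] del: alt.simps)
qed simp

text \<open>Since \<open>f\<close> lowers \<open>u\<close>, a word at \<open>f u\<close> is the word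
  with one more \<open>f\<close> at \<open>u\<close>. By \<open>eq\<close>, applied to
  \<open>hecke q c h\<close> instead of \<open>h\<close>, its innermost letter meets itself in the
  other word, and the quadratic relation removes it. This is why \<open>eq\<close> must hold for all
  functions.\<close>

lemma braid_step:
  fixes q :: "'c::comm_ring_1"
  assumes f: "sp f" and g: "sp g" and u: "u \<in> Q" and dn: "\<not> up f u"
    and eq: "\<And>h. hword q f g m h u = hword q g f m h u"
  shows "hword q f g m h (f u) = hword q g f m h (f u)"
proof (cases m)
  case (Suc p)
  define c where "c = (if even p then g else f)"
  have c: "c = (if even m then f else g)" by (simp add: c_def Suc)
  have spc: "sp c" using f g by (simp add: c_def)
  have "hword q g f m h (f u) = hword q f g (Suc m) h u"
    using dn by (simp add: hecke_def)
  also have "\<dots> = hword q f g m (hecke q c h) u"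
    by (simp only: hword_inner[of q f g m] c)
  also have "\<dots> = hword q g f m (hecke q c h) u"
    by (rule eq)
  also have "\<dots> = hword q g f p (hecke q c (hecke q c h)) u"
    by (simp only: Suc hword_inner[of q g f p] c_def)
  also have "\<dots> = hword q g f p (\<lambda>v. (q - 1) * hecke q c h v + q * h v) u"
    by (rule hword_cong[OF g f u]) (rule hecke_quadratic[OF spc])
  also have "\<dots> = (q - 1) * hword q g f p (hecke q c h) u + q * hword q g f p h u"
    by (rule hword_linear)
  also have "hword q g f p (hecke q c h) u = hword q g f m h u"
    by (simp only: Suc hword_inner[of q g f p] c_def)
  also have "\<dots> = hword q f g m h u"
    by (rule eq[symmetric])
  also have "(q - 1) * hword q f g m h u + q * hword q g f p h u = hecke q f (hword q f g m h) u"
    using hecke_quadratic[OF f u, of q "hword q g f p h"] by (simp add: Suc)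
  also have "\<dots> = hword q f g m h (f u)"
    using dn by (simp add: hecke_def)
  finally show ?thesis ..
qed simp

text \<open>At the top of the orbit both words return the value of \<open>h\<close> at the bottom,
  by \<open>hword_top\<close>. From there \<open>braid_step\<close> descends along both
  chains.\<close>

lemma braid_relation:
  fixes q :: "'c::comm_ring_1"
  assumes f: "sp f" and g: "sp g" and u: "u \<in> Q" and m: "kap f g u = m"
  shows "hword q f g m h u = hword q g f m h u"
proof -
  obtain a b i x where x: "a = f \<and> b = g \<or> a = g \<and> b = f" "bot a b x" "i \<le> kap a b x" "u = alt a b i x"
    using orbit_rep[OF f g u] by blast
  have spab: "sp a" "sp b" using x f g by auto
  have xQ: "x \<in> Q" using x by (simp add: bot_def)
  have "kap a b u = m" using m x(1) kap_commute by metis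
  then have mx: "m = kap a b x" using kap_alt[OF spab xQ] x(4) by simp
  have "\<forall>h. hword q a b m h (alt a b (m - d) x) = hword q b a m h (alt a b (m - d) x) \<and>
      hword q a b m h (alt b a (m - d) x) = hword q b a m h (alt b a (m - d) x)" if "d \<le> m" for d
    using that
  proof (induction d)
    case 0
    have "alt b a m x = alt a b m x" using kap_eq(2)[OF spab xQ] mx by simp
    moreover have "hword q a b m h (alt a b m x) = h x" "hword q b a m h (alt b a m x) = h x" for h
      using hword_top[OF spab x(2), of m q h] hword_top[OF spab(2,1), of x m q h] x(2) mx
      by (simp_all add: bot_commute[of b a] kap_commute[of b a])
    ultimately show ?case by simp
  next
    case (Suc d)
    define j where "j = m - Suc d"
    have j: "m - d = Suc j" "Suc j \<le> m" using Suc.prems by (simp_all add: j_def)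
    have IH: "hword q a b m h (alt a b (Suc j) x) = hword q b a m h (alt a b (Suc j) x)"
      "hword q a b m h (alt b a (Suc j) x) = hword q b a m h (alt b a (Suc j) x)" for h
      using Suc.IH Suc.prems unfolding j(1) by auto
    have dn: "\<not> up a (alt a b (Suc j) x)" "\<not> up b (alt b a (Suc j) x)"
      using orb_dn[OF spab x(2), of "Suc j"] orb_dn'[OF spab x(2), of "Suc j"] j(2) mx
      by (simp_all del: alt.simps)
    have inv: "a (alt a b (Suc j) x) = alt b a j x" "b (alt b a (Suc j) x) = alt a b j x"
      using sp_inv[OF spab(1) alt_Q[OF spab(2,1) xQ]] sp_inv[OF spab(2) alt_Q[OF spab xQ]] by simp_all
    show ?case
      using braid_step[OF spab alt_Q[OF spab xQ] dn(1) IH(1)]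
        braid_step[OF spab(2,1) alt_Q[OF spab(2,1) xQ] dn(2) IH(2)[symmetric]]
      by (simp only: inv j_def[symmetric]) simp
  qed
  from this[of "m - i"] have "hword q a b m h u = hword q b a m h u"
    using x(3,4) mx by simp
  then show ?thesis using x(1) by auto
qed

text \<open>\<open>E\<close> concerns the single function \<open>h\<close>. For longer words the
  induction hypothesis exchanges the inner word, so that the outer letter meets itself and the
  quadratic relation reduces to words shorter by one and by two.\<close>

lemma hword_agree:
  fixes q :: "'c::comm_ring_1"
  assumes f: "sp f" and g: "sp g" and E: "\<And>u. u \<in> Q \<Longrightarrow> kap f g u \<noteq> m \<Longrightarrow> hecke q f h u = hecke q g h u"
    and u: "u \<in> Q" "kap f g u \<noteq> m"
  shows "hword q f g n h u = hword q g f n h u"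
  using u
proof (induction n arbitrary: u rule: less_induct)
  case (less n)
  have cong: "hecke q a H u = hecke q a H' u"
    if "a \<in> {f, g}" "\<And>v. v \<in> Q \<Longrightarrow> kap f g v \<noteq> m \<Longrightarrow> H v = H' v" for a and H H' :: "'a \<Rightarrow> 'c"
  proof -
    have "a u \<in> Q" "kap f g (a u) \<noteq> m"
      using that(1) less.prems sp_Q f g kap_f[OF f g] kap_g[OF f g] by auto
    then show ?thesis using that(2) less.prems by (simp add: hecke_def)
  qed
  consider "n = 0" | "n = 1" | k where "n = Suc (Suc k)"
    by (metis One_nat_def not0_implies_Suc)
  then show ?case
  proof cases
    case 3
    have I: "hword q f g (Suc k) h v = hword q g f (Suc k) h v"
      "hword q f g k h v = hword q g f k h v" if "v \<in> Q" "kap f g v \<noteq> m" for v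
      using less.IH[of "Suc k" v] less.IH[of k v] that 3 by auto
    have "hword q f g n h u = hecke q f (hword q g f (Suc k) h) u"
      by (simp add: 3)
    also have "\<dots> = hecke q f (hword q f g (Suc k) h) u"
      by (rule cong) (simp, rule I(1)[symmetric])
    also have "\<dots> = (q - 1) * hword q f g (Suc k) h u + q * hword q g f k h u"
      by (simp add: hecke_quadratic[OF f less.prems(1)])
    also have "\<dots> = (q - 1) * hword q g f (Suc k) h u + q * hword q f g k h u"
      using I less.prems by simp
    also have "\<dots> = hecke q g (hword q g f (Suc k) h) u"
      by (simp add: hecke_quadratic[OF g less.prems(1)])
    also have "\<dots> = hecke q g (hword q f g (Suc k) h) u"
      by (rule cong) (simp, rule I(1)[symmetric])
    also have "\<dots> = hword q g f n h u"
      by (simp add: 3)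
    finally show ?thesis .
  qed (use E less.prems in simp_all)
qed

theorem transfer_matching:
  fixes q :: "'c::comm_ring_1" and R :: "'a \<Rightarrow> 'a \<Rightarrow> 'c"
  assumes f: "sp f" and g: "sp g" and w: "w \<in> Q" "\<not> up f w" "\<not> up g w" "f w \<noteq> g w"
    and below: "\<And>P x y. sp P \<Longrightarrow> x \<in> Q \<Longrightarrow> y \<in> Q \<Longrightarrow> len y < len w \<Longrightarrow> \<not> up P y \<Longrightarrow>
      R x y = hecke q P (\<lambda>u. R u (P y)) x"
    and atf: "\<And>x. x \<in> Q \<Longrightarrow> R x w = hecke q f (\<lambda>u. R u (f w)) x"
    and x: "x \<in> Q"
  shows "R x w = hecke q g (\<lambda>u. R u (g w)) x"
proof -
  obtain a b i z where z: "a = f \<and> b = g \<or> a = g \<and> b = f" "bot a b z" "i \<le> kap a b z" "w = alt a b i z"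
    using orbit_rep[OF f g w(1)] by blast
  have spab: "sp a" "sp b" using z f g by auto
  have "i = kap a b z"
    using orb_up[OF spab z(2), of i] z w by (metis order_le_less)
  have kk: "kap a b y = kap f g y" for y using z kap_commute by metis
  have bz: "bot f g z" using z bot_commute by metis
  have zQ: "z \<in> Q" using bz by (simp add: bot_def)
  define m where "m = kap f g z"
  have im: "i = m" using \<open>i = kap a b z\<close> kk m_def by simp
  have top: "alt f g m z = alt g f m z" using kap_eq[OF f g zQ] m_def by simp
  have wm: "w = alt f g m z" "w = alt g f m z" using z(1,4) im top by auto
  have "kap f g w = m" using wm kap_alt[OF f g zQ] m_def by simp
  \<comment> \<open>A collapsed orbit is excluded by \<open>f w \<noteq> g w\<close>. Therefore
    \<open>f z\<close> is still shorter than \<open>w\<close>, and \<open>below\<close> may be used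
    there for the patched matching.\<close>
  then have m2: "2 \<le> m" using kap_1[OF f g w(1)] w(4) by linarith
  obtain n where n: "m = Suc n" "1 \<le> n" using m2 by (cases m) auto
  have kap_le: "j \<le> kap f g z \<longleftrightarrow> j \<le> m" "j < kap f g z \<longleftrightarrow> j < m" for j by (simp_all add: m_def)
  define h where "h = (\<lambda>u. R u z)"
  have lw: "len w = len z + m" using orb_len[OF f g bz] wm(1) kap_le by simp
  have low: "R x (alt f g j z) = hword q f g j h x \<and> R x (alt g f j z) = hword q g f j h x"
    if "j < m" "x \<in> Q" for j x
    using that
  proof (induction j arbitrary: x)
    case (Suc j)
    have l: "len (alt f g (Suc j) z) < len w" "len (alt g f (Suc j) z) < len w"
      using orb_len[OF f g bz, of "Suc j"] orb_len'[OF f g bz, of "Suc j"] Suc.prems lw kap_le by simp_all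
    have dn: "\<not> up f (alt f g (Suc j) z)" "\<not> up g (alt g f (Suc j) z)"
      using orb_dn[OF f g bz, of "Suc j"] orb_dn'[OF f g bz, of "Suc j"] Suc.prems kap_le
      by (simp_all del: alt.simps)
    have inv: "f (alt f g (Suc j) z) = alt g f j z" "g (alt g f (Suc j) z) = alt f g j z"
      using sp_inv[OF f alt_Q[OF g f zQ]] sp_inv[OF g alt_Q[OF f g zQ]] by simp_all
    have "R x (alt f g (Suc j) z) = hecke q f (\<lambda>u. R u (alt g f j z)) x"
      using below[OF f Suc.prems(2) alt_Q[OF f g zQ] l(1) dn(1)] by (simp only: inv)
    also have "\<dots> = hword q f g (Suc j) h x"
      unfolding hword.simps by (rule hecke_cong[OF f Suc.prems(2)]) (use Suc in simp)
    finally have A: "R x (alt f g (Suc j) z) = hword q f g (Suc j) h x" .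
    have "R x (alt g f (Suc j) z) = hecke q g (\<lambda>u. R u (alt f g j z)) x"
      using below[OF g Suc.prems(2) alt_Q[OF g f zQ] l(2) dn(2)] by (simp only: inv)
    also have "\<dots> = hword q g f (Suc j) h x"
      unfolding hword.simps by (rule hecke_cong[OF g Suc.prems(2)]) (use Suc in simp)
    finally show ?case using A by blast
  qed (simp add: h_def)
  define P where "P = (\<lambda>u. if kap f g u = m then f u else g u)"
  have spP: "sp P" unfolding P_def by (rule patched_special[OF f g])
  have fz: "f z \<in> Q" "len (f z) < len w" "\<not> up f (f z)" "f (f z) = z"
    using sp_Q[OF f zQ] orb_len[OF f g bz, of 1] lw m2 kap_le orb_dn[OF f g bz, of 1] sp_inv[OF f zQ]
    by simp_all
  have "P (f z) = f (f z)" using kap_f[OF f g zQ] by (simp add: P_def m_def)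
  then have Pz: "R x (f z) = hecke q P h x" "R x (f z) = hecke q f h x" if "x \<in> Q" for x
    using below[OF spP that fz(1,2)] below[OF f that fz(1-3)] fz(3,4) by (simp_all add: h_def)
  have E: "hecke q f h u = hecke q g h u" if "u \<in> Q" "kap f g u \<noteq> m" for u
    using Pz[OF that(1)] that(2) by (simp add: hecke_def P_def)
  have braid: "hword q f g m h x = hword q g f m h x"
    using braid_relation[OF f g x] hword_agree[OF f g E x] by (cases "kap f g x = m") auto
  have inv: "f w = alt g f n z" "g w = alt f g n z"
    using sp_inv[OF f alt_Q[OF g f zQ, of n]] sp_inv[OF g alt_Q[OF f g zQ, of n]]
    by (simp add: wm(1) n(1), simp add: wm(2) n(1))
  have "R x w = hecke q f (\<lambda>u. R u (alt g f n z)) x"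
    using atf[OF x] by (simp only: inv)
  also have "\<dots> = hword q f g m h x"
    unfolding n(1) hword.simps by (rule hecke_cong[OF f x]) (use low n in simp)
  also have "\<dots> = hword q g f m h x"
    by (rule braid)
  also have "\<dots> = hecke q g (\<lambda>u. R u (g w)) x"
    unfolding n(1) hword.simps inv by (rule hecke_cong[OF g x]) (use low n in simp)
  finally show ?thesis .
qed

end

section \<open>The geometric representation\<close>

context coxeter_system
begin

section \<open>The length function\<close>

abbreviation len :: "'a \<Rightarrow> nat" where "len \<equiv> cox_length W S"

lemma S_closed [simp]: "s \<in> S \<Longrightarrow> s \<in> carrier W"
  using S_carrier by blast

lemma S_sq: "s \<in> S \<Longrightarrow> s \<otimes> s = \<one>"
  using pow_ord_eq_1[of s] S_involution[of s] by (simp add: numeral_2_eq_2)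

lemma S_inv: "s \<in> S \<Longrightarrow> inv s = s"
  using S_sq inv_equality by simp

lemma S_cancel [simp]: "s \<in> S \<Longrightarrow> x \<in> carrier W \<Longrightarrow> s \<otimes> (s \<otimes> x) = x"
  by (simp add: m_assoc[symmetric] S_sq)

lemma S_cancel_right [simp]: "s \<in> S \<Longrightarrow> x \<in> carrier W \<Longrightarrow> x \<otimes> s \<otimes> s = x"
  by (simp add: m_assoc S_sq)

lemma word_val_Nil [simp]: "word_val W [] = \<one>"
  and word_val_Cons [simp]: "word_val W (s # w) = s \<otimes> word_val W w"
  by (simp_all add: word_val_def)

lemma word_val_closed [simp]: "w \<in> lists S \<Longrightarrow> word_val W w \<in> carrier W"
  by (induction w) auto

lemma word_val_append:
  "u \<in> lists S \<Longrightarrow> v \<in> lists S \<Longrightarrow> word_val W (u @ v) = word_val W u \<otimes> word_val W v"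
  by (induction u) (auto simp: m_assoc)

lemma word_val_rev: "w \<in> lists S \<Longrightarrow> word_val W (rev w) = inv (word_val W w)"
proof (induction w)
  case (Cons s w)
  then have "s \<in> S" "w \<in> lists S" "rev w \<in> lists S" by (simp_all add: in_lists_conv_set)
  then show ?case using word_val_append[of "rev w" "[s]"] Cons.IH by (simp add: inv_mult_group S_inv)
qed simp

lemma word_exists:
  assumes "x \<in> carrier W"
  shows "\<exists>w \<in> lists S. word_val W w = x"
proof -
  have "x \<in> generate W S" using S_generates assms by simp
  then show ?thesis
  proof (induction rule: generate.induct)
    case one
    then show ?case by (intro bexI[of _ "[]"]) auto
  next
    case (incl h)
    then show ?case by (intro bexI[of _ "[h]"]) auto
  next
    case (inv h)
    then show ?case by (intro bexI[of _ "[h]"]) (auto simp: S_inv)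
  next
    case (eng h1 h2)
    then obtain u v where "u \<in> lists S" "v \<in> lists S" "word_val W u = h1" "word_val W v = h2" by blast
    then show ?case by (intro bexI[of _ "u @ v"]) (auto simp: word_val_append)
  qed
qed

lemma reduced_word:
  assumes "x \<in> carrier W"
  shows "\<exists>w \<in> lists S. length w = len x \<and> word_val W w = x"
  unfolding cox_length_def by (rule LeastI_ex) (use word_exists assms in blast)

lemma len_le: "w \<in> lists S \<Longrightarrow> len (word_val W w) \<le> length w"
  unfolding cox_length_def by (rule Least_le) blast

lemma len_one [simp]: "len \<one> = 0"
  using len_le[of "[]"] by simp

lemma len_0: "x \<in> carrier W \<Longrightarrow> len x = 0 \<Longrightarrow> x = \<one>"
  using reduced_word[of x] by auto

lemma len_mult_le: "s \<in> S \<Longrightarrow> x \<in> carrier W \<Longrightarrow> len (s \<otimes> x) \<le> Suc (len x)"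
proof -
  assume s: "s \<in> S" "x \<in> carrier W"
  obtain w where "w \<in> lists S" "length w = len x" "word_val W w = x" using reduced_word s by blast
  then show ?thesis using len_le[of "s # w"] s by simp
qed

lemma len_inv: "x \<in> carrier W \<Longrightarrow> len (inv x) = len x"
proof -
  have le: "len (inv y) \<le> len y" if y: "y \<in> carrier W" for y
  proof -
    obtain w where "w \<in> lists S" "length w = len y" "word_val W w = y" using reduced_word y by blast
    then show ?thesis using len_le[of "rev w"] word_val_rev[of w] by (simp add: in_lists_conv_set)
  qed
  assume "x \<in> carrier W"
  then show ?thesis using le[of x] le[of "inv x"] by simp
qed

text \<open>Each relator has even length 2m, so the parity of words is the sign character of the
  group. It forces multiplication by a simple reflection to change the length.\<close>

lemma parity_step: "coxeter_step W S u v \<Longrightarrow> even (length u) = even (length v)"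
  by (induction rule: coxeter_step.induct)
    (simp add: length_concat sum_list_replicate)

lemma parity_word:
  assumes "u \<in> lists S" "v \<in> lists S" "word_val W u = word_val W v"
  shows "even (length u) = even (length v)"
proof -
  have "equivclp (coxeter_step W S) u v" using presentation assms by blast
  then show ?thesis
    by (induction rule: equivclp_induct) (use parity_step in auto)
qed

lemma parity_len:
  assumes "s \<in> S" "x \<in> carrier W"
  shows "even (len (s \<otimes> x)) \<longleftrightarrow> odd (len x)"
proof -
  obtain v where v: "v \<in> lists S" "length v = len (s \<otimes> x)" "word_val W v = s \<otimes> x"
    using reduced_word[of "s \<otimes> x"] assms by auto
  obtain w where w: "w \<in> lists S" "length w = len x" "word_val W w = x"
    using reduced_word assms by blast
  show ?thesis using parity_word[of v "s # w"] v w assms by simp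
qed

lemma len_cases:
  assumes "s \<in> S" "x \<in> carrier W"
  shows "len (s \<otimes> x) = Suc (len x) \<or> len x = Suc (len (s \<otimes> x))"
proof -
  have "len (s \<otimes> x) \<le> Suc (len x)" "len x \<le> Suc (len (s \<otimes> x))"
    using len_mult_le[of s x] len_mult_le[of s "s \<otimes> x"] assms by simp_all
  moreover have "len (s \<otimes> x) \<noteq> len x" using parity_len[OF assms] by auto
  ultimately show ?thesis by linarith
qed

lemma descent_exists:
  assumes "x \<in> carrier W" "x \<noteq> \<one>"
  shows "\<exists>s \<in> S. len x = Suc (len (s \<otimes> x))"
proof -
  obtain w where w: "w \<in> lists S" "length w = len x" "word_val W w = x"
    using reduced_word assms by blast
  then obtain s v where v: "w = s # v" using assms by (cases w) auto
  then have s: "s \<in> S" "v \<in> lists S" using w by auto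
  have "s \<otimes> x = word_val W v"
    using w(3) S_cancel[OF s(1) word_val_closed[OF s(2)]] unfolding v by simp
  then have "len (s \<otimes> x) < len x" using len_le[OF s(2)] w v by simp
  then show ?thesis using len_cases[OF s(1) assms(1)] s(1) by auto
qed

lemma carrier_induct [consumes 1, case_names one mult]:
  assumes "x \<in> carrier W" "P \<one>"
    and "\<And>s x. s \<in> S \<Longrightarrow> x \<in> carrier W \<Longrightarrow> len (s \<otimes> x) = Suc (len x) \<Longrightarrow> P x \<Longrightarrow> P (s \<otimes> x)"
  shows "P x"
  using assms(1)
proof (induction "len x" arbitrary: x rule: less_induct)
  case less
  show ?case
  proof (cases "x = \<one>")
    case False
    then obtain s where s: "s \<in> S" "len x = Suc (len (s \<otimes> x))" using descent_exists less by blast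
    then have "P (s \<otimes> x)" using less by simp
    then have "P (s \<otimes> (s \<otimes> x))"
      using assms(3)[OF s(1), of "s \<otimes> x"] s less.prems by simp
    then show ?thesis using s less.prems by simp
  qed (use assms in simp)
qed

section \<open>Simple reflections and dihedral relations\<close>

text \<open>Vectors have two kinds of coordinates: \<open>Inl a\<close> is the coefficient of the simple root
  of \<open>a\<close>, and \<open>Inr a\<close> is the pairing with that root. Keeping them independent makes the
  pairing nondegenerate. When \<open>ord (s \<otimes> t) = 0\<close>, the convention \<open>x / 0 = 0\<close>
  gives the value \<open>-2\<close> of an infinite bond.\<close>

definition A :: "'a \<Rightarrow> 'a \<Rightarrow> real" where
  "A s t = (if s \<in> S \<and> t \<in> S then - 2 * cos (pi / real (ord (s \<otimes> t))) else 0)"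

definition simple :: "'a \<Rightarrow> 'a + 'a \<Rightarrow> real" where
  "simple s i = (case i of Inl a \<Rightarrow> of_bool (a = s) | Inr a \<Rightarrow> A s a)"

definition cmb :: "real \<Rightarrow> ('c \<Rightarrow> real) \<Rightarrow> real \<Rightarrow> ('c \<Rightarrow> real) \<Rightarrow> 'c \<Rightarrow> real" where
  "cmb c x d y = (\<lambda>i. c * x i + d * y i)"

definition \<sigma> :: "'a \<Rightarrow> ('a + 'a \<Rightarrow> real) \<Rightarrow> 'a + 'a \<Rightarrow> real" where
  "\<sigma> s x = cmb 1 x (- x (Inr s)) (simple s)"

lemma simple_apply [simp]: "simple s (Inl a) = of_bool (a = s)" "simple s (Inr a) = A s a"
  by (simp_all add: simple_def)

lemma A_self [simp]: "s \<in> S \<Longrightarrow> A s s = 2"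
  by (simp add: A_def S_sq)

lemma A_sym: "A s t = A t s"
proof (cases "s \<in> S \<and> t \<in> S")
  case True
  then have "inv (s \<otimes> t) = t \<otimes> s" by (simp add: inv_mult_group S_inv)
  then have "ord (t \<otimes> s) = ord (s \<otimes> t)" using ord_inv[of "s \<otimes> t"] True by simp
  then show ?thesis using True by (simp add: A_def)
qed (auto simp: A_def)

lemma \<sigma>_apply: "\<sigma> s x i = x i - x (Inr s) * simple s i"
  by (simp add: \<sigma>_def cmb_def)

lemma \<sigma>_invol: "s \<in> S \<Longrightarrow> \<sigma> s (\<sigma> s x) = x"
  by (rule ext) (simp add: \<sigma>_apply algebra_simps)

lemma \<sigma>_cmb: "\<sigma> s (cmb c x d y) = cmb c (\<sigma> s x) d (\<sigma> s y)"
  by (rule ext) (simp add: \<sigma>_apply cmb_def algebra_simps)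

text \<open>The displacement stays in the span of the two simple roots, and the two pairings rotate
  by the angle \<open>th\<close> in each reflection. They are multiplied by \<open>sin th\<close> to
  avoid a division; the induction step is the product formula \<open>prod\<close>.\<close>

lemma dihedral_orbit:
  fixes th :: real
  assumes st: "s \<in> S" "t \<in> S" and A: "A s t = - 2 * cos th"
  shows "\<exists>P Q. ((\<sigma> s \<circ> \<sigma> t) ^^ n) x = (\<lambda>i. x i - P * simple s i - Q * simple t i) \<and>
    ((\<sigma> s \<circ> \<sigma> t) ^^ n) x (Inr s) * sin th =
      - (x (Inr s) * sin ((2 * real n - 1) * th) + x (Inr t) * sin (2 * real n * th)) \<and>
    ((\<sigma> s \<circ> \<sigma> t) ^^ n) x (Inr t) * sin th =
      x (Inr t) * sin ((2 * real n + 1) * th) + x (Inr s) * sin (2 * real n * th)"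
proof (induction n)
  case 0
  show ?case by (intro exI[of _ 0]) simp
next
  case (Suc n)
  define y where "y = ((\<sigma> s \<circ> \<sigma> t) ^^ n) x"
  define c where "c = 2 * cos th"
  have c: "A s t = - c" "A t s = - c" using A A_sym[of t s] by (simp_all add: c_def)
  obtain P Q where PQ: "y = (\<lambda>i. x i - P * simple s i - Q * simple t i)"
    "y (Inr s) * sin th = - (x (Inr s) * sin ((2 * real n - 1) * th) + x (Inr t) * sin (2 * real n * th))"
    "y (Inr t) * sin th = x (Inr t) * sin ((2 * real n + 1) * th) + x (Inr s) * sin (2 * real n * th)"
    using Suc unfolding y_def by blast
  have z: "((\<sigma> s \<circ> \<sigma> t) ^^ Suc n) x = \<sigma> s (\<sigma> t y)" by (simp add: y_def)
  have zi: "\<sigma> s (\<sigma> t y) i = y i - (y (Inr s) + c * y (Inr t)) * simple s i - y (Inr t) * simple t i" for i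
    using c st by (simp add: \<sigma>_apply algebra_simps)
  have zs: "\<sigma> s (\<sigma> t y) (Inr s) = - y (Inr s) - c * y (Inr t)"
    "\<sigma> s (\<sigma> t y) (Inr t) = - c * \<sigma> s (\<sigma> t y) (Inr s) - y (Inr t)"
    unfolding zi using c st by (simp_all add: algebra_simps)
  have prod: "c * sin (k * th) = sin ((k + 1) * th) + sin ((k - 1) * th)" for k
    by (simp add: c_def algebra_simps sin_add sin_diff)
  have p: "\<sigma> s (\<sigma> t y) (Inr s) * sin th =
      - (x (Inr s) * sin ((2 * real n + 1) * th) + x (Inr t) * sin ((2 * real n + 2) * th))"
  proof -
    have "\<sigma> s (\<sigma> t y) (Inr s) * sin th = - (y (Inr s) * sin th) - c * (y (Inr t) * sin th)"
      by (simp add: zs algebra_simps)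
    also have "\<dots> = x (Inr s) * sin ((2 * real n - 1) * th) + x (Inr t) * sin (2 * real n * th)
        - x (Inr t) * (c * sin ((2 * real n + 1) * th)) - x (Inr s) * (c * sin (2 * real n * th))"
      unfolding PQ(2,3) by (simp add: algebra_simps)
    also have "c * sin (2 * real n * th) = sin ((2 * real n + 1) * th) + sin ((2 * real n - 1) * th)"
      by (rule prod)
    also have "c * sin ((2 * real n + 1) * th) = sin ((2 * real n + 2) * th) + sin (2 * real n * th)"
      using prod[of "2 * real n + 1"] by (simp add: add.assoc)
    finally show ?thesis by (simp add: algebra_simps)
  qed
  have r: "\<sigma> s (\<sigma> t y) (Inr t) * sin th =
      x (Inr t) * sin ((2 * real n + 3) * th) + x (Inr s) * sin ((2 * real n + 2) * th)"
  proof -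
    have "\<sigma> s (\<sigma> t y) (Inr t) * sin th = - c * (\<sigma> s (\<sigma> t y) (Inr s) * sin th) - y (Inr t) * sin th"
      by (simp add: zs(2) algebra_simps)
    also have "\<dots> = x (Inr s) * (c * sin ((2 * real n + 1) * th)) + x (Inr t) * (c * sin ((2 * real n + 2) * th))
        - x (Inr t) * sin ((2 * real n + 1) * th) - x (Inr s) * sin (2 * real n * th)"
      unfolding p PQ(3) by (simp add: algebra_simps)
    also have "c * sin ((2 * real n + 1) * th) = sin ((2 * real n + 2) * th) + sin (2 * real n * th)"
      using prod[of "2 * real n + 1"] by (simp add: add.assoc)
    also have "c * sin ((2 * real n + 2) * th) = sin ((2 * real n + 3) * th) + sin ((2 * real n + 1) * th)"
      using prod[of "2 * real n + 2"] by (simp add: add.assoc add_diff_eq[symmetric])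
    finally show ?thesis by (simp add: algebra_simps)
  qed
  have e: "2 * real (Suc n) - 1 = 2 * real n + 1" "2 * real (Suc n) = 2 * real n + 2"
    "2 * real (Suc n) + 1 = 2 * real n + 3" by simp_all
  show ?case unfolding z e(1) e(3)
  proof (intro exI conjI)
    show "\<sigma> s (\<sigma> t y) = (\<lambda>i. x i - (P + y (Inr s) + c * y (Inr t)) * simple s i
      - (Q + y (Inr t)) * simple t i)"
      by (rule ext) (simp add: zi, simp add: PQ(1) algebra_simps)
  qed (unfold e(2), (use p r in simp)+)
qed

text \<open>For n = m the sines return to their initial values, so the displacement pairs to zero
  with both simple roots. Their Gram matrix is nonsingular because \<open>cos th ^ 2 < 1\<close>,
  hence the displacement vanishes.\<close>

lemma dihedral_relation:
  assumes st: "s \<in> S" "t \<in> S" and m: "m = ord (s \<otimes> t)" "m \<noteq> 0"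
  shows "((\<sigma> s \<circ> \<sigma> t) ^^ m) x = x"
proof (cases "m = 1")
  case True
  then have "s \<otimes> t = \<one>" using m ord_eq_1[of "s \<otimes> t"] st by simp
  then have "s = t" using st S_inv inv_equality[of s t] by simp
  then show ?thesis using True st \<sigma>_invol by simp
next
  case False
  then have m2: "2 \<le> m" using m by simp
  define th where "th = pi / real m"
  have A: "A s t = - 2 * cos th" using st m by (simp add: A_def th_def)
  have th: "0 < th" "th \<le> pi / 2" using m2 by (simp_all add: th_def divide_simps)
  have s0: "sin th > 0" using th pi_gt_zero by (intro sin_gt_zero) linarith+
  have c0: "0 \<le> cos th" using th by (intro cos_ge_zero) linarith+
  have c1: "cos th < 1" using cos_monotone_0_pi[of 0 th] th pi_gt_zero by simp
  have mth: "real m * th = pi" using m2 by (simp add: th_def)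
  have e: "sin ((2 * real m - 1) * th) = - sin th" "sin ((2 * real m + 1) * th) = sin th"
    "sin (2 * real m * th) = 0"
  proof -
    have h: "(2 * real m - 1) * th = 2 * pi - th" "(2 * real m + 1) * th = th + 2 * pi"
      "2 * real m * th = 2 * pi"
      using mth by (simp_all add: algebra_simps)
    show "sin ((2 * real m - 1) * th) = - sin th" "sin ((2 * real m + 1) * th) = sin th"
      "sin (2 * real m * th) = 0" unfolding h by (simp_all add: sin_diff)
  qed
  obtain P Q where PQ: "((\<sigma> s \<circ> \<sigma> t) ^^ m) x = (\<lambda>i. x i - P * simple s i - Q * simple t i)"
    "((\<sigma> s \<circ> \<sigma> t) ^^ m) x (Inr s) * sin th = x (Inr s) * sin th"
    "((\<sigma> s \<circ> \<sigma> t) ^^ m) x (Inr t) * sin th = x (Inr t) * sin th"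
    using dihedral_orbit[OF st A, of m x] unfolding e by auto
  have "x (Inr s) - P * 2 - Q * A t s = x (Inr s)" "x (Inr t) - P * A s t - Q * 2 = x (Inr t)"
    using PQ s0 st unfolding PQ(1) by simp_all
  then have "P = cos th * Q" "Q = cos th * P" using A A_sym[of t s] by (simp_all add: mult.commute)
  then have "P * (1 - cos th ^ 2) = 0" "Q = cos th * P" by (simp_all add: power2_eq_square algebra_simps)
  moreover have "cos th ^ 2 < 1" using c0 c1 by (simp add: power_less_one_iff)
  ultimately have "P = 0" "Q = 0" by auto
  then show ?thesis using PQ(1) by simp
qed

lemma act_step:
  "coxeter_step W S u v \<Longrightarrow> foldr \<sigma> u x = foldr \<sigma> v x"
proof (induction rule: coxeter_step.induct)
  case (1 u v s t m)
  have "foldr \<sigma> (concat (replicate n [s, t])) y = ((\<sigma> s \<circ> \<sigma> t) ^^ n) y" for n y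
    by (induction n) simp_all
  then show ?case using dihedral_relation[OF 1(3-6)] by simp
qed

text \<open>An arbitrary word is chosen for each group element; \<open>rep_word\<close> shows, by
  the presentation, that every other word acts in the same way.\<close>

definition rep :: "'a \<Rightarrow> ('a + 'a \<Rightarrow> real) \<Rightarrow> 'a + 'a \<Rightarrow> real" where
  "rep g = foldr \<sigma> (SOME w. w \<in> lists S \<and> word_val W w = g)"

lemma rep_word:
  assumes "w \<in> lists S"
  shows "rep (word_val W w) x = foldr \<sigma> w x"
proof -
  define v where "v = (SOME v. v \<in> lists S \<and> word_val W v = word_val W w)"
  have v: "v \<in> lists S \<and> word_val W v = word_val W w"
    unfolding v_def by (rule someI[of _ w]) (use assms in simp)
  then have "equivclp (coxeter_step W S) v w" using presentation assms by blast
  then have "foldr \<sigma> v x = foldr \<sigma> w x"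
    by (induction rule: equivclp_induct) (use act_step in metis)+
  then show ?thesis by (simp add: rep_def v_def)
qed

lemma rep_one [simp]: "rep \<one> x = x"
  using rep_word[of "[]"] by simp

lemma rep_S: "s \<in> S \<Longrightarrow> rep s x = \<sigma> s x"
  using rep_word[of "[s]"] by simp

lemma rep_mult:
  assumes "g \<in> carrier W" "h \<in> carrier W"
  shows "rep (g \<otimes> h) x = rep g (rep h x)"
proof -
  obtain u v where "u \<in> lists S" "v \<in> lists S" "word_val W u = g" "word_val W v = h"
    using word_exists assms by metis
  then show ?thesis
    using rep_word[of "u @ v"] rep_word[of u] rep_word[of v] by (auto simp: word_val_append)
qed

lemma rep_inv [simp]:
  "g \<in> carrier W \<Longrightarrow> rep (inv g) (rep g x) = x" "g \<in> carrier W \<Longrightarrow> rep g (rep (inv g) x) = x"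
  by (simp_all add: rep_mult[symmetric])

lemma rep_cmb: "g \<in> carrier W \<Longrightarrow> rep g (cmb c x d y) = cmb c (rep g x) d (rep g y)"
  by (induction g rule: carrier_induct) (simp_all add: rep_mult rep_S \<sigma>_cmb)

end

section \<open>The invariant form\<close>

text \<open>Chebyshev polynomials of the second kind at c/2, with the index shifted by one: for c =
  2 cos th the value is sin (n th) / sin th. The value c = 2 belongs to an infinite bond.\<close>

fun cheb :: "real \<Rightarrow> nat \<Rightarrow> real" where
  "cheb c 0 = 0"
| "cheb c (Suc 0) = 1"
| "cheb c (Suc (Suc n)) = c * cheb c (Suc n) - cheb c n"

lemma cheb_sin: "cheb (2 * cos th) n * sin th = sin (real n * th)"
proof (induction n rule: induct_nat_012)
  case (ge2 n)
  have "sin (real (Suc (Suc n)) * th) = 2 * cos th * sin (real (Suc n) * th) - sin (real n * th)"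
    using sin_add[of "real (Suc n) * th" th] sin_diff[of "real (Suc n) * th" th]
    by (simp add: algebra_simps)
  then show ?case using ge2 by (simp add: algebra_simps)
qed simp_all

lemma cheb_two: "cheb 2 n = real n"
  by (induction "2::real" n rule: cheb.induct) simp_all

definition ng :: "('c \<Rightarrow> real) \<Rightarrow> 'c \<Rightarrow> real" where
  "ng x = (\<lambda>i. - x i)"

definition vpos :: "('a + 'a \<Rightarrow> real) \<Rightarrow> bool" where
  "vpos x \<longleftrightarrow> (\<forall>a. 0 \<le> x (Inl a))"

definition vneg :: "('a + 'a \<Rightarrow> real) \<Rightarrow> bool" where
  "vneg x \<longleftrightarrow> (\<forall>a. x (Inl a) \<le> 0)"

lemma ng_ng [simp]: "ng (ng x) = x"
  by (simp add: ng_def)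

lemma vpos_ng [simp]: "vpos (ng x) \<longleftrightarrow> vneg x" "vneg (ng x) \<longleftrightarrow> vpos x"
  by (simp_all add: ng_def vpos_def vneg_def)

text \<open>Root coefficients of the right argument meet pairing coordinates of the left one. The
  left argument may thus be any functional, while the right one should have finite support.\<close>

definition B :: "('a + 'a \<Rightarrow> real) \<Rightarrow> ('a + 'a \<Rightarrow> real) \<Rightarrow> real" where
  "B x y = (\<Sum>b | y (Inl b) \<noteq> 0. y (Inl b) * x (Inr b))"

definition fsupp :: "('a + 'a \<Rightarrow> real) \<Rightarrow> bool" where
  "fsupp y \<longleftrightarrow> finite {b. y (Inl b) \<noteq> 0}"

lemma B_superset:
  assumes "finite F" "{b. y (Inl b) \<noteq> 0} \<subseteq> F"
  shows "B x y = (\<Sum>b\<in>F. y (Inl b) * x (Inr b))"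
  unfolding B_def using assms by (intro sum.mono_neutral_left) auto

lemma B_ng [simp]: "B x (ng y) = - B x y" "B (ng x) y = - B x y"
  by (simp_all add: B_def ng_def sum_negf)

context coxeter_system
begin

lemma B_cmb_left: "B (cmb c x d x') y = c * B x y + d * B x' y"
  unfolding B_def by (simp add: cmb_def sum_distrib_left sum.distrib algebra_simps)

lemma B_cmb_right:
  assumes "fsupp y" "fsupp y'"
  shows "B x (cmb c y d y') = c * B x y + d * B x y'"
proof -
  define F where "F = {b. y (Inl b) \<noteq> 0} \<union> {b. y' (Inl b) \<noteq> 0}"
  have F: "finite F" using assms by (simp add: F_def fsupp_def)
  have "B x z = (\<Sum>b\<in>F. z (Inl b) * x (Inr b))" if "z \<in> {y, y', cmb c y d y'}" for z
    by (rule B_superset[OF F]) (use that in \<open>auto simp: F_def cmb_def\<close>)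
  then show ?thesis by (simp add: cmb_def sum_distrib_left sum.distrib algebra_simps)
qed

lemma fsupp_cmb: "fsupp y \<Longrightarrow> fsupp y' \<Longrightarrow> fsupp (cmb c y d y')"
  unfolding fsupp_def
  by (rule finite_subset[of _ "{b. y (Inl b) \<noteq> 0} \<union> {b. y' (Inl b) \<noteq> 0}"]) (auto simp: cmb_def)

lemma fsupp_simple: "fsupp (simple s)"
  unfolding fsupp_def by (rule finite_subset[of _ "{s}"]) auto

lemma B_simple [simp]: "B x (simple s) = x (Inr s)"
  using B_superset[of "{s}" "simple s" x] by auto

text \<open>The span of the simple roots inside the larger space: here the pairing coordinates are
  the actual pairings. On these vectors \<open>B\<close> is the usual bilinear form.\<close>

definition lat :: "('a + 'a \<Rightarrow> real) \<Rightarrow> bool" where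
  "lat y \<longleftrightarrow> fsupp y \<and> (\<forall>a. y (Inr a) = B (simple a) y)"

lemma lat_simple: "lat (simple s)"
  by (simp add: lat_def fsupp_simple A_sym)

lemma lat_cmb: "lat y \<Longrightarrow> lat y' \<Longrightarrow> lat (cmb c y d y')"
  by (auto simp: lat_def fsupp_cmb B_cmb_right) (simp add: cmb_def)

lemma lat_\<sigma>: "lat y \<Longrightarrow> lat (\<sigma> s y)"
  unfolding \<sigma>_def by (intro lat_cmb lat_simple)

lemma lat_rep: "g \<in> carrier W \<Longrightarrow> lat y \<Longrightarrow> lat (rep g y)"
  by (induction g rule: carrier_induct) (simp_all only: rep_one rep_mult S_closed rep_S lat_\<sigma>)

lemma B_\<sigma>: "lat y \<Longrightarrow> B (\<sigma> s x) y = B x (\<sigma> s y)"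
  unfolding \<sigma>_def by (simp add: B_cmb_left B_cmb_right lat_def fsupp_simple)

lemma B_rep:
  assumes "g \<in> carrier W" "lat y"
  shows "B (rep g x) (rep g y) = B x y"
  using assms
proof (induction g arbitrary: x y rule: carrier_induct)
  case (mult s g)
  have "B (rep (s \<otimes> g) x) (rep (s \<otimes> g) y) = B (\<sigma> s (rep g x)) (\<sigma> s (rep g y))"
    using mult.hyps by (simp only: rep_mult S_closed rep_S)
  also have "\<dots> = B (rep g x) (rep g y)"
    using mult.hyps mult.prems by (simp only: B_\<sigma> lat_\<sigma> lat_rep \<sigma>_invol)
  finally show ?case using mult by simp
qed simp

lemma rep_ng: "g \<in> carrier W \<Longrightarrow> rep g (ng x) = ng (rep g x)"
proof -
  have e: "ng y = cmb (- 1) y 0 y" for y :: "'a + 'a \<Rightarrow> real"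
    by (rule ext) (simp add: ng_def cmb_def)
  show "g \<in> carrier W \<Longrightarrow> rep g (ng x) = ng (rep g x)"
    unfolding e by (rule rep_cmb)
qed

section \<open>Positivity of roots\<close>

text \<open>For a finite order m the value is sin (n pi / m) / sin (pi / m), nonnegative for n at
  most m. For an infinite bond the argument is 2 and the value is n.\<close>

lemma cheb_nonneg:
  assumes st: "s \<in> S" "t \<in> S" "s \<noteq> t" and n: "ord (s \<otimes> t) = 0 \<or> n \<le> ord (s \<otimes> t)"
  shows "0 \<le> cheb (- A s t) n"
proof (cases "ord (s \<otimes> t) = 0")
  case True
  then show ?thesis using st cheb_two by (simp add: A_def)
next
  case False
  define m where "m = ord (s \<otimes> t)"
  have "m \<noteq> 1"
  proof
    assume "m = 1"
    then have "s \<otimes> t = \<one>" using st ord_eq_1[of "s \<otimes> t"] by (simp add: m_def)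
    then show False using st S_inv inv_equality[of s t] by simp
  qed
  then have m: "2 \<le> m" "n \<le> m" using False n by (auto simp: m_def)
  define th where "th = pi / real m"
  have th: "0 < th" "real m * th = pi" using m by (simp_all add: th_def)
  have "real 2 * th \<le> real m * th" using m th by (intro mult_right_mono) simp_all
  then have s0: "sin th > 0" using th pi_gt_zero by (intro sin_gt_zero) simp_all
  have "real n * th \<le> real m * th" using m th by (intro mult_right_mono) simp_all
  then have "0 \<le> sin (real n * th)" using th by (intro sin_ge_zero) simp_all
  then have "0 \<le> cheb (2 * cos th) n * sin th" by (simp only: cheb_sin)
  then have "0 \<le> cheb (2 * cos th) n" using s0 by (simp add: zero_le_mult_iff)
  moreover have "- A s t = 2 * cos th" using st by (simp add: A_def th_def m_def)
  ultimately show ?thesis by simp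
qed

text \<open>If \<open>s\<close> is an ascent of \<open>g\<close>, strip letters \<open>t, s, t, \<dots>\<close> from the left of \<open>g\<close> as long as the
  length drops. The simple root of \<open>s\<close> becomes a combination of two simple roots with Chebyshev
  coefficients, which are nonnegative since fewer than \<open>ord (s \<otimes> t)\<close> letters are stripped.\<close>

primrec lalt :: "'a \<Rightarrow> 'a \<Rightarrow> nat \<Rightarrow> 'a \<Rightarrow> 'a" where
  "lalt s t 0 g = g"
| "lalt s t (Suc j) g = (if even j then t else s) \<otimes> lalt s t j g"

lemma lalt_closed: "s \<in> S \<Longrightarrow> t \<in> S \<Longrightarrow> g \<in> carrier W \<Longrightarrow> lalt s t j g \<in> carrier W"
  by (induction j) simp_all

lemma lalt_len:
  "s \<in> S \<Longrightarrow> t \<in> S \<Longrightarrow> g \<in> carrier W \<Longrightarrow> len (lalt s t (n + k) g) \<le> len (lalt s t n g) + k"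
proof (induction k)
  case (Suc k)
  have "len (lalt s t (Suc (n + k)) g) \<le> Suc (len (lalt s t (n + k) g))"
    using len_mult_le lalt_closed Suc.prems by simp
  then show ?case using Suc by simp
qed simp

lemma lalt_even: "s \<in> S \<Longrightarrow> t \<in> S \<Longrightarrow> g \<in> carrier W \<Longrightarrow> lalt s t (2 * n) g = (s \<otimes> t) [^] n \<otimes> g"
proof (induction n)
  case (Suc n)
  have "lalt s t (2 * Suc n) g = s \<otimes> (t \<otimes> ((s \<otimes> t) [^] n \<otimes> g))"
    using Suc by simp
  also have "\<dots> = (s \<otimes> t) [^] Suc n \<otimes> g"
    unfolding nat_pow_Suc2[OF m_closed[OF S_closed[OF Suc.prems(1)] S_closed[OF Suc.prems(2)]]]
    using Suc.prems by (simp add: m_assoc)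
  finally show ?case .
qed simp

text \<open>Stripping \<open>b\<close> applies \<sigma> of \<open>b\<close> to the combination; the
  new coefficient of \<open>simple b\<close> is c times one coefficient minus the other, which is
  the recursion of \<open>cheb\<close>.\<close>

lemma lalt_rep:
  assumes "s \<in> S" "t \<in> S" "g \<in> carrier W"
  shows "rep (inv g) (simple s) = rep (inv (lalt s t j g))
    (cmb (cheb (- A s t) (Suc j)) (simple (if even j then s else t))
      (cheb (- A s t) j) (simple (if even j then t else s)))"
proof (induction j)
  case 0
  have "cmb 1 (simple s) 0 (simple t) = simple s" by (rule ext) (simp add: cmb_def)
  then show ?case by simp
next
  case (Suc j)
  define a where "a = (if even j then s else t)"
  define b where "b = (if even j then t else s)"
  define c where "c = - A s t"
  have ab: "a \<in> S" "b \<in> S" "A a b = - c" "A b b = 2"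
    using assms by (auto simp: a_def b_def c_def A_sym)
  have h: "lalt s t j g \<in> carrier W" using lalt_closed assms by blast
  have e: "lalt s t (Suc j) g = b \<otimes> lalt s t j g" by (simp add: b_def)
  define v where "v = cmb (cheb c (Suc j)) (simple a) (cheb c j) (simple b)"
  have sv: "\<sigma> b v = cmb (cheb c (Suc (Suc j))) (simple b) (cheb c (Suc j)) (simple a)"
    by (rule ext) (use ab in \<open>simp add: v_def \<sigma>_apply cmb_def algebra_simps\<close>)
  have "rep (inv (lalt s t (Suc j) g)) (\<sigma> b v) = rep (inv (lalt s t j g)) (\<sigma> b (\<sigma> b v))"
    using h ab unfolding e by (simp only: inv_mult_group S_closed S_inv rep_mult inv_closed rep_S)
  also have "\<dots> = rep (inv g) (simple s)"
    using Suc ab(2) by (simp only: \<sigma>_invol v_def a_def b_def c_def)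
  finally have F: "rep (inv (lalt s t (Suc j) g)) (\<sigma> b v) = rep (inv g) (simple s)" .
  have "(if even (Suc j) then s else t) = b" "(if even (Suc j) then t else s) = a"
    by (simp_all add: a_def b_def)
  then show ?case using F[symmetric] unfolding sv c_def by (simp only:)
qed

lemma simple_pos:
  assumes "g \<in> carrier W" "s \<in> S" "len g < len (s \<otimes> g)"
  shows "vpos (rep (inv g) (simple s))"
  using assms
proof (induction "len g" arbitrary: g s rule: less_induct)
  case less
  note g = less.prems(1) and s = less.prems(2)
  show ?case
  proof (cases "g = \<one>")
    case False
    then obtain t where t: "t \<in> S" "len g = Suc (len (t \<otimes> g))" using descent_exists g by blast
    then have st: "s \<noteq> t" using less.prems by auto
    define h where "h = (\<lambda>j. lalt s t j g)"
    have h: "h j \<in> carrier W" for j using lalt_closed s t g by (simp add: h_def)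
    have hS: "h (Suc j) = (if even j then t else s) \<otimes> h j" for j by (simp add: h_def)
    have "\<not> (len (h (Suc (len g))) + Suc (len g) = len g)" by simp
    moreover have "len (h 0) + 0 = len g" by (simp add: h_def)
    \<comment> \<open>The last index up to which every stripped letter has lowered the
      length.\<close>
    ultimately obtain j where j: "\<And>i. i \<le> j \<Longrightarrow> len (h i) + i = len g"
      "len (h (Suc j)) + Suc j \<noteq> len g"
      using ex_least_nat_less[of "\<lambda>n. len (h n) + n \<noteq> len g" "Suc (len g)"] by blast
    have "len (h 1) + 1 = len g" using t by (simp add: h_def)
    then have "j \<noteq> 0" using j(2) by (intro notI) simp
    then obtain i where i: "j = Suc i" by (cases j) auto
    have lt: "len (h j) < len g" using j(1)[of j] i by simp
    define a where "a = (if even j then s else t)"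
    define b where "b = (if even j then t else s)"
    have ab: "a \<in> S" "b \<in> S" using s t by (simp_all add: a_def b_def)
    have "len (b \<otimes> h j) = Suc (len (h j)) \<or> len (h j) = Suc (len (b \<otimes> h j))"
      using len_cases ab h by blast
    moreover have "len (b \<otimes> h j) + Suc j \<noteq> len g" using j(2) hS[of j] by (simp add: b_def)
    ultimately have bj: "len (h j) < len (b \<otimes> h j)" using j(1)[of j] by auto
    have "h j = a \<otimes> h i" using hS[of i] i by (simp add: a_def)
    then have "a \<otimes> h j = h i" using ab h by simp
    then have aj: "len (h j) < len (a \<otimes> h j)" using j(1)[of i] j(1)[of j] i by simp
    \<comment> \<open>If at least \<open>ord (s \<otimes> t) = k + 1\<close> letters lowered the
      length, \<open>h (k + 1)\<close> has length \<open>len g - (k + 1)\<close>. After 2k + 2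
      letters the word is back at \<open>g\<close>, and its last letter is \<open>s\<close>, so
      \<open>h (2 k + 1) = s \<otimes> g\<close>. But k letters cannot raise the length from
      \<open>h (k + 1)\<close> beyond \<open>len g - 1\<close>.\<close>
    have m: "ord (s \<otimes> t) = 0 \<or> Suc j \<le> ord (s \<otimes> t)"
    proof (rule ccontr)
      assume "\<not> ?thesis"
      then obtain k where k: "ord (s \<otimes> t) = Suc k" "Suc k \<le> j" by (cases "ord (s \<otimes> t)") auto
      have "h (2 * Suc k) = g"
        using lalt_even[OF s t(1) g, of "Suc k"] pow_ord_eq_1[of "s \<otimes> t"] s t g k by (simp add: h_def)
      then have "s \<otimes> h (Suc k + k) = g" using hS[of "Suc k + k"] by (simp add: mult_2)
      then have "h (Suc k + k) = s \<otimes> g" using s h by auto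
      moreover have "len (h (Suc k + k)) \<le> len (h (Suc k)) + k"
        using lalt_len s t g unfolding h_def by blast
      ultimately show False using j(1)[of "Suc k"] k less.prems(3) by simp
    qed
    have U: "0 \<le> cheb (- A s t) j" "0 \<le> cheb (- A s t) (Suc j)"
      using cheb_nonneg[OF s t(1) st] m by auto
    have "vpos (rep (inv (h j)) (simple a))" "vpos (rep (inv (h j)) (simple b))"
      using less.hyps[OF lt h] ab aj bj by auto
    then have "vpos (cmb (cheb (- A s t) (Suc j)) (rep (inv (h j)) (simple a))
        (cheb (- A s t) j) (rep (inv (h j)) (simple b)))"
      using U by (simp add: vpos_def cmb_def)
    then show ?thesis
      unfolding lalt_rep[OF s t(1) g, of j] using h
      by (simp only: rep_cmb inv_closed h_def a_def b_def)
  qed (simp add: vpos_def)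
qed

definition roots :: "('a + 'a \<Rightarrow> real) set" where
  "roots = {rep g (simple s) | g s. g \<in> carrier W \<and> s \<in> S}"

lemma simple_root: "s \<in> S \<Longrightarrow> simple s \<in> roots"
  unfolding roots_def by (intro CollectI exI[of _ \<one>] exI[of _ s]) simp

lemma root_rep: "\<beta> \<in> roots \<Longrightarrow> g \<in> carrier W \<Longrightarrow> rep g \<beta> \<in> roots"
proof -
  assume "\<beta> \<in> roots" and g: "g \<in> carrier W"
  then obtain h s where "\<beta> = rep h (simple s)" "h \<in> carrier W" "s \<in> S" by (auto simp: roots_def)
  then show ?thesis using g unfolding roots_def
    by (intro CollectI exI[of _ "g \<otimes> h"] exI[of _ s]) (simp add: rep_mult)
qed

lemma root_lat: "\<beta> \<in> roots \<Longrightarrow> lat \<beta>"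
  by (auto simp: roots_def lat_rep lat_simple)

lemma root_norm: "\<beta> \<in> roots \<Longrightarrow> B \<beta> \<beta> = 2"
  by (auto simp: roots_def B_rep lat_simple)

lemma B_sym:
  assumes "lat x" "\<beta> \<in> roots"
  shows "B x \<beta> = B \<beta> x"
proof -
  obtain g s where gs: "\<beta> = rep g (simple s)" "g \<in> carrier W" "s \<in> S" using assms by (auto simp: roots_def)
  define z where "z = rep (inv g) x"
  have z: "lat z" "x = rep g z" using gs assms lat_rep by (simp_all add: z_def)
  have "B x \<beta> = B z (simple s)" "B \<beta> x = B (simple s) z"
    using gs z B_rep lat_simple by simp_all
  then show ?thesis using z by (simp add: lat_def)
qed

lemma simple_neg_root: "s \<in> S \<Longrightarrow> \<sigma> s (simple s) = ng (simple s)"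
  by (rule ext) (simp add: \<sigma>_apply ng_def)

lemma root_ng: "\<beta> \<in> roots \<Longrightarrow> ng \<beta> \<in> roots"
proof -
  assume "\<beta> \<in> roots"
  then obtain g s where gs: "\<beta> = rep g (simple s)" "g \<in> carrier W" "s \<in> S" by (auto simp: roots_def)
  then have "ng \<beta> = rep g (rep s (simple s))" by (simp add: rep_S simple_neg_root rep_ng)
  then show ?thesis using root_rep[OF root_rep[OF simple_root]] gs by simp
qed

lemma root_sign: "\<beta> \<in> roots \<Longrightarrow> vpos \<beta> \<or> vneg \<beta>"
proof -
  assume "\<beta> \<in> roots"
  then obtain g s where gs: "\<beta> = rep g (simple s)" "g \<in> carrier W" "s \<in> S" by (auto simp: roots_def)
  show ?thesis
  proof (cases "len (inv g) < len (s \<otimes> inv g)")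
    case True
    then show ?thesis using simple_pos[of "inv g" s] gs by simp
  next
    case False
    define h where "h = g \<otimes> s"
    have h: "h \<in> carrier W" "inv h = s \<otimes> inv g" using gs by (simp_all add: h_def inv_mult_group S_inv)
    have "len (inv h) < len (s \<otimes> inv h)"
      using False len_cases[of s "inv g"] gs h by auto
    then have "vpos (rep (inv (inv h)) (simple s))"
      by (intro simple_pos) (use h(1) gs in simp_all)
    then have "vpos (rep h (simple s))" using h(1) by (simp only: inv_inv)
    moreover have "rep h (simple s) = ng \<beta>"
      using gs by (simp add: h_def rep_mult rep_S simple_neg_root rep_ng)
    ultimately show ?thesis by simp
  qed
qed

lemma root_excl: "\<beta> \<in> roots \<Longrightarrow> vpos \<beta> \<Longrightarrow> \<not> vneg \<beta>"
proof
  assume b: "\<beta> \<in> roots" "vpos \<beta>" "vneg \<beta>"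
  then have "\<beta> (Inl a) = 0" for a unfolding vpos_def vneg_def by (meson antisym)
  then have "B \<beta> \<beta> = 0" by (simp add: B_def)
  then show False using root_norm[OF b(1)] by simp
qed

lemma root_vneg: "\<beta> \<in> roots \<Longrightarrow> vneg \<beta> \<longleftrightarrow> \<not> vpos \<beta>"
  using root_sign root_excl by blast

text \<open>A nontrivial element has a left descent \<open>s\<close>, and then its inverse sends the
  simple root of \<open>s\<close> to a negative root, which the identity does not.\<close>

lemma rep_faithful:
  assumes "g \<in> carrier W" "h \<in> carrier W" "\<And>x. rep g x = rep h x"
  shows "g = h"
proof (rule ccontr)
  assume ne: "g \<noteq> h"
  define k where "k = inv (inv h \<otimes> g)"
  have k: "k \<in> carrier W" "inv k = inv h \<otimes> g" using assms by (simp_all add: k_def)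
  have "k \<noteq> \<one>"
  proof
    assume "k = \<one>"
    then have "h \<otimes> (inv h \<otimes> g) = h" using assms k(2) by simp
    then show False using ne assms by (simp add: m_assoc[symmetric])
  qed
  then obtain s where s: "s \<in> S" "len k = Suc (len (s \<otimes> k))" using descent_exists k by blast
  have id: "rep (inv k) x = x" for x using assms k by (simp add: rep_mult)
  have "vpos (rep (inv (s \<otimes> k)) (simple s))" using simple_pos[of "s \<otimes> k" s] s k by simp
  moreover have "rep (inv (s \<otimes> k)) (simple s) = ng (simple s)"
    using s k(1) by (simp only: inv_mult_group S_closed S_inv rep_mult inv_closed rep_S id simple_neg_root)
  ultimately have "vneg (simple s)" by simp
  then show False using root_excl[OF simple_root] s by (auto simp: vpos_def)
qed

section \<open>Reflections and inversions\<close>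

definition rfl :: "('a + 'a \<Rightarrow> real) \<Rightarrow> 'a" where
  "rfl \<beta> = (THE t. t \<in> carrier W \<and> (\<forall>x. rep t x = cmb 1 x (- B x \<beta>) \<beta>))"

lemma rfl_unique:
  assumes "t \<in> carrier W" "\<And>x. rep t x = cmb 1 x (- B x \<beta>) \<beta>"
  shows "rfl \<beta> = t"
  unfolding rfl_def using assms by (intro the_equality) (auto intro: rep_faithful)

lemma rep_conj:
  assumes "g \<in> carrier W" "t \<in> carrier W" "lat \<beta>" "\<And>x. rep t x = cmb 1 x (- B x \<beta>) \<beta>"
  shows "rep (g \<otimes> t \<otimes> inv g) x = cmb 1 x (- B x (rep g \<beta>)) (rep g \<beta>)"
proof -
  have "rep (g \<otimes> t \<otimes> inv g) x = cmb 1 x (- B (rep (inv g) x) \<beta>) (rep g \<beta>)"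
    using assms by (simp add: rep_mult rep_cmb)
  also have "B (rep (inv g) x) \<beta> = B x (rep g \<beta>)"
    using B_rep[OF assms(1,3), of "rep (inv g) x"] assms by simp
  finally show ?thesis .
qed

lemma rfl_conj_simple:
  assumes "g \<in> carrier W" "s \<in> S"
  shows "rfl (rep g (simple s)) = g \<otimes> s \<otimes> inv g"
  using assms by (intro rfl_unique rep_conj) (simp_all add: lat_simple rep_S \<sigma>_def)

lemma rfl_rep:
  assumes "\<beta> \<in> roots"
  shows "rfl \<beta> \<in> carrier W" "rep (rfl \<beta>) x = cmb 1 x (- B x \<beta>) \<beta>" "rfl \<beta> \<in> reflections W S"
proof -
  obtain g s where gs: "\<beta> = rep g (simple s)" "g \<in> carrier W" "s \<in> S" using assms by (auto simp: roots_def)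
  then show "rfl \<beta> \<in> carrier W" "rep (rfl \<beta>) x = cmb 1 x (- B x \<beta>) \<beta>" "rfl \<beta> \<in> reflections W S"
    using rfl_conj_simple[of g s] rep_conj[of g s "simple s" x]
    by (auto simp: reflections_def lat_simple rep_S \<sigma>_def)
qed

lemma rfl_conj:
  assumes "\<beta> \<in> roots" "g \<in> carrier W"
  shows "rfl (rep g \<beta>) = g \<otimes> rfl \<beta> \<otimes> inv g"
  using assms by (intro rfl_unique rep_conj) (simp_all add: rfl_rep root_lat)

lemma rfl_ng: "\<beta> \<in> roots \<Longrightarrow> rfl (ng \<beta>) = rfl \<beta>"
  by (rule rfl_unique) (auto simp: rfl_rep cmb_def ng_def[of \<beta>] B_def sum_negf)

lemma rfl_simple: "s \<in> S \<Longrightarrow> rfl (simple s) = s"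
  using rfl_conj_simple[of \<one> s] by simp

lemma rfl_sq: "\<beta> \<in> roots \<Longrightarrow> x \<in> carrier W \<Longrightarrow> rfl \<beta> \<otimes> (rfl \<beta> \<otimes> x) = x"
proof -
  assume b: "\<beta> \<in> roots" "x \<in> carrier W"
  then obtain g s where gs: "\<beta> = rep g (simple s)" "g \<in> carrier W" "s \<in> S" by (auto simp: roots_def)
  then have "rfl \<beta> \<otimes> (rfl \<beta> \<otimes> x) = g \<otimes> (s \<otimes> (inv g \<otimes> (g \<otimes> (s \<otimes> (inv g \<otimes> x)))))"
    using b by (simp add: rfl_conj_simple m_assoc)
  also have "\<dots> = x" using gs b by (simp add: m_assoc[symmetric] S_sq)
  finally show ?thesis .
qed

lemma rfl_self: "\<beta> \<in> roots \<Longrightarrow> rep (rfl \<beta>) \<beta> = ng \<beta>"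
  by (rule ext) (simp add: rfl_rep root_norm cmb_def ng_def)

lemma reflection_root:
  assumes "t \<in> reflections W S"
  shows "\<exists>\<beta>\<in>roots. vpos \<beta> \<and> rfl \<beta> = t"
proof -
  obtain g s where gs: "t = g \<otimes> s \<otimes> inv g" "g \<in> carrier W" "s \<in> S"
    using assms by (auto simp: reflections_def)
  then have "rep g (simple s) \<in> roots" "rfl (rep g (simple s)) = t"
    using root_rep simple_root rfl_conj_simple by auto
  then show ?thesis using root_sign root_ng rfl_ng vpos_ng(1) by metis
qed

text \<open>The root coefficients determine the pairing coordinates through \<open>lat\<close>, and
  the common norm 2 leaves only c = 1.\<close>

lemma root_proportional:
  assumes "\<beta> \<in> roots" "\<gamma> \<in> roots" "c > 0" "\<And>a. \<beta> (Inl a) = c * \<gamma> (Inl a)"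
  shows "\<beta> = \<gamma>"
proof -
  have "{b. \<beta> (Inl b) \<noteq> 0} = {b. \<gamma> (Inl b) \<noteq> 0}" using assms by simp
  then have B: "B x \<beta> = c * B x \<gamma>" for x
    using assms(4) unfolding B_def by (simp add: sum_distrib_left mult.assoc)
  have "\<beta> (Inr a) = c * \<gamma> (Inr a)" for a
    using root_lat[OF assms(1)] root_lat[OF assms(2)] B by (simp add: lat_def)
  then have bg: "\<beta> i = c * \<gamma> i" for i using assms(4) by (cases i) auto
  then have "\<beta> = cmb c \<gamma> 0 \<gamma>" by (intro ext) (simp add: cmb_def)
  then have "B \<beta> \<beta> = c * c * 2"
    using B[of \<beta>] root_norm[OF assms(2)] by (simp add: B_cmb_left)
  then have "c = 1" using root_norm[OF assms(1)] assms(3) by (simp add: square_eq_1_iff)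
  then show ?thesis using bg by auto
qed

text \<open>The reflection changes only the coefficient at \<open>s\<close>. If the sign flips, all
  other coefficients are zero.\<close>

lemma simple_unique_sign_change:
  assumes "\<beta> \<in> roots" "vpos \<beta>" "s \<in> S" "\<not> vpos (\<sigma> s \<beta>)"
  shows "\<beta> = simple s"
proof -
  have r: "\<sigma> s \<beta> \<in> roots" using root_rep[OF assms(1), of s] assms by (simp add: rep_S)
  then have n: "vneg (\<sigma> s \<beta>)" using root_vneg assms by blast
  have z: "\<beta> (Inl a) = 0" if "a \<noteq> s" for a
  proof (rule antisym)
    have "\<sigma> s \<beta> (Inl a) = \<beta> (Inl a)" using that by (simp add: \<sigma>_apply)
    then show "\<beta> (Inl a) \<le> 0" using n by (metis vneg_def)
    show "0 \<le> \<beta> (Inl a)" using assms(2) by (simp add: vpos_def)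
  qed
  have "\<beta> (Inl s) \<noteq> 0"
  proof
    assume "\<beta> (Inl s) = 0"
    then have "\<beta> (Inl a) = 0" for a using z by metis
    then show False using root_excl[OF assms(1,2)] by (simp add: vneg_def)
  qed
  then have "\<beta> (Inl s) > 0" using assms(2) by (auto simp: vpos_def less_le)
  then show ?thesis
    by (rule root_proportional[OF assms(1) simple_root[OF assms(3)]]) (use z in auto)
qed

text \<open>Strip the left letter \<open>s\<close>. Unless \<beta> is its simple root, \<sigma> of
  \<open>s\<close> keeps \<beta> positive and conjugates its reflection, so the shorter element
  takes over.\<close>

lemma len_rfl_less:
  assumes "b \<in> carrier W" "\<beta> \<in> roots" "vpos \<beta>" "vneg (rep (inv b) \<beta>)"
  shows "len (rfl \<beta> \<otimes> b) < len b"
  using assms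
proof (induction b arbitrary: \<beta> rule: carrier_induct)
  case one
  then show ?case using root_excl by simp
next
  case (mult s b)
  note s = mult.hyps
  show ?case
  proof (cases "\<beta> = simple s")
    case True
    then show ?thesis using s rfl_simple by simp
  next
    case False
    let ?b = "\<sigma> s \<beta>"
    have p: "vpos ?b" using simple_unique_sign_change mult False by blast
    have r: "?b \<in> roots" using root_rep[of \<beta> s] mult by (simp add: rep_S)
    have "rep (inv b) ?b = rep (inv (s \<otimes> b)) \<beta>"
      using s by (simp add: inv_mult_group S_inv rep_mult rep_S)
    then have l: "len (rfl ?b \<otimes> b) < len b" using mult.IH[OF r p] mult.prems by simp
    have "rfl ?b = s \<otimes> rfl \<beta> \<otimes> s"
      using rfl_conj[of \<beta> s] mult.prems s by (simp add: rep_S S_inv)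
    then have "s \<otimes> (rfl ?b \<otimes> b) = rfl \<beta> \<otimes> (s \<otimes> b)"
      using s mult.prems rfl_rep by (simp add: m_assoc)
    moreover have "len (s \<otimes> (rfl ?b \<otimes> b)) \<le> Suc (len (rfl ?b \<otimes> b))"
      using len_mult_le s rfl_rep[OF r] by simp
    ultimately show ?thesis using l s by simp
  qed
qed

lemma len_rfl:
  assumes b: "b \<in> carrier W" and \<beta>: "\<beta> \<in> roots" "vpos \<beta>"
  shows "len (rfl \<beta> \<otimes> b) < len b \<longleftrightarrow> vneg (rep (inv b) \<beta>)"
    and "len b < len (rfl \<beta> \<otimes> b) \<longleftrightarrow> vpos (rep (inv b) \<beta>)"
proof -
  have r: "rep (inv b) \<beta> \<in> roots" using root_rep b \<beta> by simp
  have t: "rfl \<beta> \<in> carrier W" using rfl_rep \<beta> by blast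
  have up: "len b < len (rfl \<beta> \<otimes> b)" if "vpos (rep (inv b) \<beta>)"
  proof -
    have "inv (rfl \<beta>) = rfl \<beta>" using rfl_sq[OF \<beta>(1), of \<one>] t inv_equality by simp
    then have "rep (inv (rfl \<beta> \<otimes> b)) \<beta> = ng (rep (inv b) \<beta>)"
      using b t \<beta> by (simp add: inv_mult_group rep_mult rfl_self rep_ng)
    then show ?thesis
      using len_rfl_less[of "rfl \<beta> \<otimes> b" \<beta>] that b t \<beta> rfl_sq[OF \<beta>(1) b] by simp
  qed
  show "len (rfl \<beta> \<otimes> b) < len b \<longleftrightarrow> vneg (rep (inv b) \<beta>)"
    "len b < len (rfl \<beta> \<otimes> b) \<longleftrightarrow> vpos (rep (inv b) \<beta>)"
    using up len_rfl_less[OF b \<beta>] root_vneg[OF r] by (meson less_asym)+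
qed

lemma finite_inversions:
  "b \<in> carrier W \<Longrightarrow> finite {\<beta> \<in> roots. vpos \<beta> \<and> vneg (rep (inv b) \<beta>)}"
proof (induction b rule: carrier_induct)
  case one
  have "{\<beta> \<in> roots. vpos \<beta> \<and> vneg (rep (inv \<one>) \<beta>)} = {}" using root_excl by auto
  then show ?case by (simp only: finite.emptyI)
next
  case (mult s b)
  have "{\<beta> \<in> roots. vpos \<beta> \<and> vneg (rep (inv (s \<otimes> b)) \<beta>)} \<subseteq>
      insert (simple s) (\<sigma> s ` {\<beta> \<in> roots. vpos \<beta> \<and> vneg (rep (inv b) \<beta>)})"
  proof
    fix \<beta> assume "\<beta> \<in> {\<beta> \<in> roots. vpos \<beta> \<and> vneg (rep (inv (s \<otimes> b)) \<beta>)}"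
    then have b: "\<beta> \<in> roots" "vpos \<beta>" "vneg (rep (inv b) (\<sigma> s \<beta>))"
      using mult.hyps by (auto simp: inv_mult_group S_inv rep_mult rep_S)
    have r: "\<sigma> s \<beta> \<in> roots" using root_rep[of \<beta> s] mult b by (simp add: rep_S)
    show "\<beta> \<in> insert (simple s) (\<sigma> s ` {\<beta> \<in> roots. vpos \<beta> \<and> vneg (rep (inv b) \<beta>)})"
    proof (cases "\<beta> = simple s")
      case False
      then have "vpos (\<sigma> s \<beta>)" using simple_unique_sign_change b mult by blast
      then have "\<sigma> s \<beta> \<in> {\<beta> \<in> roots. vpos \<beta> \<and> vneg (rep (inv b) \<beta>)}" using r b by simp
      then have "\<sigma> s (\<sigma> s \<beta>) \<in> \<sigma> s ` {\<beta> \<in> roots. vpos \<beta> \<and> vneg (rep (inv b) \<beta>)}" by (rule imageI)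
      then show ?thesis using \<sigma>_invol mult by simp
    qed simp
  qed
  then show ?case by (rule finite_subset) (use mult.IH in simp)
qed

end

section \<open>Covers and planes of roots\<close>

definition det2 :: "'a \<Rightarrow> 'a \<Rightarrow> ('a + 'a \<Rightarrow> real) \<Rightarrow> ('a + 'a \<Rightarrow> real) \<Rightarrow> real" where
  "det2 i j x y = x (Inl i) * y (Inl j) - x (Inl j) * y (Inl i)"

context coxeter_system
begin

lemma vpos_cmb: "vpos x \<Longrightarrow> vpos y \<Longrightarrow> 0 \<le> c \<Longrightarrow> 0 \<le> d \<Longrightarrow> vpos (cmb c x d y)"
  and vneg_cmb: "vneg x \<Longrightarrow> vneg y \<Longrightarrow> 0 \<le> c \<Longrightarrow> 0 \<le> d \<Longrightarrow> vneg (cmb c x d y)"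
  by (simp_all add: vpos_def vneg_def cmb_def add_nonpos_nonpos mult_nonneg_nonpos)

definition plane :: "('a + 'a \<Rightarrow> real) \<Rightarrow> ('a + 'a \<Rightarrow> real) \<Rightarrow> ('a + 'a \<Rightarrow> real) set" where
  "plane x y = {cmb c x d y | c d. True}"

lemma plane_commute: "plane x y = plane y x"
proof -
  have "cmb c x d y = cmb d y c x" for c d and x y :: "'a + 'a \<Rightarrow> real"
    by (rule ext) (simp add: cmb_def)
  then show ?thesis unfolding plane_def by metis
qed

lemma plane_cmb: "u \<in> plane x y \<Longrightarrow> v \<in> plane x y \<Longrightarrow> cmb c u d v \<in> plane x y"
proof -
  assume "u \<in> plane x y" "v \<in> plane x y"
  then obtain a b a' b' where "u = cmb a x b y" "v = cmb a' x b' y" by (auto simp: plane_def)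
  then have "cmb c u d v = cmb (c * a + d * a') x (c * b + d * b') y"
    by (intro ext) (simp add: cmb_def algebra_simps)
  then show ?thesis by (auto simp: plane_def)
qed

lemma plane_basis: "x \<in> plane x y" "y \<in> plane x y"
proof -
  have "x = cmb 1 x 0 y" "y = cmb 0 x 1 y" by (simp_all add: cmb_def)
  then show "x \<in> plane x y" "y \<in> plane x y" unfolding plane_def by blast+
qed

text \<open>A Pluecker relation for three vectors of a plane; it serves as Cramer's rule for
  \<open>y\<close> in terms of \<open>x\<close> and \<open>z\<close>.\<close>

lemma plane_det:
  assumes "x \<in> plane p q" "y \<in> plane p q" "z \<in> plane p q"
  shows "det2 i j x z * y k = det2 i j y z * x k + det2 i j x y * z k"
proof -
  obtain a1 b1 a2 b2 a3 b3 where "x = cmb a1 p b1 q" "y = cmb a2 p b2 q" "z = cmb a3 p b3 q"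
    using assms by (auto simp: plane_def)
  then show ?thesis by (simp add: det2_def cmb_def algebra_simps)
qed

lemma rfl_inv: "\<beta> \<in> roots \<Longrightarrow> inv (rfl \<beta>) = rfl \<beta>"
  using rfl_sq[of \<beta> \<one>] rfl_rep(1)[of \<beta>] inv_equality by simp

lemma rep_inv_rfl:
  "\<beta> \<in> roots \<Longrightarrow> b \<in> carrier W \<Longrightarrow> rep (inv (rfl \<beta> \<otimes> b)) x = rep (inv b) (rep (rfl \<beta>) x)"
  by (simp only: inv_mult_group rfl_rep(1) rep_mult inv_closed rfl_inv)

lemma rep_rfl_invol: "\<beta> \<in> roots \<Longrightarrow> rep (rfl \<beta>) (rep (rfl \<beta>) x) = x"
  using rep_inv(1)[OF rfl_rep(1)[of \<beta>], of x] by (simp add: rfl_inv)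

lemma rfl_rfl: "\<beta> \<in> roots \<Longrightarrow> \<gamma> \<in> roots \<Longrightarrow> b \<in> carrier W \<Longrightarrow>
  rfl (rep (rfl \<beta>) \<gamma>) \<otimes> (rfl \<beta> \<otimes> b) = rfl \<beta> \<otimes> (rfl \<gamma> \<otimes> b)"
  by (simp add: rfl_conj rfl_inv rfl_rep(1) m_assoc rfl_sq)

text \<open>An inversion \<open>\<beta>\<close> of \<open>b\<close> inside the cone of two others does not give a cover: the product of
  two of the three reflections yields an element strictly between in length.\<close>

lemma inner_inversion_no_cover:
  assumes b: "b \<in> carrier W"
    and \<alpha>: "\<alpha> \<in> roots" "vpos \<alpha>" "vneg (rep (inv b) \<alpha>)"
    and \<beta>: "\<beta> \<in> roots" "vpos \<beta>" "vneg (rep (inv b) \<beta>)"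
    and \<gamma>: "\<gamma> \<in> roots" "vpos \<gamma>" "vneg (rep (inv b) \<gamma>)"
    and comb: "\<beta> = cmb c \<alpha> d \<gamma>" "c > 0" "d > 0" "1 \<le> c * B \<alpha> \<beta>"
    and extr: "cmb (B \<alpha> \<beta>) \<alpha> (- 1) \<beta> \<in> roots \<Longrightarrow> vpos (cmb (B \<alpha> \<beta>) \<alpha> (- 1) \<beta>) \<Longrightarrow>
      \<not> vneg (rep (inv b) (cmb (B \<alpha> \<beta>) \<alpha> (- 1) \<beta>))"
    and cov: "len b = Suc (len (rfl \<beta> \<otimes> b))"
  shows False
proof -
  define k where "k = B \<alpha> \<beta>"
  have ib: "inv b \<in> carrier W" using b by simp
  have tb: "rfl \<alpha> \<otimes> b \<in> carrier W" "rfl \<beta> \<otimes> b \<in> carrier W" using b \<alpha> \<beta> rfl_rep(1) by simp_all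
  \<comment> \<open>This is k \<beta> - \<alpha>, up to sign the reflection of \<alpha> in \<beta>.
    As c k is at least 1, it lies in the cone of \<beta> and \<gamma> and is again a positive
    inversion.\<close>
  define \<epsilon> where "\<epsilon> = ng (rep (rfl \<beta>) \<alpha>)"
  define \<rho> where "\<rho> = rep (rfl \<alpha>) \<beta>"
  have r: "\<epsilon> \<in> roots" "\<rho> \<in> roots"
    using \<alpha> \<beta> rfl_rep(1) by (simp_all add: \<epsilon>_def \<rho>_def root_rep root_ng)
  have k: "1 / c \<le> k" using comb by (simp add: k_def field_simps)
  have \<epsilon>: "\<epsilon> = cmb (k - 1 / c) \<beta> (d / c) \<gamma>"
  proof
    fix i
    have "\<epsilon> i = k * \<beta> i - \<alpha> i" using \<beta> by (simp add: \<epsilon>_def ng_def rfl_rep k_def cmb_def)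
    moreover have "\<beta> i = c * \<alpha> i + d * \<gamma> i" using fun_cong[OF comb(1), of i] by (simp add: cmb_def)
    then have "\<alpha> i = \<beta> i / c - d / c * \<gamma> i" using comb(2) by (simp add: field_simps)
    ultimately show "\<epsilon> i = cmb (k - 1 / c) \<beta> (d / c) \<gamma> i" by (simp add: cmb_def algebra_simps)
  qed
  have pe: "vpos \<epsilon>"
    unfolding \<epsilon> using \<beta> \<gamma> comb k by (simp add: vpos_def cmb_def)
  have ne: "vneg (rep (inv b) \<epsilon>)"
  proof -
    have "0 \<le> k - 1 / c" "0 \<le> d / c" using k comb by simp_all
    then show ?thesis
      using \<beta>(3) \<gamma>(3) unfolding \<epsilon> rep_cmb[OF ib] by (rule vneg_cmb[rotated 2])
  qed
  have l\<alpha>: "len (rfl \<alpha> \<otimes> b) < len b" using len_rfl(1)[OF b \<alpha>(1,2)] \<alpha> by simp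
  show False
  proof (cases "vpos \<rho>")
    case True
    define Y where "Y = rfl \<alpha> \<otimes> (rfl \<beta> \<otimes> b)"
    have "rep (inv (rfl \<beta> \<otimes> b)) \<alpha> = ng (rep (inv b) \<epsilon>)"
      using rep_inv_rfl[OF \<beta>(1) b] ib by (simp add: \<epsilon>_def rep_ng)
    then have 1: "len (rfl \<beta> \<otimes> b) < len Y"
      using len_rfl(2)[OF tb(2) \<alpha>(1,2)] ne by (simp add: Y_def)
    have "rep (inv (rfl \<alpha> \<otimes> b)) \<rho> = rep (inv b) \<beta>"
      using rep_inv_rfl[OF \<alpha>(1) b] rep_rfl_invol[OF \<alpha>(1)] by (simp add: \<rho>_def)
    then have "len (rfl \<rho> \<otimes> (rfl \<alpha> \<otimes> b)) < len (rfl \<alpha> \<otimes> b)"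
      using len_rfl(1)[OF tb(1) r(2) True] \<beta> by simp
    then have "len Y < len (rfl \<alpha> \<otimes> b)"
      using rfl_rfl[OF \<alpha>(1) \<beta>(1) b] by (simp add: Y_def \<rho>_def)
    then show False using 1 l\<alpha> cov by simp
  next
    case False
    define Y where "Y = rfl \<beta> \<otimes> (rfl \<alpha> \<otimes> b)"
    have e: "ng \<rho> = cmb (B \<alpha> \<beta>) \<alpha> (- 1) \<beta>"
      using \<alpha> B_sym[OF root_lat[OF \<beta>(1)] \<alpha>(1)] by (intro ext) (simp add: \<rho>_def ng_def rfl_rep cmb_def)
    have "vpos (ng \<rho>)" using False root_vneg[OF r(2)] by simp
    then have "\<not> vneg (rep (inv b) (ng \<rho>))" using extr root_ng[OF r(2)] unfolding e by blast
    then have v: "vneg (rep (inv b) \<rho>)" using root_sign[OF root_rep[OF r(2) ib]] ib by (simp add: rep_ng)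
    have "rep (inv (rfl \<beta> \<otimes> b)) \<epsilon> = ng (rep (inv b) \<alpha>)"
      using rep_inv_rfl[OF \<beta>(1) b] rep_rfl_invol[OF \<beta>(1)] rfl_rep(1)[OF \<beta>(1)] ib
      by (simp add: \<epsilon>_def rep_ng)
    then have "len (rfl \<beta> \<otimes> b) < len (rfl \<epsilon> \<otimes> (rfl \<beta> \<otimes> b))"
      using len_rfl(2)[OF tb(2) r(1) pe] \<alpha> by simp
    moreover have "rfl \<epsilon> = rfl (rep (rfl \<beta>) \<alpha>)"
      using \<alpha> \<beta> rfl_rep(1) by (simp add: \<epsilon>_def rfl_ng root_rep)
    ultimately have 1: "len (rfl \<beta> \<otimes> b) < len Y"
      using rfl_rfl[OF \<beta>(1) \<alpha>(1) b] by (simp add: Y_def)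
    have "rep (inv (rfl \<alpha> \<otimes> b)) \<beta> = rep (inv b) \<rho>"
      using rep_inv_rfl[OF \<alpha>(1) b] by (simp add: \<rho>_def)
    then have "len Y < len (rfl \<alpha> \<otimes> b)"
      using len_rfl(1)[OF tb(1) \<beta>(1,2)] v by (simp add: Y_def)
    then show False using 1 l\<alpha> cov by simp
  qed
qed

lemma det2_exists:
  assumes "\<alpha> \<in> roots" "vpos \<alpha>" "\<beta> \<in> roots" "vpos \<beta>" "\<alpha> \<noteq> \<beta>"
  shows "\<exists>i j. det2 i j \<alpha> \<beta> \<noteq> 0"
proof (rule ccontr)
  assume "\<not> ?thesis"
  then have z: "\<alpha> (Inl i) * \<beta> (Inl j) = \<alpha> (Inl j) * \<beta> (Inl i)" for i j by (simp add: det2_def)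
  obtain i where i: "\<alpha> (Inl i) > 0"
    using root_excl[OF assms(1,2)] by (auto simp: vneg_def not_le)
  obtain j where j: "\<beta> (Inl j) > 0"
    using root_excl[OF assms(3,4)] by (auto simp: vneg_def not_le)
  have e: "\<alpha> (Inl a) = (\<alpha> (Inl j) / \<beta> (Inl j)) * \<beta> (Inl a)" for a
    using z[of a j] j by (simp add: field_simps)
  then have "\<alpha> (Inl j) / \<beta> (Inl j) > 0"
    using i j assms(2) unfolding vpos_def
    by (metis (no_types, lifting) divide_pos_pos less_eq_real_def mult_zero_left order_less_irrefl divide_eq_0_iff)
  then show False using root_proportional[OF assms(1,3)] e assms(5) by blast
qed

text \<open>The form may degenerate on the two roots, so \<open>y\<close> is not sought in their
  span: Cramer's rule gives it on the two free pairing coordinates at \<open>i\<close> and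
  \<open>j\<close>.\<close>

lemma separating_functional:
  assumes "lat \<alpha>" "lat \<beta>" "det2 i j \<alpha> \<beta> \<noteq> 0"
  shows "\<exists>y. B y \<alpha> = 0 \<and> B y \<beta> = 1"
proof -
  have ij: "i \<noteq> j" using assms by (auto simp: det2_def)
  define D where "D = det2 i j \<alpha> \<beta>"
  define y :: "'a + 'a \<Rightarrow> real" where
    "y = (\<lambda>k. if k = Inr i then - \<alpha> (Inl j) / D else if k = Inr j then \<alpha> (Inl i) / D else 0)"
  have "B y z = z (Inl i) * y (Inr i) + z (Inl j) * y (Inr j)" if "fsupp z" for z
  proof -
    have "B y z = (\<Sum>b\<in>{b. z (Inl b) \<noteq> 0} \<union> {i, j}. z (Inl b) * y (Inr b))"
      using that by (intro B_superset) (auto simp: fsupp_def)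
    also have "\<dots> = (\<Sum>b\<in>{i, j}. z (Inl b) * y (Inr b))"
      using that by (intro sum.mono_neutral_right) (auto simp: fsupp_def y_def)
    finally show ?thesis using ij by simp
  qed
  then have "B y z = (z (Inl j) * \<alpha> (Inl i) - z (Inl i) * \<alpha> (Inl j)) / D" if "fsupp z" for z
    using that ij by (simp add: y_def diff_divide_distrib)
  moreover have "(\<beta> (Inl j) * \<alpha> (Inl i) - \<beta> (Inl i) * \<alpha> (Inl j)) / D = 1"
    using assms(3) by (simp add: D_def det2_def mult.commute)
  ultimately show ?thesis using assms(1,2) by (intro exI[of _ y]) (simp add: lat_def)
qed

text \<open>All vectors moved by a product of two reflections move by a vector in the plane of the two roots.\<close>

lemma rfl_product_plane_aux:
  assumes r: "\<alpha> \<in> roots" "\<beta> \<in> roots" "\<alpha>' \<in> roots" "\<beta>' \<in> roots" and p: "vpos \<alpha>'" "vpos \<beta>'"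
    and ne: "\<alpha>' \<noteq> \<beta>'" and eq: "rfl \<alpha> \<otimes> rfl \<beta> = rfl \<alpha>' \<otimes> rfl \<beta>'"
  shows "\<beta>' \<in> plane \<alpha> \<beta>"
proof -
  obtain i j where "det2 i j \<alpha>' \<beta>' \<noteq> 0" using det2_exists r p ne by metis
  then obtain y where y: "B y \<alpha>' = 0" "B y \<beta>' = 1"
    using separating_functional root_lat r by blast
  \<comment> \<open>The right-hand product sends this vector to \<open>y\<close>, so it moves it by
    exactly \<beta>'. The left-hand product moves every vector by a combination of \<alpha> and
    \<beta>.\<close>
  define y' where "y' = rep (rfl \<beta>') y"
  have y': "y' = cmb 1 y (- 1) \<beta>'" using y r by (simp add: y'_def rfl_rep)
  have g: "rep (rfl \<alpha>) (rep (rfl \<beta>) x) = rep (rfl \<alpha>') (rep (rfl \<beta>') x)" for x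
    using eq r rfl_rep(1) by (simp add: rep_mult[symmetric])
  have "rep (rfl \<alpha>) (rep (rfl \<beta>) y') = rep (rfl \<alpha>') y"
    unfolding g y'_def using rep_rfl_invol r by simp
  also have "\<dots> = y" using y r by (intro ext) (simp add: rfl_rep cmb_def)
  finally have gy: "rep (rfl \<alpha>) (rep (rfl \<beta>) y') = y" .
  define u where "u = B (rep (rfl \<beta>) y') \<alpha>"
  have "y i = y' i - B y' \<beta> * \<beta> i - u * \<alpha> i" for i
  proof -
    have "y i = rep (rfl \<alpha>) (rep (rfl \<beta>) y') i" by (simp only: gy)
    also have "\<dots> = rep (rfl \<beta>) y' i - u * \<alpha> i"
      by (subst rfl_rep(2)[OF r(1)]) (simp add: cmb_def u_def)
    also have "rep (rfl \<beta>) y' i = y' i - B y' \<beta> * \<beta> i"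
      by (subst rfl_rep(2)[OF r(2)]) (simp add: cmb_def)
    finally show ?thesis by simp
  qed
  then have "\<beta>' i = (- u) * \<alpha> i + (- B y' \<beta>) * \<beta> i" for i
    using fun_cong[OF y', of i] by (simp add: cmb_def)
  then have "\<beta>' = cmb (- u) \<alpha> (- B y' \<beta>) \<beta>" by (intro ext) (simp add: cmb_def)
  then show ?thesis by (auto simp: plane_def)
qed

lemma rfl_product_plane:
  assumes r: "\<alpha> \<in> roots" "\<beta> \<in> roots" "\<alpha>' \<in> roots" "\<beta>' \<in> roots" and p: "vpos \<alpha>'" "vpos \<beta>'"
    and ne: "\<alpha>' \<noteq> \<beta>'" and eq: "rfl \<alpha> \<otimes> rfl \<beta> = rfl \<alpha>' \<otimes> rfl \<beta>'"
  shows "\<alpha>' \<in> plane \<alpha> \<beta>" "\<beta>' \<in> plane \<alpha> \<beta>"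
proof -
  show "\<beta>' \<in> plane \<alpha> \<beta>" using rfl_product_plane_aux assms by blast
  have "inv (rfl \<alpha> \<otimes> rfl \<beta>) = inv (rfl \<alpha>' \<otimes> rfl \<beta>')" using eq by simp
  then have "rfl \<beta> \<otimes> rfl \<alpha> = rfl \<beta>' \<otimes> rfl \<alpha>'"
    using r rfl_rep(1) by (simp add: inv_mult_group rfl_inv)
  then show "\<alpha>' \<in> plane \<alpha> \<beta>"
    using rfl_product_plane_aux[OF r(2,1,4,3) p(2,1)] ne plane_commute by metis
qed

context
  fixes p1 p2 :: "'a + 'a \<Rightarrow> real" and i j :: 'a
  assumes D: "det2 i j p1 p2 \<noteq> 0"
begin

definition plane_roots :: "('a + 'a \<Rightarrow> real) set" where
  "plane_roots = {\<beta> \<in> roots. vpos \<beta> \<and> \<beta> \<in> plane p1 p2}"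

text \<open>An affine coordinate on the rays of positive roots in the plane. The sum is used as
  denominator because one coordinate alone may vanish on a root; both cannot, by
  \<open>D\<close>.\<close>

definition slope :: "('a + 'a \<Rightarrow> real) \<Rightarrow> real" where
  "slope x = x (Inl j) / (x (Inl i) + x (Inl j))"

lemma plane_roots_pos: "\<beta> \<in> plane_roots \<Longrightarrow> 0 < \<beta> (Inl i) + \<beta> (Inl j)"
proof (rule ccontr)
  assume b: "\<beta> \<in> plane_roots" and "\<not> 0 < \<beta> (Inl i) + \<beta> (Inl j)"
  moreover have "0 \<le> \<beta> (Inl i)" "0 \<le> \<beta> (Inl j)" using b by (simp_all add: plane_roots_def vpos_def)
  ultimately have z: "\<beta> (Inl i) = 0" "\<beta> (Inl j) = 0" by linarith+
  have "det2 i j p1 p2 * \<beta> k = det2 i j \<beta> p2 * p1 k + det2 i j p1 \<beta> * p2 k" for k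
    using plane_det[OF plane_basis(1) _ plane_basis(2), of \<beta> p1 p2 i j k] b by (simp add: plane_roots_def)
  then have "\<beta> k = 0" for k using D z by (simp add: det2_def)
  then show False using b root_excl[of \<beta>] by (simp add: plane_roots_def vneg_def)
qed

lemma det2_slope:
  assumes "x \<in> plane_roots" "y \<in> plane_roots"
  shows "det2 i j x y = (x (Inl i) + x (Inl j)) * (y (Inl i) + y (Inl j)) * (slope y - slope x)"
proof -
  have s: "z (Inl j) = slope z * (z (Inl i) + z (Inl j))"
    "z (Inl i) = (1 - slope z) * (z (Inl i) + z (Inl j))" if "z \<in> plane_roots" for z
    using plane_roots_pos[OF that] by (simp_all add: slope_def field_simps)
  show ?thesis unfolding det2_def
    by (subst s(1)[OF assms(1)], subst s(2)[OF assms(1)], subst s(1)[OF assms(2)], subst s(2)[OF assms(2)])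
      (simp add: algebra_simps)
qed

lemma det2_slope_sign:
  assumes "x \<in> plane_roots" "y \<in> plane_roots"
  shows "0 < det2 i j x y \<longleftrightarrow> slope x < slope y"
proof -
  have "0 < (x (Inl i) + x (Inl j)) * (y (Inl i) + y (Inl j))"
    using plane_roots_pos assms by (intro mult_pos_pos) auto
  then show ?thesis unfolding det2_slope[OF assms]
    by (metis diff_gt_0_iff_gt zero_less_mult_pos mult_pos_pos)
qed

lemma slope_inj:
  assumes x: "x \<in> plane_roots" and y: "y \<in> plane_roots" and eq: "slope x = slope y"
  shows "x = y"
proof -
  define c where "c = (x (Inl i) + x (Inl j)) / (y (Inl i) + y (Inl j))"
  have c: "c > 0" using plane_roots_pos x y by (simp add: c_def)
  have s: "z (Inl j) = slope z * (z (Inl i) + z (Inl j))" if "z \<in> plane_roots" for z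
    using plane_roots_pos[OF that] by (simp add: slope_def)
  have cc: "x (Inl i) + x (Inl j) = c * (y (Inl i) + y (Inl j))"
    using plane_roots_pos[OF y] by (simp add: c_def)
  have cj: "x (Inl j) = c * y (Inl j)"
    using s[OF x] s[OF y] eq cc by (metis mult.left_commute)
  then have ci: "x (Inl i) = c * y (Inl i)" using cc by (simp add: algebra_simps)
  have pl: "x \<in> plane p1 p2" "y \<in> plane p1 p2" using x y by (simp_all add: plane_roots_def)
  have "det2 i j p1 p2 * x k = det2 i j p1 p2 * (c * y k)" for k
  proof -
    have "det2 i j p1 p2 * x k = det2 i j x p2 * p1 k + det2 i j p1 x * p2 k"
      using plane_det plane_basis pl by blast
    also have "\<dots> = c * (det2 i j y p2 * p1 k + det2 i j p1 y * p2 k)"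
      by (simp add: det2_def ci cj algebra_simps)
    also have "det2 i j y p2 * p1 k + det2 i j p1 y * p2 k = det2 i j p1 p2 * y k"
      using plane_det plane_basis pl by metis
    finally show ?thesis by simp
  qed
  then have "x k = c * y k" for k using D by simp
  then show ?thesis using root_proportional[OF _ _ c] x y by (simp add: plane_roots_def)
qed

lemma slope_between:
  assumes "x \<in> plane_roots" "y \<in> plane_roots" "z \<in> plane_roots" "slope x < slope y" "slope y < slope z"
  shows "\<exists>c d. c > 0 \<and> d > 0 \<and> y = cmb c x d z"
proof -
  have d: "det2 i j x z > 0" "det2 i j y z > 0" "det2 i j x y > 0"
    using det2_slope_sign assms by auto
  have "y = cmb (det2 i j y z / det2 i j x z) x (det2 i j x y / det2 i j x z) z"
  proof
    fix k
    have "det2 i j x z * y k = det2 i j y z * x k + det2 i j x y * z k"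
      using plane_det[of x p1 p2 y z i j k] assms by (simp add: plane_roots_def)
    then show "y k = cmb (det2 i j y z / det2 i j x z) x (det2 i j x y / det2 i j x z) z k"
      using d(1) by (simp add: cmb_def field_simps)
  qed
  then show ?thesis using d by (metis divide_pos_pos)
qed

text \<open>The orientation of x against k x - y is opposite to that of x against y, so k x - y lies
  on the far side of x.\<close>

lemma slope_beyond:
  assumes "x \<in> plane_roots" "y \<in> plane_roots" "cmb k x (- 1) y \<in> plane_roots"
  shows "slope (cmb k x (- 1) y) < slope x \<longleftrightarrow> slope x < slope y"
    and "slope x < slope (cmb k x (- 1) y) \<longleftrightarrow> slope y < slope x"
proof -
  have "det2 i j x (cmb k x (- 1) y) = det2 i j y x" "det2 i j (cmb k x (- 1) y) x = det2 i j x y"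
    by (simp_all add: det2_def cmb_def algebra_simps)
  then show "slope (cmb k x (- 1) y) < slope x \<longleftrightarrow> slope x < slope y"
    "slope x < slope (cmb k x (- 1) y) \<longleftrightarrow> slope y < slope x"
    using det2_slope_sign assms by metis+
qed

definition plane_inversions :: "'a \<Rightarrow> ('a + 'a \<Rightarrow> real) set" where
  "plane_inversions b = {\<beta> \<in> plane_roots. vneg (rep (inv b) \<beta>)}"

text \<open>Otherwise \<beta> lies in the cone of the two inversions \<alpha>, \<gamma> of extreme
  slope, and \<open>inner_inversion_no_cover\<close> applies to one of them; its condition
  \<open>extr\<close> holds since a root beyond an extreme inversion is no inversion.\<close>

lemma cover_extremal:
  assumes b: "b \<in> carrier W" and \<beta>: "\<beta> \<in> plane_inversions b" and cov: "len b = Suc (len (rfl \<beta> \<otimes> b))"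
  shows "(\<forall>\<gamma>\<in>plane_inversions b. slope \<gamma> \<le> slope \<beta>) \<or> (\<forall>\<gamma>\<in>plane_inversions b. slope \<beta> \<le> slope \<gamma>)"
proof (rule ccontr)
  assume n: "\<not> ?thesis"
  have fin: "finite (plane_inversions b)"
    by (rule finite_subset[OF _ finite_inversions[OF b]]) (auto simp: plane_inversions_def plane_roots_def)
  define \<alpha> where "\<alpha> = arg_min_on slope (plane_inversions b)"
  define \<gamma> where "\<gamma> = arg_min_on (\<lambda>x. - slope x) (plane_inversions b)"
  have ne: "plane_inversions b \<noteq> {}" using \<beta> by auto
  have \<alpha>: "\<alpha> \<in> plane_inversions b" "\<And>x. x \<in> plane_inversions b \<Longrightarrow> slope \<alpha> \<le> slope x"
    unfolding \<alpha>_def using arg_min_if_finite(1)[OF fin ne, of slope] arg_min_least[OF fin ne, of _ slope] by auto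
  have \<gamma>: "\<gamma> \<in> plane_inversions b" "\<And>x. x \<in> plane_inversions b \<Longrightarrow> slope x \<le> slope \<gamma>"
    unfolding \<gamma>_def
    using arg_min_if_finite(1)[OF fin ne, of "\<lambda>x. - slope x"] arg_min_least[OF fin ne, of _ "\<lambda>x. - slope x"] by auto
  obtain u v where "u \<in> plane_inversions b" "slope \<beta> < slope u" "v \<in> plane_inversions b" "slope v < slope \<beta>"
    using n by (auto simp: not_le)
  then have sl: "slope \<alpha> < slope \<beta>" "slope \<beta> < slope \<gamma>"
    using \<alpha>(2) \<gamma>(2) by (meson le_less_trans less_le_trans)+
  have in_plane_roots: "\<alpha> \<in> plane_roots" "\<beta> \<in> plane_roots" "\<gamma> \<in> plane_roots" using \<alpha> \<beta> \<gamma> by (auto simp: plane_inversions_def)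
  obtain c d where cd: "c > 0" "d > 0" "\<beta> = cmb c \<alpha> d \<gamma>" using slope_between in_plane_roots sl by blast
  then have cd': "\<beta> = cmb d \<gamma> c \<alpha>" by (simp add: cmb_def add.commute)
  \<comment> \<open>The norm of \<beta>, split along \<alpha> and \<gamma>: one of the two parts is
    at least 1, and this decides on which side to argue.\<close>
  have "2 = c * B \<alpha> \<beta> + d * B \<gamma> \<beta>"
  proof -
    have "B (cmb c \<alpha> d \<gamma>) \<beta> = c * B \<alpha> \<beta> + d * B \<gamma> \<beta>" by (rule B_cmb_left)
    then show ?thesis using root_norm[of \<beta>] in_plane_roots cd(3) by (simp add: plane_roots_def)
  qed
  then consider "1 \<le> c * B \<alpha> \<beta>" | "1 \<le> d * B \<gamma> \<beta>" by linarith
  moreover have P: "x \<in> roots" "vpos x" "vneg (rep (inv b) x)" "x \<in> plane p1 p2" if "x \<in> plane_inversions b" for x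
    using that by (auto simp: plane_inversions_def plane_roots_def)
  have E: "cmb k x (- 1) \<beta> \<in> plane_inversions b"
    if "x \<in> plane_inversions b" "cmb k x (- 1) \<beta> \<in> roots" "vpos (cmb k x (- 1) \<beta>)" "vneg (rep (inv b) (cmb k x (- 1) \<beta>))" for k x
    using that \<beta> by (auto simp: plane_inversions_def plane_roots_def plane_cmb)
  ultimately show False
  proof cases
    case 1
    show False
    proof (rule inner_inversion_no_cover[OF b P(1-3)[OF \<alpha>(1)] P(1-3)[OF \<beta>] P(1-3)[OF \<gamma>(1)] cd(3,1,2) 1 _ cov])
      assume "cmb (B \<alpha> \<beta>) \<alpha> (- 1) \<beta> \<in> roots" "vpos (cmb (B \<alpha> \<beta>) \<alpha> (- 1) \<beta>)"
      then show "\<not> vneg (rep (inv b) (cmb (B \<alpha> \<beta>) \<alpha> (- 1) \<beta>))"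
        using E[OF \<alpha>(1)] \<alpha>(2) slope_beyond(1)[OF in_plane_roots(1,2)] sl plane_inversions_def by (fastforce simp: not_less)
    qed
  next
    case 2
    show False
    proof (rule inner_inversion_no_cover[OF b P(1-3)[OF \<gamma>(1)] P(1-3)[OF \<beta>] P(1-3)[OF \<alpha>(1)] cd' cd(2,1) 2 _ cov])
      assume "cmb (B \<gamma> \<beta>) \<gamma> (- 1) \<beta> \<in> roots" "vpos (cmb (B \<gamma> \<beta>) \<gamma> (- 1) \<beta>)"
      then show "\<not> vneg (rep (inv b) (cmb (B \<gamma> \<beta>) \<gamma> (- 1) \<beta>))"
        using E[OF \<gamma>(1)] \<gamma>(2) slope_beyond(2)[OF in_plane_roots(3,2)] sl plane_inversions_def by (fastforce simp: not_less)
    qed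
  qed
qed

text \<open>The boundary rays of the cone of all positive roots in the plane, not only of the
  inversions; by \<open>slope_inj\<close> there are at most two such roots.\<close>

definition globally_extremal :: "('a + 'a \<Rightarrow> real) \<Rightarrow> bool" where
  "globally_extremal \<beta> \<longleftrightarrow> (\<forall>\<gamma>\<in>plane_roots. slope \<gamma> \<le> slope \<beta>) \<or> (\<forall>\<gamma>\<in>plane_roots. slope \<beta> \<le> slope \<gamma>)"

text \<open>The two roots are the two ends of the inversions in the plane. If positive roots lay
  outside on both sides, they would not be inversions, so the inverse of \<open>b\<close> would keep
  them positive, and with them everything in their cone, including both ends.\<close>

lemma pair_global_extremal:
  assumes b: "b \<in> carrier W" and \<alpha>: "\<alpha> \<in> plane_inversions b" "len b = Suc (len (rfl \<alpha> \<otimes> b))"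
    and \<gamma>: "\<gamma> \<in> plane_inversions b" "len b = Suc (len (rfl \<gamma> \<otimes> b))" and ne: "\<alpha> \<noteq> \<gamma>"
  shows "globally_extremal \<alpha> \<or> globally_extremal \<gamma>"
proof -
  have *: "globally_extremal x \<or> globally_extremal y"
    if x: "x \<in> plane_inversions b" "len b = Suc (len (rfl x \<otimes> b))" and y: "y \<in> plane_inversions b" "len b = Suc (len (rfl y \<otimes> b))"
      and sl: "slope x < slope y" for x y
  proof (rule ccontr)
    assume n: "\<not> ?thesis"
    have lo: "\<forall>\<gamma>\<in>plane_inversions b. slope x \<le> slope \<gamma>"
      using cover_extremal[OF b x] y(1) sl by (meson not_le)
    have hi: "\<forall>\<gamma>\<in>plane_inversions b. slope \<gamma> \<le> slope y"
      using cover_extremal[OF b y] x(1) sl by (meson not_le)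
    obtain u v where u: "u \<in> plane_roots" "slope u < slope x" and v: "v \<in> plane_roots" "slope y < slope v"
      using n unfolding globally_extremal_def by (meson not_le)
    have np: "u \<notin> plane_inversions b" "v \<notin> plane_inversions b" using lo hi u v by (meson not_le)+
    have "vpos (rep (inv b) z)" if "z \<in> plane_roots" "z \<notin> plane_inversions b" for z
      using that root_sign[OF root_rep, of z "inv b"] b by (auto simp: plane_inversions_def plane_roots_def)
    then have p: "vpos (rep (inv b) u)" "vpos (rep (inv b) v)" using np u v by auto
    have xp: "x \<in> plane_roots" using x by (simp add: plane_inversions_def)
    obtain c d where cd: "c > 0" "d > 0" "x = cmb c u d v"
      using slope_between[OF u(1) xp v(1) u(2)] sl v(2) by auto
    have "vpos (rep (inv b) x)"
      using p cd b by (simp only: rep_cmb inv_closed vpos_cmb less_imp_le)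
    moreover have "rep (inv b) x \<in> roots" using root_rep xp b by (simp add: plane_roots_def)
    ultimately show False using root_excl x by (simp add: plane_inversions_def)
  qed
  have "slope \<alpha> \<noteq> slope \<gamma>" using slope_inj ne \<alpha> \<gamma> by (auto simp: plane_inversions_def)
  then show ?thesis using *[OF \<alpha> \<gamma>] *[OF \<gamma> \<alpha>] by linarith
qed

text \<open>All positive roots of the plane lie in the cone of \<alpha> and \<beta>, hence stay
  positive under the inverse of \<open>c\<close>. A second inversion \<gamma> of the reflected
  element would make B(\<gamma>, \<alpha>) \<alpha> - \<gamma> a positive root beyond the extremal
  \<alpha>.\<close>

lemma two_global_extremal:
  assumes c: "c \<in> carrier W" and \<alpha>: "\<alpha> \<in> plane_roots" "globally_extremal \<alpha>" "vpos (rep (inv c) \<alpha>)"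
    and \<beta>: "\<beta> \<in> plane_roots" "globally_extremal \<beta>" "vpos (rep (inv c) \<beta>)" and ne: "\<alpha> \<noteq> \<beta>"
    and \<gamma>: "\<gamma> \<in> plane_inversions (rfl \<alpha> \<otimes> c)" "\<gamma> \<noteq> \<alpha>"
  shows False
proof -
  have nsl: "slope \<alpha> \<noteq> slope \<beta>" using slope_inj ne \<alpha> \<beta> by auto
  have ic: "inv c \<in> carrier W" using c by simp
  have all_pos: "vpos (rep (inv c) \<delta>)" if \<delta>: "\<delta> \<in> plane_roots" for \<delta>
  proof (cases "\<delta> = \<alpha> \<or> \<delta> = \<beta>")
    case False
    then have n: "slope \<delta> \<noteq> slope \<alpha>" "slope \<delta> \<noteq> slope \<beta>" using slope_inj \<delta> \<alpha> \<beta> by auto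
    consider "slope \<alpha> < slope \<delta>" "slope \<delta> < slope \<beta>" | "slope \<beta> < slope \<delta>" "slope \<delta> < slope \<alpha>"
      using \<alpha> \<beta> \<delta> n nsl unfolding globally_extremal_def by (metis order.antisym order_less_le)
    then have "\<exists>a b. a > 0 \<and> b > 0 \<and> \<delta> = cmb a \<alpha> b \<beta>"
    proof cases
      case 1
      then show ?thesis using slope_between \<alpha> \<beta> \<delta> by blast
    next
      case 2
      then obtain a b where "a > 0" "b > 0" "\<delta> = cmb a \<beta> b \<alpha>" using slope_between \<alpha> \<beta> \<delta> by blast
      moreover have "cmb a \<beta> b \<alpha> = cmb b \<alpha> a \<beta>" by (simp add: cmb_def add.commute)
      ultimately show ?thesis by auto
    qed
    then show ?thesis using \<alpha>(3) \<beta>(3) ic rep_cmb vpos_cmb less_imp_le by metis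
  qed (use \<alpha> \<beta> in auto)
  have r: "\<alpha> \<in> roots" "\<gamma> \<in> roots" using \<alpha> \<gamma> by (auto simp: plane_inversions_def plane_roots_def)
  define \<epsilon> where "\<epsilon> = ng (rep (rfl \<alpha>) \<gamma>)"
  have e: "\<epsilon> = cmb (B \<gamma> \<alpha>) \<alpha> (- 1) \<gamma>"
    using r by (intro ext) (simp add: \<epsilon>_def ng_def rfl_rep cmb_def)
  have er: "rep (rfl \<alpha>) \<gamma> \<in> roots" "\<epsilon> \<in> roots" using r rfl_rep(1) by (simp_all add: \<epsilon>_def root_rep root_ng)
  have "vneg (rep (inv (rfl \<alpha> \<otimes> c)) \<gamma>)" using \<gamma> by (simp add: plane_inversions_def)
  then have n: "vneg (rep (inv c) (rep (rfl \<alpha>) \<gamma>))" using rep_inv_rfl r c by simp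
  have pl: "\<epsilon> \<in> plane p1 p2" unfolding e using \<alpha> \<gamma> by (intro plane_cmb) (auto simp: plane_inversions_def plane_roots_def)
  have pl': "rep (rfl \<alpha>) \<gamma> \<in> plane p1 p2"
  proof -
    have "rep (rfl \<alpha>) \<gamma> = cmb 1 \<gamma> (- B \<gamma> \<alpha>) \<alpha>" using r by (simp add: rfl_rep)
    then show ?thesis using \<alpha> \<gamma> by (simp add: plane_cmb plane_inversions_def plane_roots_def)
  qed
  have "\<not> vpos (rep (rfl \<alpha>) \<gamma>)"
  proof
    assume "vpos (rep (rfl \<alpha>) \<gamma>)"
    then have "vpos (rep (inv c) (rep (rfl \<alpha>) \<gamma>))" using all_pos er pl' by (simp add: plane_roots_def)
    then show False using root_excl[OF root_rep[OF er(1) ic]] n by blast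
  qed
  then have "vpos \<epsilon>" using root_vneg[OF er(1)] by (simp add: \<epsilon>_def)
  then have ep: "\<epsilon> \<in> plane_roots" using er pl by (simp add: plane_roots_def)
  have gp: "\<gamma> \<in> plane_roots" using \<gamma> by (simp add: plane_inversions_def)
  have "slope \<gamma> \<noteq> slope \<alpha>" using slope_inj gp \<alpha> \<gamma> by blast
  then show False
    using slope_beyond[OF \<alpha>(1) gp, of "B \<gamma> \<alpha>"] ep \<alpha>(2) gp unfolding globally_extremal_def e[symmetric]
    by (meson linorder_neqE not_le)
qed

end

text \<open>The product depends only on \<open>b\<close> and \<open>c\<close>. So all pairs of
  reflections that lead from \<open>b\<close> and \<open>c\<close> to a common element have the same
  product, which puts their roots into one plane.\<close>

lemma rfl_eq_product:
  assumes "\<alpha> \<in> roots" "\<gamma> \<in> roots" "b \<in> carrier W" "c \<in> carrier W" "rfl \<alpha> \<otimes> b = rfl \<gamma> \<otimes> c"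
  shows "rfl \<alpha> \<otimes> rfl \<gamma> = b \<otimes> inv c"
proof -
  have "rfl \<gamma> \<otimes> (rfl \<alpha> \<otimes> b) = c" using assms rfl_sq by simp
  then have "rfl \<gamma> = c \<otimes> inv (rfl \<alpha> \<otimes> b)"
    using assms rfl_rep(1) by (metis inv_solve_right m_closed)
  then show ?thesis
    using assms by (metis inv_mult_group inv_solve_left m_assoc m_closed rfl_rep(1) inv_closed rfl_inv rfl_sq)
qed

definition rcov :: "'a \<Rightarrow> 'a \<Rightarrow> bool" where
  "rcov a b \<longleftrightarrow> a \<in> carrier W \<and> b \<in> carrier W \<and> (\<exists>t \<in> reflections W S. b = t \<otimes> a) \<and>
    len b = Suc (len a)"

lemma rcov_root:
  assumes "rcov a b"
  shows "\<exists>\<beta>\<in>roots. vpos \<beta> \<and> b = rfl \<beta> \<otimes> a \<and> a = rfl \<beta> \<otimes> b"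
proof -
  obtain t where t: "t \<in> reflections W S" "b = t \<otimes> a" using assms by (auto simp: rcov_def)
  obtain \<beta> where b: "\<beta> \<in> roots" "vpos \<beta>" "rfl \<beta> = t" using reflection_root t by blast
  then show ?thesis using t rfl_sq[OF b(1), of a] assms by (intro bexI[of _ \<beta>]) (auto simp: rcov_def)
qed

text \<open>The roots leading from \<open>b1\<close> to the three elements lie in one plane and give
  covers, so each has extreme slope among the inversions of \<open>b1\<close>. Three distinct slopes
  cannot all be extreme.\<close>

lemma rcov_K32:
  assumes b: "b1 \<noteq> b2" and a: "a1 \<noteq> a2" "a1 \<noteq> a3" "a2 \<noteq> a3"
    and c1: "rcov a1 b1" "rcov a2 b1" "rcov a3 b1"
    and c2: "rcov a1 b2" "rcov a2 b2" "rcov a3 b2"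
  shows False
proof -
  have car: "b1 \<in> carrier W" "b2 \<in> carrier W" using c1 c2 by (auto simp: rcov_def)
  have "\<exists>\<alpha> \<gamma>. \<alpha> \<in> roots \<and> vpos \<alpha> \<and> rfl \<alpha> \<otimes> b1 = a \<and> \<gamma> \<in> roots \<and> vpos \<gamma> \<and> rfl \<gamma> \<otimes> b2 = a"
    if "rcov a b1" "rcov a b2" for a
    using rcov_root[OF that(1)] rcov_root[OF that(2)] by metis
  then obtain \<alpha>1 \<gamma>1 \<alpha>2 \<gamma>2 \<alpha>3 \<gamma>3 where
    r1: "\<alpha>1 \<in> roots" "vpos \<alpha>1" "rfl \<alpha>1 \<otimes> b1 = a1" "\<gamma>1 \<in> roots" "vpos \<gamma>1" "rfl \<gamma>1 \<otimes> b2 = a1" and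
    r2: "\<alpha>2 \<in> roots" "vpos \<alpha>2" "rfl \<alpha>2 \<otimes> b1 = a2" "\<gamma>2 \<in> roots" "vpos \<gamma>2" "rfl \<gamma>2 \<otimes> b2 = a2" and
    r3: "\<alpha>3 \<in> roots" "vpos \<alpha>3" "rfl \<alpha>3 \<otimes> b1 = a3" "\<gamma>3 \<in> roots" "vpos \<gamma>3" "rfl \<gamma>3 \<otimes> b2 = a3"
    using c1 c2 by metis
  have ne: "\<alpha> \<noteq> \<gamma>" if "\<alpha> \<in> roots" "rfl \<alpha> \<otimes> b1 = rfl \<gamma> \<otimes> b2" for \<alpha> \<gamma>
    using that b car rfl_sq by metis
  obtain i j where D: "det2 i j \<alpha>1 \<gamma>1 \<noteq> 0" using det2_exists r1 ne by metis
  have inp: "\<alpha> \<in> plane_inversions \<alpha>1 \<gamma>1 b1"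
    if "\<alpha> \<in> roots" "vpos \<alpha>" "rfl \<alpha> \<otimes> b1 = a" "\<gamma> \<in> roots" "vpos \<gamma>" "rfl \<gamma> \<otimes> b2 = a" "rcov a b1" for \<alpha> \<gamma> a
  proof -
    have "rfl \<alpha>1 \<otimes> rfl \<gamma>1 = rfl \<alpha> \<otimes> rfl \<gamma>"
      using rfl_eq_product[of \<alpha>1 \<gamma>1 b1 b2] rfl_eq_product[of \<alpha> \<gamma> b1 b2] r1 that car by simp
    moreover have "\<alpha> \<noteq> \<gamma>" using ne[OF that(1)] that by simp
    ultimately have "\<alpha> \<in> plane \<alpha>1 \<gamma>1"
      using rfl_product_plane(1)[OF r1(1,4) that(1,4,2,5)] by simp
    moreover have "vneg (rep (inv b1) \<alpha>)"
      using len_rfl(1)[OF car(1) that(1,2)] that by (simp add: rcov_def)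
    ultimately show ?thesis using that by (simp add: plane_inversions_def[OF D] plane_roots_def[OF D])
  qed
  have p: "\<alpha>1 \<in> plane_inversions \<alpha>1 \<gamma>1 b1" "\<alpha>2 \<in> plane_inversions \<alpha>1 \<gamma>1 b1" "\<alpha>3 \<in> plane_inversions \<alpha>1 \<gamma>1 b1"
    using inp[OF r1] inp[OF r2] inp[OF r3] c1 by auto
  define s where "s = slope i j"
  have ext: "(\<forall>\<gamma>\<in>plane_inversions \<alpha>1 \<gamma>1 b1. s \<gamma> \<le> s \<alpha>) \<or> (\<forall>\<gamma>\<in>plane_inversions \<alpha>1 \<gamma>1 b1. s \<alpha> \<le> s \<gamma>)"
    if "\<alpha> \<in> plane_inversions \<alpha>1 \<gamma>1 b1" "rfl \<alpha> \<otimes> b1 = a" "rcov a b1" for \<alpha> a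
    unfolding s_def using cover_extremal[OF D car(1) that(1)] that by (simp add: rcov_def)
  have "\<alpha>1 \<noteq> \<alpha>2" "\<alpha>1 \<noteq> \<alpha>3" "\<alpha>2 \<noteq> \<alpha>3" using a r1 r2 r3 by auto
  then have "s \<alpha>1 \<noteq> s \<alpha>2" "s \<alpha>1 \<noteq> s \<alpha>3" "s \<alpha>2 \<noteq> s \<alpha>3"
    unfolding s_def using slope_inj[OF D] p by (auto simp: plane_inversions_def[OF D])
  moreover have "(s \<alpha>2 \<le> s \<alpha>1 \<and> s \<alpha>3 \<le> s \<alpha>1) \<or> (s \<alpha>1 \<le> s \<alpha>2 \<and> s \<alpha>1 \<le> s \<alpha>3)"
    "(s \<alpha>1 \<le> s \<alpha>2 \<and> s \<alpha>3 \<le> s \<alpha>2) \<or> (s \<alpha>2 \<le> s \<alpha>1 \<and> s \<alpha>2 \<le> s \<alpha>3)"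
    "(s \<alpha>1 \<le> s \<alpha>3 \<and> s \<alpha>2 \<le> s \<alpha>3) \<or> (s \<alpha>3 \<le> s \<alpha>1 \<and> s \<alpha>3 \<le> s \<alpha>2)"
    using ext[OF p(1) r1(3) c1(1)] ext[OF p(2) r2(3) c1(2)] ext[OF p(3) r3(3) c1(3)] p by blast+
  ultimately show False by linarith
qed

text \<open>For each of the three upper elements, one of its two roots is globally extremal. By the
  pigeonhole principle two of these belong to the same lower element, where
  \<open>two_global_extremal\<close> gives the contradiction.\<close>

lemma rcov_K23:
  assumes b: "b1 \<noteq> b2" and a: "a1 \<noteq> a2" "a1 \<noteq> a3" "a2 \<noteq> a3"
    and c1: "rcov b1 a1" "rcov b1 a2" "rcov b1 a3"
    and c2: "rcov b2 a1" "rcov b2 a2" "rcov b2 a3"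
  shows False
proof -
  have car: "b1 \<in> carrier W" "b2 \<in> carrier W" using c1 c2 by (auto simp: rcov_def)
  define Q where "Q = (\<lambda>\<alpha> \<gamma> a. \<alpha> \<in> roots \<and> vpos \<alpha> \<and> rfl \<alpha> \<otimes> b1 = a \<and> \<gamma> \<in> roots \<and> vpos \<gamma> \<and> rfl \<gamma> \<otimes> b2 = a
    \<and> rcov b1 a \<and> rcov b2 a)"
  have "\<exists>\<alpha> \<gamma>. Q \<alpha> \<gamma> a" if "rcov b1 a" "rcov b2 a" for a
    using rcov_root[OF that(1)] rcov_root[OF that(2)] that unfolding Q_def by metis
  then obtain \<alpha>1 \<gamma>1 \<alpha>2 \<gamma>2 \<alpha>3 \<gamma>3 where Q: "Q \<alpha>1 \<gamma>1 a1" "Q \<alpha>2 \<gamma>2 a2" "Q \<alpha>3 \<gamma>3 a3"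
    using c1 c2 by metis
  have ne: "\<alpha> \<noteq> \<gamma>" if "Q \<alpha> \<gamma> a" for \<alpha> \<gamma> a
    using that b car rfl_sq unfolding Q_def by metis
  have r1: "\<alpha>1 \<in> roots" "vpos \<alpha>1" "rfl \<alpha>1 \<otimes> b1 = a1" "\<gamma>1 \<in> roots" "vpos \<gamma>1" "rfl \<gamma>1 \<otimes> b2 = a1"
    using Q(1) by (auto simp: Q_def)
  obtain i j where D: "det2 i j \<alpha>1 \<gamma>1 \<noteq> 0" using det2_exists r1 ne[OF Q(1)] by metis
  let ?P = "plane_inversions \<alpha>1 \<gamma>1" and ?R = "plane_roots \<alpha>1 \<gamma>1" and ?E = "globally_extremal \<alpha>1 \<gamma>1 i j"
  have inp: "\<alpha> \<in> ?P a \<and> \<gamma> \<in> ?P a \<and> \<alpha> \<in> ?R \<and> \<gamma> \<in> ?R \<and> vpos (rep (inv b1) \<alpha>) \<and> vpos (rep (inv b2) \<gamma>) \<and>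
      (?E \<alpha> \<or> ?E \<gamma>)" if q: "Q \<alpha> \<gamma> a" for \<alpha> \<gamma> a
  proof -
    have r: "\<alpha> \<in> roots" "vpos \<alpha>" "rfl \<alpha> \<otimes> b1 = a" "\<gamma> \<in> roots" "vpos \<gamma>" "rfl \<gamma> \<otimes> b2 = a"
      "len a = Suc (len b1)" "len a = Suc (len b2)" "a \<in> carrier W"
      using q by (auto simp: Q_def rcov_def)
    have bk: "rfl \<alpha> \<otimes> a = b1" "rfl \<gamma> \<otimes> a = b2" using rfl_sq[OF r(1) car(1)] rfl_sq[OF r(4) car(2)] by (simp_all only: r(3,6))
    have "rfl \<alpha>1 \<otimes> rfl \<gamma>1 = rfl \<alpha> \<otimes> rfl \<gamma>"
      using rfl_eq_product[of \<alpha>1 \<gamma>1 b1 b2] rfl_eq_product[of \<alpha> \<gamma> b1 b2] r1 r car by simp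
    then have pl: "\<alpha> \<in> plane \<alpha>1 \<gamma>1" "\<gamma> \<in> plane \<alpha>1 \<gamma>1"
      using rfl_product_plane[OF r1(1,4) r(1,4,2,5) ne[OF q]] by simp_all
    have "vneg (rep (inv a) \<alpha>)" "vneg (rep (inv a) \<gamma>)"
      using len_rfl(1)[OF r(9) r(1,2)] len_rfl(1)[OF r(9) r(4,5)] r bk by simp_all
    then have P: "\<alpha> \<in> ?P a" "\<gamma> \<in> ?P a" "\<alpha> \<in> ?R" "\<gamma> \<in> ?R" using r pl by (simp_all add: plane_inversions_def[OF D] plane_roots_def[OF D])
    moreover have "vpos (rep (inv b1) \<alpha>)" "vpos (rep (inv b2) \<gamma>)"
      using len_rfl(2)[OF car(1) r(1,2)] len_rfl(2)[OF car(2) r(4,5)] r by simp_all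
    moreover have "?E \<alpha> \<or> ?E \<gamma>"
      using pair_global_extremal[OF D r(9) P(1) _ P(2) _ ne[OF q]] r bk by simp
    ultimately show ?thesis by blast
  qed
  have two: False if q: "Q \<alpha> \<gamma> a" "Q \<alpha>' \<gamma>' a'" "a \<noteq> a'" "?E \<alpha> \<and> ?E \<alpha>' \<or> ?E \<gamma> \<and> ?E \<gamma>'" for \<alpha> \<gamma> a \<alpha>' \<gamma>' a'
  proof -
    have n: "\<alpha> \<noteq> \<alpha>'" "\<gamma> \<noteq> \<gamma>'" using q unfolding Q_def by auto
    have e: "rfl \<alpha> \<otimes> b1 = a" "rfl \<gamma> \<otimes> b2 = a" using q by (auto simp: Q_def)
    show False
      using q(4)
    proof
      assume "?E \<alpha> \<and> ?E \<alpha>'"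
      then show False
        by (intro two_global_extremal[OF D car(1), of \<alpha> \<alpha>' \<gamma>])
          (use inp[OF q(1)] inp[OF q(2)] n ne[OF q(1)] e in auto)
    next
      assume "?E \<gamma> \<and> ?E \<gamma>'"
      then show False
        by (intro two_global_extremal[OF D car(2), of \<gamma> \<gamma>' \<alpha>])
          (use inp[OF q(1)] inp[OF q(2)] n ne[OF q(1)] e in auto)
    qed
  qed
  show False
    using two[OF Q(1,2) a(1)] two[OF Q(1,3) a(2)] two[OF Q(2,3) a(3)] inp[OF Q(1)] inp[OF Q(2)] inp[OF Q(3)]
    by blast
qed

end

section \<open>The Bruhat order\<close>

context coxeter_system
begin

abbreviation le :: "'a \<Rightarrow> 'a \<Rightarrow> bool" where "le \<equiv> bruhat_le W S"

abbreviation step :: "'a \<Rightarrow> 'a \<Rightarrow> bool" where "step \<equiv> bruhat_step W S"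

lemma step_iff:
  "step x y \<longleftrightarrow> x \<in> carrier W \<and> (\<exists>\<beta>\<in>roots. vpos \<beta> \<and> y = rfl \<beta> \<otimes> x \<and> vpos (rep (inv x) \<beta>))"
proof
  assume s: "step x y"
  then obtain t where t: "x \<in> carrier W" "t \<in> reflections W S" "y = t \<otimes> x" "len x < len y"
    by (auto simp: bruhat_step_def)
  then obtain \<beta> where "\<beta> \<in> roots" "vpos \<beta>" "rfl \<beta> = t" using reflection_root by blast
  then show "x \<in> carrier W \<and> (\<exists>\<beta>\<in>roots. vpos \<beta> \<and> y = rfl \<beta> \<otimes> x \<and> vpos (rep (inv x) \<beta>))"
    using len_rfl(2) t by auto
next
  assume "x \<in> carrier W \<and> (\<exists>\<beta>\<in>roots. vpos \<beta> \<and> y = rfl \<beta> \<otimes> x \<and> vpos (rep (inv x) \<beta>))"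
  then show "step x y" unfolding bruhat_step_def using len_rfl(2) rfl_rep by fastforce
qed

text \<open>Conjugation by \<open>s\<close> moves the root \<beta> to its image under \<sigma> of
  \<open>s\<close>, which stays positive unless \<beta> is the simple root of \<open>s\<close>; that
  is the excluded case \<open>y = s \<otimes> x\<close>.\<close>

lemma step_left:
  assumes "step x y" "s \<in> S" "y \<noteq> s \<otimes> x"
  shows "step (s \<otimes> x) (s \<otimes> y)"
proof -
  obtain \<beta> where b: "x \<in> carrier W" "\<beta> \<in> roots" "vpos \<beta>" "y = rfl \<beta> \<otimes> x" "vpos (rep (inv x) \<beta>)"
    using assms(1) step_iff by blast
  have "\<beta> \<noteq> simple s" using assms b rfl_simple by auto
  then have p: "vpos (\<sigma> s \<beta>)" using simple_unique_sign_change b assms by blast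
  have r: "\<sigma> s \<beta> \<in> roots" using root_rep[OF b(2), of s] assms by (simp add: rep_S)
  have "rfl (\<sigma> s \<beta>) = s \<otimes> rfl \<beta> \<otimes> s"
    using rfl_conj[OF b(2), of s] assms by (simp add: rep_S S_inv)
  then have y: "s \<otimes> y = rfl (\<sigma> s \<beta>) \<otimes> (s \<otimes> x)"
    using b assms rfl_rep(1)[OF b(2)] by (simp add: m_assoc)
  have "rep (inv (s \<otimes> x)) (\<sigma> s \<beta>) = rep (inv x) \<beta>"
    using b assms by (simp only: inv_mult_group S_closed S_inv rep_mult inv_closed rep_S \<sigma>_invol)
  then show ?thesis using y p r b assms unfolding step_iff by auto
qed

text \<open>The root \<beta> stays, and its image under the inverse of \<open>x\<close> is moved by
  \<sigma> of \<open>p\<close>. The excluded case is the one where this image is the simple root of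
  \<open>p\<close>.\<close>

lemma step_right:
  assumes "step x y" "p \<in> S" "y \<noteq> x \<otimes> p"
  shows "step (x \<otimes> p) (y \<otimes> p)"
proof -
  obtain \<beta> where b: "x \<in> carrier W" "\<beta> \<in> roots" "vpos \<beta>" "y = rfl \<beta> \<otimes> x" "vpos (rep (inv x) \<beta>)"
    using assms(1) step_iff by blast
  have ix: "inv x \<in> carrier W" using b by simp
  have "rep (inv x) \<beta> \<noteq> simple p"
  proof
    assume "rep (inv x) \<beta> = simple p"
    then have "p = inv x \<otimes> rfl \<beta> \<otimes> x" using rfl_conj[OF b(2) ix] rfl_simple assms b by simp
    then have "x \<otimes> p = x \<otimes> (inv x \<otimes> (rfl \<beta> \<otimes> x))" using b rfl_rep(1)[OF b(2)] by (simp add: m_assoc)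
    also have "\<dots> = y" using b rfl_rep(1)[OF b(2)] by (simp add: m_assoc[symmetric])
    finally show False using assms by simp
  qed
  then have p: "vpos (\<sigma> p (rep (inv x) \<beta>))"
    using simple_unique_sign_change[OF root_rep[OF b(2) ix] b(5)] assms by blast
  have "rep (inv (x \<otimes> p)) \<beta> = \<sigma> p (rep (inv x) \<beta>)"
    using b assms by (simp only: inv_mult_group S_closed S_inv rep_mult inv_closed rep_S)
  moreover have "y \<otimes> p = rfl \<beta> \<otimes> (x \<otimes> p)" using b assms rfl_rep(1)[OF b(2)] by (simp add: m_assoc)
  ultimately show ?thesis using p b assms unfolding step_iff by auto
qed

lemma step_closed: "step x y \<Longrightarrow> x \<in> carrier W \<and> y \<in> carrier W" and step_len: "step x y \<Longrightarrow> len x < len y"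
  by (simp_all add: bruhat_step_def)

lemma le_refl: "x \<in> carrier W \<Longrightarrow> le x x"
  by (simp add: bruhat_le_def)

lemma step_le: "step x y \<Longrightarrow> le x y"
  using step_closed by (auto simp: bruhat_le_def)

lemma le_trans: "le x y \<Longrightarrow> le y z \<Longrightarrow> le x z"
  by (auto simp: bruhat_le_def)

lemma le_closed: "le x y \<Longrightarrow> x \<in> carrier W \<and> y \<in> carrier W"
proof -
  assume "le x y"
  then have "(bruhat_step W S)\<^sup>*\<^sup>* x y" "x \<in> carrier W" by (auto simp: bruhat_le_def)
  then show ?thesis by (induction rule: rtranclp_induct) (use step_closed in auto)
qed

lemma le_len: "le x y \<Longrightarrow> x = y \<or> len x < len y"
proof -
  assume "le x y"
  then have "(bruhat_step W S)\<^sup>*\<^sup>* x y" by (auto simp: bruhat_le_def)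
  then show ?thesis by (induction rule: rtranclp_induct) (use step_len less_trans in blast)+
qed

lemma le_eq: "le x y \<Longrightarrow> len x = len y \<Longrightarrow> x = y"
  using le_len by fastforce

lemma le_cover_step:
  assumes "le x y" "len y = Suc (len x)"
  shows "step x y"
proof -
  have "(bruhat_step W S)\<^sup>*\<^sup>* x y" "x \<noteq> y" using assms by (auto simp: bruhat_le_def)
  then obtain z where z: "step x z" "(bruhat_step W S)\<^sup>*\<^sup>* z y" by (metis converse_rtranclpE)
  then have "le z y" using step_closed by (auto simp: bruhat_le_def)
  then have "z = y" using le_len[of z y] step_len[OF z(1)] assms by auto
  then show ?thesis using z by simp
qed

text \<open>Every step of a chain can be moved by \<open>m\<close>, except a step from some a to
  \<open>m a\<close>, where the moved chain joins the given one. Left and right multiplications are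
  the two instances.\<close>

lemma le_involution:
  assumes m: "\<And>x. x \<in> carrier W \<Longrightarrow> m x \<in> carrier W"
    and mm: "\<And>x. x \<in> carrier W \<Longrightarrow> m (m x) = x"
    and st: "\<And>x y. step x y \<Longrightarrow> y \<noteq> m x \<Longrightarrow> step (m x) (m y)"
    and xy: "le x y"
  shows "le (m x) y \<or> le (m x) (m y)" and "le x (m y) \<or> le (m x) (m y)"
proof -
  have s: "(bruhat_step W S)\<^sup>*\<^sup>* x y" "y \<in> carrier W" "x \<in> carrier W"
    using xy le_closed[OF xy] by (auto simp: bruhat_le_def)
  show "le (m x) y \<or> le (m x) (m y)"
    using s(1)
  proof (induction rule: converse_rtranclp_induct)
    case base
    show ?case using le_refl[OF m] s by blast
  next
    case (step a b)
    show ?case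
    proof (cases "b = m a")
      case True
      have "b \<in> carrier W" using step_closed step.hyps(1) by blast
      then show ?thesis using True step.hyps(2) by (simp add: bruhat_le_def)
    next
      case False
      have "le (m a) (m b)" by (rule step_le[OF st[OF step.hyps(1) False]])
      then show ?thesis using step.IH le_trans by blast
    qed
  qed
  show "le x (m y) \<or> le (m x) (m y)"
    using s(1)
  proof (induction rule: rtranclp_induct)
    case base
    show ?case using le_refl[OF m] s by blast
  next
    case (step a b)
    show ?case
    proof (cases "b = m a")
      case True
      then have "m b = a" using mm step_closed[OF step.hyps(2)] by simp
      then show ?thesis using step.hyps(1) s(3) by (simp add: bruhat_le_def)
    next
      case False
      have "le (m a) (m b)" by (rule step_le[OF st[OF step.hyps(2) False]])
      then show ?thesis using step.IH le_trans by blast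
    qed
  qed
qed

lemma left_step:
  assumes "s \<in> S" "x \<in> carrier W" "len x < len (s \<otimes> x)"
  shows "step x (s \<otimes> x)"
proof -
  have "s \<in> reflections W S" using rfl_rep(3)[OF simple_root[OF assms(1)]] rfl_simple assms by simp
  then show ?thesis using assms by (auto simp: bruhat_step_def)
qed

lemma left_le: "s \<in> S \<Longrightarrow> x \<in> carrier W \<Longrightarrow> len (s \<otimes> x) < len x \<Longrightarrow> le (s \<otimes> x) x"
  using step_le[OF left_step[of s "s \<otimes> x"]] by simp

lemma le_left:
  assumes "s \<in> S" "le x y"
  shows "le (s \<otimes> x) y \<or> le (s \<otimes> x) (s \<otimes> y)" "le x (s \<otimes> y) \<or> le (s \<otimes> x) (s \<otimes> y)"
  using le_involution[of "\<lambda>x. s \<otimes> x", OF _ _ _ assms(2)] assms step_left by simp_all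

lemma le_right:
  assumes "s \<in> S" "le x y"
  shows "le (x \<otimes> s) y \<or> le (x \<otimes> s) (y \<otimes> s)"
  using le_involution(1)[of "\<lambda>x. x \<otimes> s", OF _ _ _ assms(2)] assms step_right by simp

section \<open>Lifting property, chains and intervals of length two\<close>

lemma lift_mult: "s \<in> S \<Longrightarrow> len (s \<otimes> y) < len y \<Longrightarrow> le x y \<Longrightarrow> le (s \<otimes> x) y"
  using le_left(1) left_le le_trans le_closed by metis

lemma lift_up: "s \<in> S \<Longrightarrow> len (s \<otimes> y) < len y \<Longrightarrow> le x y \<Longrightarrow> len x < len (s \<otimes> x) \<Longrightarrow> le x (s \<otimes> y)"
  using le_left(2) step_le[OF left_step] le_trans le_closed by metis

lemma lift_down: "s \<in> S \<Longrightarrow> len (s \<otimes> y) < len y \<Longrightarrow> le x y \<Longrightarrow> len (s \<otimes> x) < len x \<Longrightarrow> le (s \<otimes> x) (s \<otimes> y)"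
  using le_left(2) left_le le_trans le_closed by metis

text \<open>Take a left descent \<open>s\<close> of \<open>y\<close>. If \<open>s\<close> raises
  \<open>x\<close>, then \<open>s \<otimes> y\<close> serves. Otherwise a coatom \<open>z\<close> of
  \<open>s \<otimes> y\<close> above \<open>s \<otimes> x\<close> exists by induction: if
  \<open>s\<close> raises \<open>z\<close>, then \<open>s \<otimes> z\<close> serves, and if not,
  \<open>x\<close> is below \<open>s \<otimes> y\<close> after all.\<close>

lemma coatom_exists:
  assumes "le x y" "x \<noteq> y"
  shows "\<exists>z. le x z \<and> le z y \<and> len y = Suc (len z)"
  using assms
proof (induction "len y" arbitrary: x y rule: less_induct)
  case less
  have car: "x \<in> carrier W" "y \<in> carrier W" using le_closed less by blast+
  have "y \<noteq> \<one>" using le_len[OF less.prems(1)] less.prems(2) by auto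
  then obtain s where s: "s \<in> S" "len y = Suc (len (s \<otimes> y))" using descent_exists car by blast
  then have sy: "len (s \<otimes> y) < len y" "le (s \<otimes> y) y" using left_le car by auto
  show ?case
  proof (cases "len x < len (s \<otimes> x)")
    case True
    then show ?thesis using lift_up s sy less.prems by blast
  next
    case False
    then have sx: "len (s \<otimes> x) < len x" using len_cases[OF s(1) car(1)] by auto
    have l: "le (s \<otimes> x) (s \<otimes> y)" using lift_down s sy sx less.prems by blast
    have "s \<otimes> x \<noteq> s \<otimes> y" using less.prems car s by (metis S_cancel)
    then obtain z where z: "le (s \<otimes> x) z" "le z (s \<otimes> y)" "len (s \<otimes> y) = Suc (len z)"
      using less.hyps[OF sy(1) l] by blast
    have zc: "z \<in> carrier W" using z le_closed by blast
    have zy: "le z y" using z sy le_trans by blast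
    show ?thesis
    proof (cases "len z < len (s \<otimes> z)")
      case True
      have "le (s \<otimes> x) (s \<otimes> z)" using z(1) step_le[OF left_step[OF s(1) zc True]] le_trans by blast
      then have "le (s \<otimes> (s \<otimes> x)) (s \<otimes> z)" by (rule lift_mult[rotated 2]) (use s zc True in simp_all)
      moreover have "le (s \<otimes> z) y" using lift_mult s sy zy by blast
      ultimately show ?thesis
        using s z True len_cases[OF s(1) zc] car by (intro exI[of _ "s \<otimes> z"]) auto
    next
      case False
      then have "len (s \<otimes> z) < len z" using len_cases[OF s(1) zc] by auto
      then have "le (s \<otimes> (s \<otimes> x)) z" using lift_mult s z by blast
      then have "le x (s \<otimes> y)" using le_trans[OF _ z(2)] s(1) car(1) by simp
      then show ?thesis using s sy by blast
    qed
  qed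
qed

lemma atom_exists:
  assumes "le x y" "x \<noteq> y"
  shows "\<exists>z. le x z \<and> len z = Suc (len x) \<and> le z y"
  using assms
proof (induction "len y" arbitrary: y rule: less_induct)
  case less
  then obtain z where z: "le x z" "le z y" "len y = Suc (len z)" using coatom_exists by blast
  show ?case
  proof (cases "x = z")
    case True
    then show ?thesis using z less le_closed le_refl by (intro exI[of _ y]) auto
  next
    case False
    then obtain u where "le x u" "len u = Suc (len x)" "le u z"
      using less.hyps[of z] z by auto
    then show ?thesis using le_trans[OF _ z(2)] by blast
  qed
qed

sublocale bru: graded_poset "bruhat_le W S" "cox_length W S"
  by unfold_locales (fact le_trans le_len atom_exists)+

text \<open>Take a left descent \<open>s\<close> of \<open>y\<close>. If \<open>s\<close> raises
  \<open>x\<close>, the middle elements are \<open>s \<otimes> x\<close> and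
  \<open>s \<otimes> y\<close>. Otherwise the two middle elements between
  \<open>s \<otimes> x\<close> and \<open>s \<otimes> y\<close> are known by induction and are
  multiplied by \<open>s\<close>.\<close>

lemma two_middle:
  assumes "le x y" "len y = Suc (Suc (len x))"
  shows "\<exists>a b. a \<noteq> b \<and> (\<forall>z. bru.cov x z \<and> bru.cov z y \<longleftrightarrow> z = a \<or> z = b)"
  using assms
proof (induction "len y" arbitrary: x y rule: less_induct)
  case less
  have car: "x \<in> carrier W" "y \<in> carrier W" using le_closed less by blast+
  have "y \<noteq> \<one>" using less.prems(2) by auto
  then obtain s where s: "s \<in> S" "len y = Suc (len (s \<otimes> y))" using descent_exists car by blast
  then have sy: "len (s \<otimes> y) < len y" "le (s \<otimes> y) y" using left_le car by auto
  have ss: "s \<otimes> (s \<otimes> z) = z" if "z \<in> carrier W" for z using s that by simp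
  have inj: "z = z'" if "s \<otimes> z = s \<otimes> z'" "z \<in> carrier W" "z' \<in> carrier W" for z z'
    using ss that by metis
  have cc: "z \<in> carrier W" "z' \<in> carrier W" if "bru.cov z z'" for z z' using that le_closed by (auto simp: bru.cov_def)
  have top: "z = s \<otimes> y" if "bru.cov x z" "bru.cov z y" "len z < len (s \<otimes> z)" for z
    using lift_up[OF s(1) sy(1), of z] that s le_eq by (auto simp: bru.cov_def)
  show ?case
  proof (cases "len x < len (s \<otimes> x)")
    case True
    have lx: "len (s \<otimes> x) = Suc (len x)" using True len_cases[OF s(1) car(1)] by auto
    have m1: "bru.cov x (s \<otimes> y) \<and> bru.cov (s \<otimes> y) y"
      using lift_up[OF s(1) sy(1) less.prems(1) True] sy s less.prems by (simp add: bru.cov_def)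
    have m2: "bru.cov x (s \<otimes> x) \<and> bru.cov (s \<otimes> x) y"
      using step_le[OF left_step[OF s(1) car(1) True]] lift_mult[OF s(1) sy(1) less.prems(1)] lx less.prems
      by (simp add: bru.cov_def)
    have m3: "z = s \<otimes> x" if z: "bru.cov x z" "bru.cov z y" "\<not> len z < len (s \<otimes> z)" for z
    proof -
      have "len z = Suc (len (s \<otimes> z))" using len_cases[OF s(1) cc(2)[OF z(1)]] z by auto
      moreover from this have "le x (s \<otimes> z)" using lift_up[OF s(1)] z True by (simp add: bru.cov_def)
      ultimately have "x = s \<otimes> z" using z le_eq by (simp add: bru.cov_def)
      then show ?thesis using ss cc z by simp
    qed
    have m4: "s \<otimes> x \<noteq> s \<otimes> y"
    proof
      assume "s \<otimes> x = s \<otimes> y"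
      then have "x = y" using inj car by blast
      then show False using less.prems by simp
    qed
    have "bru.cov x z \<and> bru.cov z y \<longleftrightarrow> z = s \<otimes> x \<or> z = s \<otimes> y" for z
      using m1 m2 m3[of z] top[of z] by auto
    then show ?thesis using m4 by blast
  next
    case False
    then have sx: "len x = Suc (len (s \<otimes> x))" using len_cases[OF s(1) car(1)] by auto
    have l: "le (s \<otimes> x) (s \<otimes> y)" using lift_down[OF s(1) sy(1) less.prems(1)] sx by simp
    obtain a b where ab: "a \<noteq> b" "\<And>z. bru.cov (s \<otimes> x) z \<and> bru.cov z (s \<otimes> y) \<longleftrightarrow> z = a \<or> z = b"
      using less.hyps[OF sy(1) l] s sx less.prems by auto
    have down: "bru.cov (s \<otimes> x) (s \<otimes> z) \<and> bru.cov (s \<otimes> z) (s \<otimes> y)"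
      if z: "bru.cov x z" "bru.cov z y" "\<not> len z < len (s \<otimes> z)" for z
    proof -
      have lz: "len z = Suc (len (s \<otimes> z))" using len_cases[OF s(1) cc(2)[OF z(1)]] z by auto
      have "le (s \<otimes> x) (s \<otimes> z)" "le (s \<otimes> z) (s \<otimes> y)"
        using lift_down[OF s(1)] z lz sx sy(1) by (simp_all add: bru.cov_def)
      then show ?thesis using z lz sx s by (simp add: bru.cov_def)
    qed
    have raise: "bru.cov x (s \<otimes> c) \<and> bru.cov (s \<otimes> c) y"
      if c: "bru.cov (s \<otimes> x) c" "bru.cov c (s \<otimes> y)" "len c < len (s \<otimes> c)" for c
    proof -
      have cC: "c \<in> carrier W" using cc c by blast
      have lc: "len (s \<otimes> c) = Suc (len c)" using c len_cases[OF s(1) cC] by auto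
      have "le (s \<otimes> x) (s \<otimes> c)"
        using c(1) step_le[OF left_step[OF s(1) cC c(3)]] le_trans by (auto simp: bru.cov_def)
      then have "le x (s \<otimes> c)" using lift_mult[OF s(1), of "s \<otimes> c" "s \<otimes> x"] ss car cC c(3) by simp
      moreover have "le c y" using c(2) sy(2) le_trans by (auto simp: bru.cov_def)
      then have "le (s \<otimes> c) y" using lift_mult s sy by blast
      ultimately show ?thesis using c lc sx s less.prems by (simp add: bru.cov_def)
    qed
    have stay: "le x c" if c: "bru.cov (s \<otimes> x) c" "\<not> len c < len (s \<otimes> c)" for c
    proof -
      have "len (s \<otimes> c) < len c" using len_cases[OF s(1) cc(2)[OF c(1)]] c by auto
      then show ?thesis using lift_mult[OF s(1), of c "s \<otimes> x"] c ss car by (simp add: bru.cov_def)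
    qed
    have abc: "a \<in> carrier W" "b \<in> carrier W" using ab(2) cc by blast+
    show ?thesis
    proof (cases "le x (s \<otimes> y)")
      case False
      have up: "len c < len (s \<otimes> c)" if "bru.cov (s \<otimes> x) c" "bru.cov c (s \<otimes> y)" for c
        using stay that False le_trans unfolding bru.cov_def by blast
      have nt: "\<not> len z < len (s \<otimes> z)" if "bru.cov x z" "bru.cov z y" for z
        using top that False by (auto simp: bru.cov_def)
      have "bru.cov x z \<and> bru.cov z y \<longleftrightarrow> z = s \<otimes> a \<or> z = s \<otimes> b" for z
      proof
        assume z: "bru.cov x z \<and> bru.cov z y"
        then have "s \<otimes> z = a \<or> s \<otimes> z = b" using down nt ab(2) by blast
        moreover have "z \<in> carrier W" using cc z by blast
        ultimately show "z = s \<otimes> a \<or> z = s \<otimes> b" using ss by metis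
      next
        assume "z = s \<otimes> a \<or> z = s \<otimes> b"
        then show "bru.cov x z \<and> bru.cov z y"
          using raise[of a] raise[of b] up[of a] up[of b] ab(2)[of a] ab(2)[of b] by auto
      qed
      moreover have "s \<otimes> a \<noteq> s \<otimes> b" using inj abc ab(1) by blast
      ultimately show ?thesis by blast
    next
      case True
      \<comment> \<open>Here \<open>x\<close> itself is one of the two middle elements of the
        smaller interval. Its product with \<open>s\<close> is too short to lie above
        \<open>x\<close>, and \<open>s \<otimes> y\<close> takes its place.\<close>
      have xm: "bru.cov (s \<otimes> x) x \<and> bru.cov x (s \<otimes> y)"
        using True sx s less.prems left_le[OF s(1) car(1)] by (simp add: bru.cov_def)
      then obtain u where u: "u \<noteq> x" "bru.cov (s \<otimes> x) u" "bru.cov u (s \<otimes> y)"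
        "\<And>z. bru.cov (s \<otimes> x) z \<and> bru.cov z (s \<otimes> y) \<Longrightarrow> z = x \<or> z = u"
        using ab by metis
      have uC: "u \<in> carrier W" using cc u by blast
      have uu: "len u < len (s \<otimes> u)"
      proof (rule ccontr)
        assume "\<not> ?thesis"
        then have "le x u" using stay[OF u(2)] by blast
        then show False using u(1,2) xm le_eq[of x u] by (simp add: bru.cov_def)
      qed
      have "bru.cov x z \<and> bru.cov z y \<longleftrightarrow> z = s \<otimes> y \<or> z = s \<otimes> u" for z
      proof
        assume z: "bru.cov x z \<and> bru.cov z y"
        show "z = s \<otimes> y \<or> z = s \<otimes> u"
        proof (cases "len z < len (s \<otimes> z)")
          case False
          then have "s \<otimes> z = x \<or> s \<otimes> z = u" using down[of z] z u(4)[of "s \<otimes> z"] by blast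
          moreover have "z \<in> carrier W" using cc z by blast
          ultimately have "z = s \<otimes> x \<or> z = s \<otimes> u" using ss by metis
          moreover have "z \<noteq> s \<otimes> x" using z sx by (auto simp: bru.cov_def)
          ultimately show ?thesis by blast
        qed (use top z in blast)
      next
        assume "z = s \<otimes> y \<or> z = s \<otimes> u"
        moreover have "bru.cov x (s \<otimes> y) \<and> bru.cov (s \<otimes> y) y" using xm sy s by (simp add: bru.cov_def)
        ultimately show "bru.cov x z \<and> bru.cov z y" using raise[OF u(2,3) uu] by auto
      qed
      moreover have "s \<otimes> y \<noteq> s \<otimes> u"
      proof
        assume "s \<otimes> y = s \<otimes> u"
        then have "y = u" using inj uC car by blast
        then show False using u(3) s by (simp add: bru.cov_def)
      qed
      ultimately show ?thesis by blast
    qed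
  qed
qed

lemma cv_rcov: "bru.cov x y \<Longrightarrow> rcov x y"
  using le_cover_step[of x y] by (auto simp: bru.cov_def rcov_def bruhat_step_def)

lemma thin: "thin_poset (bruhat_le W S) (cox_length W S)"
proof (unfold_locales, goal_cases)
  case (1 x u y)
  then have "le x y" "len y = Suc (Suc (len x))"
    using le_trans[of x u y] by (simp_all add: bru.cov_def)
  then obtain a b where ab: "a \<noteq> b" "\<And>z. bru.cov x z \<and> bru.cov z y \<longleftrightarrow> z = a \<or> z = b"
    using two_middle by metis
  then show ?case using 1 by metis
next
  case (2 b1 b2 a1 a2 a3)
  then show ?case using rcov_K32[of b1 b2 a1 a2 a3] cv_rcov by blast
next
  case (3 b1 b2 a1 a2 a3)
  then show ?case using rcov_K23[of b1 b2 a1 a2 a3] cv_rcov by blast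
qed

section \<open>Special matchings of lower intervals\<close>

text \<open>By the lifting property an \<open>f\<close> that lowers \<open>w\<close> preserves the
  interval below \<open>w\<close>; this is how the induction hypothesis for a shorter element
  becomes applicable.\<close>

lemma restrict_special:
  assumes f: "bru.special Q f" and w: "w \<in> Q" "\<not> bru.up f w"
  shows "bru.special {x. le x w} f"
proof -
  have Q: "x \<in> Q" if "le x w" for x using bru.sp_dec[OF f w(1) that] .
  have "x \<in> {x. le x w}" if "y \<in> {x. le x w}" "le x y" for x y
    using that le_trans by blast
  moreover have "f u \<in> {x. le x w} \<and> f (f u) = u \<and> (bru.cov u (f u) \<or> bru.cov (f u) u)"
    if "u \<in> {x. le x w}" for u
    using that bru.sp_lift[OF f w] bru.sp_inv[OF f] bru.sp_down[OF f] Q by blast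
  moreover have "le (f u) (f v)" if "v \<in> {x. le x w}" "bru.cov u v" "v \<noteq> f u" for u v
    using that bru.sp_le[OF f] Q by blast
  ultimately show ?thesis unfolding bru.special_def by blast
qed

lemma cov_step: "bru.cov u v \<longleftrightarrow> step u v \<and> len v = Suc (len u)"
  using le_cover_step[of u v] step_le[of u v] by (auto simp: bru.cov_def)

lemma cov_left: "s \<in> S \<Longrightarrow> u \<in> carrier W \<Longrightarrow> bru.cov u (s \<otimes> u) \<longleftrightarrow> len u < len (s \<otimes> u)"
  using left_step[of s u] len_cases[of s u] by (auto simp: cov_step bruhat_step_def)

lemma left_special:
  assumes s: "s \<in> S" and w: "w \<in> carrier W" "len (s \<otimes> w) < len w"
  shows "bru.special {x. le x w} ((\<otimes>) s)"
proof -
  have "x \<in> {x. le x w}" if "y \<in> {x. le x w}" "le x y" for x y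
    using that le_trans by blast
  moreover have "s \<otimes> u \<in> {x. le x w} \<and> s \<otimes> (s \<otimes> u) = u \<and> (bru.cov u (s \<otimes> u) \<or> bru.cov (s \<otimes> u) u)"
    if u: "u \<in> {x. le x w}" for u
  proof -
    have c: "u \<in> carrier W" using u le_closed by blast
    have "bru.cov u (s \<otimes> u) \<or> bru.cov (s \<otimes> u) u"
      using cov_left[OF s c] cov_left[OF s, of "s \<otimes> u"] len_cases[OF s c] s c by auto
    then show ?thesis using u lift_mult[OF s w(2)] s c by simp
  qed
  moreover have "le (s \<otimes> u) (s \<otimes> v)" if "bru.cov u v" "v \<noteq> s \<otimes> u" for u v
    using that step_left[of u v s] s step_le cov_step by blast
  ultimately show ?thesis unfolding bru.special_def by blast
qed

lemma len_right: "x \<in> carrier W \<Longrightarrow> p \<in> S \<Longrightarrow> len (x \<otimes> p) = len (p \<otimes> inv x)"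
  using len_inv[of "x \<otimes> p"] by (simp add: inv_mult_group S_inv)

lemma len_right_cases:
  "p \<in> S \<Longrightarrow> x \<in> carrier W \<Longrightarrow> len (x \<otimes> p) = Suc (len x) \<or> len x = Suc (len (x \<otimes> p))"
  using len_cases[of p "inv x"] len_right[of x p] len_inv[of x] by auto

lemma right_step:
  assumes "p \<in> S" "x \<in> carrier W" "len x < len (x \<otimes> p)"
  shows "step x (x \<otimes> p)"
proof -
  have "x \<otimes> p = (x \<otimes> p \<otimes> inv x) \<otimes> x" using assms by (simp add: m_assoc)
  then show ?thesis using assms by (force simp: bruhat_step_def reflections_def)
qed

lemma cov_right: "p \<in> S \<Longrightarrow> u \<in> carrier W \<Longrightarrow> bru.cov u (u \<otimes> p) \<longleftrightarrow> len u < len (u \<otimes> p)"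
  using right_step[of p u] len_right_cases[of p u] by (auto simp: cov_step bruhat_step_def)

lemma right_special:
  assumes p: "p \<in> S" and w: "w \<in> carrier W" "len (w \<otimes> p) < len w"
  shows "bru.special {x. le x w} (\<lambda>x. x \<otimes> p)"
proof -
  have wp: "le (w \<otimes> p) w" using step_le[OF right_step[OF p, of "w \<otimes> p"]] w p by simp
  have "x \<in> {x. le x w}" if "y \<in> {x. le x w}" "le x y" for x y
    using that le_trans by blast
  moreover have "u \<otimes> p \<in> {x. le x w} \<and> u \<otimes> p \<otimes> p = u \<and> (bru.cov u (u \<otimes> p) \<or> bru.cov (u \<otimes> p) u)"
    if u: "u \<in> {x. le x w}" for u
  proof -
    have c: "u \<in> carrier W" using u le_closed by blast
    have "bru.cov u (u \<otimes> p) \<or> bru.cov (u \<otimes> p) u"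
      using cov_right[OF p c] cov_right[OF p, of "u \<otimes> p"] len_right_cases[OF p c] p c by auto
    moreover have "le (u \<otimes> p) w" using u le_right[OF p, of u w] wp le_trans by blast
    ultimately show ?thesis using p c by simp
  qed
  moreover have "le (u \<otimes> p) (v \<otimes> p)" if "bru.cov u v" "v \<noteq> u \<otimes> p" for u v
    using that step_right[of u v p] p step_le cov_step by blast
  ultimately show ?thesis unfolding bru.special_def by blast
qed

section \<open>R-polynomials along special matchings\<close>

text \<open>By lifting, \<open>f\<close> preserves the set of elements below \<open>y\<close>, so
  neither \<open>x\<close> nor \<open>f x\<close> lies below \<open>y\<close> or \<open>f y\<close>,
  and all terms vanish.\<close>

lemma R_outside:
  assumes R: "R_polynomials W S R" and f: "bru.special Q f" and y: "y \<in> Q" "\<not> bru.up f y"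
    and x: "x \<in> Q" "\<not> le x y" and Q: "Q \<subseteq> carrier W"
  shows "R x y = bru.hecke q f (\<lambda>u. R u (f y)) x"
proof -
  have R0: "R u v = 0" if "u \<in> Q" "v \<in> Q" "\<not> le u v" for u v
    using R that Q unfolding R_polynomials_def by blast
  have fy: "le (f y) y" using bru.sp_down[OF f y] bru.cov_le by blast
  have fQ: "f x \<in> Q" "f y \<in> Q" using bru.sp_Q[OF f] x y by auto
  have "\<not> le (f x) y" using bru.sp_lift[OF f y, of "f x"] bru.sp_inv[OF f x(1)] x(2) by auto
  then have "\<not> le x (f y)" "\<not> le (f x) (f y)" using fy le_trans x(2) by blast+
  then show ?thesis using R0 x y fQ by (simp add: bru.hecke_def)
qed

text \<open>When \<open>s\<close> raises \<open>x\<close> this is the second recursion; when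
  \<open>s\<close> lowers \<open>x\<close> it is the first one, taken at
  \<open>s \<otimes> x\<close>.\<close>

lemma R_left:
  assumes R: "R_polynomials W S R" and s: "s \<in> S" and w: "w \<in> carrier W" "len (s \<otimes> w) < len w"
    and x: "x \<in> carrier W"
  shows "R x w = bru.hecke [:0, 1:] ((\<otimes>) s) (\<lambda>u. R u (s \<otimes> w)) x"
proof -
  have r: "R (s \<otimes> a) w = R a (s \<otimes> w) \<and> R a w = ([:0, 1:] - 1) * R a (s \<otimes> w) + [:0, 1:] * R (s \<otimes> a) (s \<otimes> w)"
    if "a \<in> carrier W" "len a < len (s \<otimes> a)" for a
    using R that s w unfolding R_polynomials_def by (metis S_cancel S_closed m_closed)
  show ?thesis
  proof (cases "len x < len (s \<otimes> x)")
    case True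
    then show ?thesis using r[OF x] cov_left[OF s x] by (simp add: bru.hecke_def)
  next
    case False
    then have "len (s \<otimes> x) < len (s \<otimes> (s \<otimes> x))" using len_cases[OF s x] s x by auto
    then show ?thesis using r[of "s \<otimes> x"] cov_left[OF s x] False s x by (simp add: bru.hecke_def)
  qed
qed

theorem R_special_matching:
  assumes R: "R_polynomials W S R" and w: "w \<in> carrier W"
    and f: "bru.special {x. le x w} f" "\<not> bru.up f w" and x: "le x w"
  shows "R x w = bru.hecke [:0, 1:] f (\<lambda>u. R u (f w)) x"
  using w f x
proof (induction "len w" arbitrary: w f x rule: less_induct)
  case less
  note w = less.prems(1) and f = less.prems(2,3) and x = less.prems(4)
  let ?Q = "{x. le x w}"
  interpret bounded_ideal "bruhat_le W S" "cox_length W S" ?Q "len w"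
  proof -
    interpret thin_poset "bruhat_le W S" "cox_length W S" by (rule thin)
    show "bounded_ideal (bruhat_le W S) (cox_length W S) ?Q (len w)"
      by unfold_locales (use le_len in fastforce)
  qed
  have Qc: "?Q \<subseteq> carrier W" using le_closed by blast
  have wQ: "w \<in> ?Q" using w le_refl by simp
  have below: "R a y = bru.hecke [:0, 1:] P (\<lambda>u. R u (P y)) a"
    if P: "bru.special ?Q P" "a \<in> ?Q" "y \<in> ?Q" "len y < len w" "\<not> bru.up P y" for P a y
  proof (cases "le a y")
    case True
    have "y \<in> carrier W" using P(3) le_closed by blast
    then show ?thesis
      using less.hyps[OF P(4)] restrict_special[OF P(1,3,5)] P(5) True by blast
  next
    case False
    then show ?thesis using R_outside[OF R P(1,3,5,2) _ Qc] by blast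
  qed
  have transfer: "R a w = bru.hecke [:0, 1:] g (\<lambda>u. R u (g w)) a"
    if "bru.special ?Q h" "bru.special ?Q g" "\<not> bru.up h w" "\<not> bru.up g w" "h w \<noteq> g w" "a \<in> ?Q"
      "\<And>b. b \<in> ?Q \<Longrightarrow> R b w = bru.hecke [:0, 1:] h (\<lambda>u. R u (h w)) b" for h g a
    using transfer_matching[OF that(1,2) wQ that(3,4,5) below that(7,6)] by blast
  have left: "bru.special ?Q ((\<otimes>) s)" "\<not> bru.up ((\<otimes>) s) w"
    "\<And>b. b \<in> ?Q \<Longrightarrow> R b w = bru.hecke [:0, 1:] ((\<otimes>) s) (\<lambda>u. R u (s \<otimes> w)) b"
    if "s \<in> S" "len (s \<otimes> w) < len w" for s
    using left_special[OF that(1) w that(2)] cov_left[OF that(1) w] that(2) R_left[OF R that(1) w that(2)] Qc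
    by auto
  have lw: "len w = Suc (len (f w))" using bru.sp_down[OF f(1) wQ f(2)] by (simp add: bru.cov_def)
  then have w1: "w \<noteq> \<one>" by auto
  show ?case
  proof (cases "\<exists>s\<in>S. len (s \<otimes> w) < len w \<and> s \<otimes> w \<noteq> f w")
    case True
    then obtain s where s: "s \<in> S" "len (s \<otimes> w) < len w" "s \<otimes> w \<noteq> f w" by blast
    show ?thesis
      using transfer[OF left(1)[OF s(1,2)] f(1) left(2)[OF s(1,2)] f(2) s(3) _ left(3)[OF s(1,2)]] x by blast
  next
    case noleft: False
    \<comment> \<open>Now every left descent sends \<open>w\<close> to \<open>f w\<close>, and the
      transfer needs distinct images. A right multiplication with another image serves as
      intermediate matching: transfer from left to right, then from right to
      \<open>f\<close>.\<close>
    obtain s where s: "s \<in> S" "len (s \<otimes> w) < len w" using descent_exists[OF w w1] by auto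
    have sf: "s \<otimes> w = f w" using noleft s by blast
    show ?thesis
    proof (cases "\<exists>p\<in>S. len (w \<otimes> p) < len w \<and> w \<otimes> p \<noteq> f w")
      case True
      then obtain p where p: "p \<in> S" "len (w \<otimes> p) < len w" "w \<otimes> p \<noteq> f w" by blast
      have rs: "bru.special ?Q (\<lambda>x. x \<otimes> p)" "\<not> bru.up (\<lambda>x. x \<otimes> p) w"
        using right_special[OF p(1) w p(2)] cov_right[OF p(1) w] p(2) by auto
      have "R b w = bru.hecke [:0, 1:] (\<lambda>x. x \<otimes> p) (\<lambda>u. R u (w \<otimes> p)) b" if "b \<in> ?Q" for b
        using transfer[OF left(1)[OF s] rs(1) left(2)[OF s] rs(2) _ that left(3)[OF s]] p(3) sf by simp
      then show ?thesis
        using transfer[OF rs(1) f(1) rs(2) f(2) p(3)] x by blast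
    next
      case noright: False
      obtain p where p: "p \<in> S" "len (p \<otimes> inv w) < len (inv w)"
        using descent_exists[of "inv w"] w w1 by (metis inv_closed inv_inv inv_one lessI)
      then have pw: "len (w \<otimes> p) < len w" using len_right[OF w p(1)] len_inv[OF w] by simp
      then have pf: "w \<otimes> p = f w" using noright p by blast
      define v where "v = f w"
      have v: "v \<in> carrier W" "w = v \<otimes> p" "s \<otimes> v = w" "len v < len w"
        using w p s pf[symmetric] sf[symmetric] pw S_cancel[OF s(1) w]
        by (simp_all only: v_def m_closed S_closed S_cancel_right)
      \<comment> \<open>A left descent \<open>r\<close> of \<open>v\<close> would also be one of
        \<open>w = v \<otimes> p\<close>, since the right factor adds at most one to the length of
        \<open>r \<otimes> v\<close>. Then \<open>noleft\<close> gives \<open>r = s\<close>, but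
        \<open>s\<close> raises \<open>v\<close>.\<close>
      have "v = \<one>"
      proof (rule ccontr)
        assume "v \<noteq> \<one>"
        then obtain r where r: "r \<in> S" "len v = Suc (len (r \<otimes> v))" using descent_exists v by blast
        have "r \<otimes> w = (r \<otimes> v) \<otimes> p" using r v(1) p v(2) by (simp add: m_assoc)
        then have "len (r \<otimes> w) \<le> Suc (len (r \<otimes> v))"
          using len_right_cases[OF p(1), of "r \<otimes> v"] r v by auto
        then have "len (r \<otimes> w) < len w" using r v by simp
        then have "r \<otimes> w = s \<otimes> w" using noleft r sf by auto
        then have "r = s" using r s w by simp
        then show False using r v by simp
      qed
      \<comment> \<open>The interval is reduced to the identity and a simple reflection, where
        \<open>f\<close> can only be the left multiplication.\<close>
      then have fs: "f w = \<one>" "w = s" using v(3) s(1) by (simp_all add: v_def[symmetric])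
      then have fone: "f \<one> = s" using bru.sp_inv[OF f(1) wQ] by simp
      have "x = w \<or> x = \<one>"
        using le_len[OF x] lw fs(1) len_0[of x] le_closed[OF x] by auto
      then have "f x = s \<otimes> x" using fs fone s S_sq by auto
      moreover have "f w = s \<otimes> w" using sf by simp
      ultimately show ?thesis
        using left(3)[OF s, of x] x by (simp add: bru.hecke_def)
    qed
  qed
qed

section \<open>Distinguished matchings are special\<close>

lemma covered_cov: "bruhat_covered W S x y \<longleftrightarrow> bru.cov x y"
proof
  assume c: "bruhat_covered W S x y"
  then have xy: "le x y" "x \<noteq> y" by (auto simp: bruhat_covered_def bruhat_less_def)
  then obtain z where z: "le x z" "len z = Suc (len x)" "le z y" using atom_exists by blast
  then have "z = y" using c by (auto simp: bruhat_covered_def bruhat_less_def)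
  then show "bru.cov x y" using z by (simp add: bru.cov_def)
next
  assume c: "bru.cov x y"
  then have "x \<noteq> y" "le x y" by (auto simp: bru.cov_def)
  moreover have False if "le x z" "x \<noteq> z" "le z y" "z \<noteq> y" for z
    using le_len[OF that(1)] le_len[OF that(3)] that c by (auto simp: bru.cov_def)
  ultimately show "bruhat_covered W S x y" unfolding bruhat_covered_def bruhat_less_def by blast
qed

lemma matching_special:
  assumes "partial_distinguished_matching W S Q f"
  shows "bru.special Q f"
proof -
  have dec: "x \<in> Q" if "y \<in> Q" "le x y" for x y
    using assms that by (auto simp: partial_distinguished_matching_def decreasing_def)
  have Qf: "f u \<in> Q" "f (f u) = u" "bru.cov u (f u) \<or> bru.cov (f u) u" if "u \<in> Q" for u
    using assms that unfolding partial_distinguished_matching_def covered_cov by blast+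
  have coat: "bru.cov a (f u) \<longleftrightarrow> a = u \<or> (\<exists>v. a = f v \<and> bru.cov v u \<and> bru.cov v (f v))"
    if "u \<in> Q" "bru.cov u (f u)" for u a
  proof -
    have "coat W S (f u) = {u} \<union> {f v | v. bruhat_covered W S v u \<and> bruhat_covered W S v (f v)}"
      using assms that unfolding partial_distinguished_matching_def covered_cov by blast
    then show ?thesis unfolding coat_def covered_cov by blast
  qed
  have "le (f u) (f v)" if v: "v \<in> Q" and c: "bru.cov u v" and n: "v \<noteq> f u" for u v
  proof -
    have u: "u \<in> Q" using dec v c bru.cov_le by blast
    show ?thesis
    proof (cases "bru.cov v (f v)")
      case vup: True
      show ?thesis
      proof (cases "bru.cov u (f u)")
        case True
        then have "bru.cov (f u) (f v)" using coat[OF v vup, of "f u"] c by blast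
        then show ?thesis using bru.cov_le by blast
      next
        case False
        then show ?thesis using Qf(3)[OF u] c vup bru.cov_le le_trans by blast
      qed
    next
      case False
      \<comment> \<open>The coatom condition is read at \<open>f v\<close>, whose partner is
        \<open>v\<close>: a coatom \<open>u\<close> of \<open>v\<close> other than
        \<open>f v\<close> is the image of some \<open>a\<close> covered by \<open>f v\<close>, and
        this \<open>a\<close> is \<open>f u\<close>.\<close>
      then have d: "bru.cov (f v) (f (f v))" using Qf[OF v] by auto
      have "u \<noteq> f v" using n Qf(2)[OF v] by auto
      moreover have "bru.cov u (f (f v))" using c Qf(2)[OF v] by simp
      ultimately obtain a where a: "u = f a" "bru.cov a (f v)"
        using coat[OF Qf(1)[OF v] d, of u] by blast
      have "a \<in> Q" using dec Qf(1)[OF v] a(2) bru.cov_le by blast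
      then show ?thesis using a Qf(2) bru.cov_le by auto
    qed
  qed
  then show ?thesis using dec Qf unfolding bru.special_def by blast
qed

end

theorem mainTheorem2:
  fixes W :: "('a, 'b) monoid_scheme"
    and S Q :: "'a set"
    and \<phi> :: "'a \<Rightarrow> 'a"
    and R :: "'a \<Rightarrow> 'a \<Rightarrow> int poly"
    and x y :: 'a
  assumes "coxeter_system W S"
    and "R_polynomials W S R"
    and "partial_distinguished_matching W S Q \<phi>"
    and "x \<in> Q" and "y \<in> Q"
    and "bruhat_covered W S x (\<phi> x)" and "bruhat_covered W S y (\<phi> y)"
  shows "R (\<phi> x) (\<phi> y) = R x y \<and>
    R x (\<phi> y) = ([:0, 1:] - 1) * R x y + [:0, 1:] * R (\<phi> x) y"
proof -
  interpret coxeter_system W S by fact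
  have sp: "bru.special Q \<phi>" by (rule matching_special) fact
  have up: "bru.up \<phi> x" "bru.up \<phi> y" using assms covered_cov by auto
  have Q: "\<phi> x \<in> Q" "\<phi> y \<in> Q" "Q \<subseteq> carrier W"
    using bru.sp_Q[OF sp] assms by (auto simp: partial_distinguished_matching_def decreasing_def)
  have inv: "\<phi> (\<phi> x) = x" "\<phi> (\<phi> y) = y" using bru.sp_inv[OF sp] assms by auto
  have dn: "\<not> bru.up \<phi> (\<phi> x)" "\<not> bru.up \<phi> (\<phi> y)" using bru.sp_up_iff[OF sp] up assms by auto
  have F: "R a (\<phi> y) = bru.hecke [:0, 1:] \<phi> (\<lambda>u. R u (\<phi> (\<phi> y))) a" if "a \<in> Q" for a
  proof (cases "le a (\<phi> y)")
    case True
    show ?thesis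
      by (rule R_special_matching[OF assms(2) _ restrict_special[OF sp Q(2) dn(2)] dn(2) True]) (use Q in blast)
  next
    case False
    then show ?thesis using R_outside[OF assms(2) sp Q(2) dn(2) that _ Q(3)] by blast
  qed
  \<comment> \<open>At \<phi> x, which is lowered, the operator gives the first formula; at x, which
    is raised, it gives the second.\<close>
  show ?thesis using F[OF assms(4)] F[OF Q(1)] up dn by (simp add: bru.hecke_def inv)
qed

end
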